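(* Let $M$ be a one-cusped hyperbolic $3$-manifold with trivial second homology, $X$ an ordered ideal triangulation of $M$, $\alpha\in\mathscr A_X$ an angle structure and $l$ a peripheral simple closed curve. Suppose that $X$ is FAMED with respect to $l$, and that the following asymptotic expansion holds for $(X,\alpha)$ as $\hbar\to0^+$: $$|\mathscr Z_\hbar(X,\alpha)|=\left|\frac{\exp\left(\frac i\pi R(\mathbf z)\right)}{\det(\mathcal A)\sqrt{2\det\mathbf B^{-1}}}\cdot\frac{\exp\Big(-\frac1{2\pi\hbar}\mathrm{Vol}\big(M;l,\mathrm H^{\mathbb R}_{X,l}(\alpha)\big)\Big)}{\sqrt{\pm\tau(M,l,X,\mathbf z)}}\big(1+O(\hbar)\big)\right|,$$ where $\mathbf z$ are shape parameters on $X$ of a (possibly incomplete) hyperbolic cone structure on $M$ satisfying $\mathrm H^{\mathbb C}_{X,l}(\mathbf z)=i\,\mathrm H^{\mathbb R}_{X,l}(\alpha)$, whose volume is $\mathrm{Vol}(M;l,\mathrm H^{\mathbb R}_{X,l}(\alpha))$, and $\tau(M,l,X,\mathbf z)\neq0$. Then $$\sup\{\mathrm{Vol}(\alpha')\mid\alpha'\in\mathscr A_X,\ \mathrm H^{\mathbb R}_{X,l}(\alpha')=\mathrm H^{\mathbb R}_{X,l}(\alpha)\}\le\mathrm{Vol}\big(M;l,\mathrm H^{\mathbb R}_{X,l}(\alpha)\big).$$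
   Context: **Triangulations.** $M$ is oriented with one torus cusp, complete finite-volume hyperbolic, $H_2(M;\mathbb Z)=0$. An ordered ideal triangulation $X$ of $M$ consists of ideal tetrahedra $T_1,\dots,T_N$, each with an ordering $0,1,2,3$ of its vertices, all faces being glued in pairs respecting the vertex orders, such that the quotient minus the vertices is $M$. $X^2$ is the set of $2N$ faces, $X^1$ the set of $N$ edges after identification. The sign $\varepsilon(T)=+1$ if $\overrightarrow{01},\overrightarrow{02},\overrightarrow{03}$ form a right-handed frame, $-1$ otherwise; $\mathcal E=\mathrm{diag}(\varepsilon(T_k))$. $x_k(T)\in X^2$ is the face of $T$ opposite to vertex $k$, and $\mathcal X_k\in M_{N,2N}(\mathbb Z)$ has $(i,j)$ entry $1$ if the $j$-th face is $x_k(T_i)$, $0$ otherwise. $\mathcal B=\begin{pmatrix}0_N\\ \mathcal E\end{pmatrix}$, $\mathcal A=\begin{pmatrix}\mathcal X_0-\mathcal X_1+\mathcal X_2\\ \mathcal X_2-\mathcal X_3\end{pmatrix}$. **Angle structures.** $\mathscr A_X$ is the set of $\alpha=(a_1,b_1,c_1,\dots,a_N,b_N,c_N)\in(0,\pi)^{3N}$ with $a_k+b_k+c_k=\pi$ such that, putting $a_k$ on edges $01,23$ of $T_k$, $b_k$ on $02,13$, $c_k$ on $03,12$, the angles around every edge of $X$ sum to $2\pi$. **Shapes, holonomy, volume.** A shape parameter $z_k\in\mathbb C\setminus\{0,1\}$ of $T_k$ comes with $z_k'=\frac1{1-z_k}$, $z_k''=\frac{z_k-1}{z_k}$. $z_k$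 sits on edges $01,23$; if $\varepsilon(T_k)=1$, $z_k'$ sits on $03,12$ and $z_k''$ on $02,13$; if $\varepsilon(T_k)=-1$, $z_k'$ sits on $02,13$ and $z_k''$ on $03,12$. $\mathrm{Log}$ is the principal logarithm. For an oriented normal closed curve $\sigma$ in the cusp triangulation of the boundary torus, $\mathrm H^{\mathbb C}_{X,\sigma}(\mathbf z)=\sum\pm\mathrm{Log}$ of the shapes at corners cut off by $\sigma$, sign $+$ (resp. $-$) if the corner is to the left (resp. right); $\mathrm H^{\mathbb R}_{X,\sigma}(\alpha)$ is the same with dihedral angles. $\mathrm{Vol}(\alpha')$ is the sum over $k$ of the volumes of the ideal hyperbolic tetrahedra with dihedral angles $a_k',b_k',c_k'$. **Neumann–Zagier matrices.** Fix $N-1$ independent edges. $\mathbf G,\mathbf G',\mathbf G''\in M_N(\mathbb Z)$ are such that the first $N-1$ entries of $\mathbf G\,\mathbf{Log}\,\mathbf z+\mathbf G'\,\mathbf{Log}\,\mathbf z'+\mathbf G''\,\mathbf{Log}\,\mathbf z''$ are the sums of $\mathrm{Log}$'s around these edges and the last is $\mathrm H^{\mathbb C}_{X,l}(\mathbf z)$; the shapes of the cone structure satisfy that this vector is $(2\pi i,\dots,2\pi i,i\,\mathrm H^{\mathbb R}_{X,l}(\alpha))^\top$. $\mathbf A=\mathbf G-\mathbf G'$, $\mathbf B=\mathbf G''-\mathbf G'$. **FAMED.** $X$ is FAMED with respect to $l$ if $\mathscr A_X\ne\emptyset$, $\det\mathcal A\neq0$, $\det\mathbf B\ne0$, and $\mathbf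 B^{-1}\mathbf A=\mathcal X_0\mathcal A^{-1}\mathcal B+(\mathcal X_0\mathcal A^{-1}\mathcal B)^\top+\frac{\mathcal E+\mathrm{Id}_N}2$. **Partition function.** $\hbar=(\mathsf b+\mathsf b^{-1})^{-2}$ with $\mathsf b>0$. $\Phi_{\mathsf b}(z)=\exp\Big(\frac14\int_{\mathbb R+i0^+}\frac{e^{-2izw}dw}{\sinh(\mathsf bw)\sinh(\mathsf b^{-1}w)w}\Big)$ for $|\mathrm{Im}\,z|<\frac1{2\sqrt\hbar}$ (contour avoiding $0$ from above). When $\det\mathcal A\ne0$, let $Q=-\frac12\big(\mathcal X_0\mathcal A^{-1}\mathcal B+(\mathcal X_0\mathcal A^{-1}\mathcal B)^\top\big)$ and $$\mathscr Z_\hbar(X,\alpha)=\int_{\mathbb R^N}\frac{e^{2i\pi\mathbf t^\top Q\mathbf t}}{|\det\mathcal A|}\prod_{k=1}^N\frac{\exp(\hbar^{-1/2}c_k\varepsilon(T_k)t_k)}{\Phi_{\mathsf b}\big(\varepsilon(T_k)(t_k-\frac{i}{2\pi\sqrt\hbar}(\pi-a_k))\big)^{\varepsilon(T_k)}}\,d\mathbf t.$$ **1-loop invariant and $R$.** A strong combinatorial flattening is $\mathbf f,\mathbf f',\mathbf f''\in\mathbb Z^N$ with $f_k+f_k'+f_k''=1$ such that for every choice of peripheral simple closed curve defining the last rows, $\mathbf G\mathbf f+\mathbf G'\mathbf f'+\mathbf G''\mathbf f''=(2,\dots,2,0)^\top$. With $\Delta_{\mathbf z},\Delta_{\mathbf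 z''}$ the diagonal matrices with entries $z_k$, $z_k''$, $\tau(M,l,X,\mathbf z)=\pm\frac12\det(\mathbf A\Delta_{\mathbf z''}+\mathbf B\Delta_{\mathbf z}^{-1})\prod_kz_k^{f_k''}(z_k'')^{-f_k}$. With $\operatorname{Li}_2(z)=-\int_0^z\mathrm{Log}(1-u)\frac{du}u$, $R(\mathbf z)=-\frac12(\mathbf{Log}\,\mathbf z-i\pi\mathbf f)\cdot(\mathbf{Log}\,\mathbf z''+i\pi\mathbf f'')+\sum_k\operatorname{Li}_2(e^{-\mathrm{Log}\,z_k})$. *)

theory Defs
  imports "HOL-Complex_Analysis.Complex_Analysis" "HOL-Homology.Homology"
    "HOL-Library.Landau_Symbols"
begin

no_notation fps_nth (infixl "$" 75)

section \<open>Hyperbolic space and hyperbolic manifolds\<close>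

text \<open>Upper half-space model: the point \<open>(w, t)\<close> has horizontal coordinate \<open>w\<close> and height \<open>t\<close>;
  the orientation is the one of the coordinates \<open>(Re w, Im w, t)\<close>. The ideal boundary is
  \<^typ>\<open>complex option\<close>, where \<^const>\<open>None\<close> is the point at infinity.\<close>

definition H3 :: "(complex \<times> real) set" where
  "H3 = {(w, t). t > 0}"

definition hvol :: "(complex \<times> real) set \<Rightarrow> ennreal" where
  "hvol S = (\<integral>\<^sup>+ x. ennreal (1 / snd x ^ 3) * indicator (S \<inter> H3) x \<partial>lborel)"

definition SL2 :: "(complex^2^2) set" where
  "SL2 = {A. det A = 1}"

definition act :: "complex^2^2 \<Rightarrow> complex \<times> real \<Rightarrow> complex \<times> real" where
  "act A = (\<lambda>(w, t).
     let a = A$1$1; b = A$1$2; c = A$2$1; d = A$2$2;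
         D = (cmod (c * w + d))\<^sup>2 + (cmod c)\<^sup>2 * t\<^sup>2
     in (((a * w + b) * cnj (c * w + d) + a * cnj c * of_real (t\<^sup>2)) / of_real D, t / D))"

definition mob :: "complex^2^2 \<Rightarrow> complex option \<Rightarrow> complex option" where
  "mob A p = (case p of
     None \<Rightarrow> if A$2$1 = 0 then None else Some (A$1$1 / A$2$1)
   | Some w \<Rightarrow> if A$2$1 * w + A$2$2 = 0 then None
              else Some ((A$1$1 * w + A$1$2) / (A$2$1 * w + A$2$2)))"

text \<open>\<open>dev\<close> is the developing map, on the universal cover \<^const>\<open>H3\<close> of the quotient by \<open>\<Gamma>\<close>, of a
  hyperbolic structure on that quotient; the volume of the structure is computed on a Borel
  fundamental domain cut into countably many Borel pieces on which \<open>dev\<close> is injective.\<close>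

definition structure_volume ::
  "(complex^2^2) set \<Rightarrow> (complex \<times> real \<Rightarrow> complex \<times> real) \<Rightarrow> ennreal \<Rightarrow> bool" where
  "structure_volume \<Gamma> dev V \<longleftrightarrow>
     (\<exists>F :: nat \<Rightarrow> (complex \<times> real) set.
        disjoint_family F \<and>
        (\<forall>i. F i \<in> sets borel \<and> F i \<subseteq> H3 \<and> inj_on dev (F i)) \<and>
        (\<forall>x\<in>H3. \<exists>!y. y \<in> (\<Union>i. F i) \<and> (\<exists>A\<in>\<Gamma>. act A x = y)) \<and>
        V = suminf (\<lambda>i. hvol (dev ` F i)))"

text \<open>\<open>M\<close> is an oriented complete hyperbolic 3-manifold of finite volume: the quotient of \<^const>\<open>H3\<close>
  by a group of orientation-preserving isometries acting freely and discontinuously. The group is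
  given by a subgroup \<open>\<Gamma>\<close> of SL(2,C), which may or may not contain minus the identity. The
  orientation of \<open>M\<close> is the one for which \<open>\<pi>\<close> preserves orientation.\<close>

definition hyperbolic_manifold ::
  "(complex^2^2) set \<Rightarrow> 'm topology \<Rightarrow> (complex \<times> real \<Rightarrow> 'm) \<Rightarrow> bool" where
  "hyperbolic_manifold \<Gamma> M \<pi> \<longleftrightarrow>
     \<Gamma> \<subseteq> SL2 \<and> mat 1 \<in> \<Gamma> \<and> (\<forall>A\<in>\<Gamma>. \<forall>B\<in>\<Gamma>. A ** B \<in> \<Gamma>) \<and> (\<forall>A\<in>\<Gamma>. matrix_inv A \<in> \<Gamma>) \<and>
     (\<forall>x\<in>H3. \<exists>U. open U \<and> x \<in> U \<and> U \<subseteq> H3 \<and>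
        (\<forall>A\<in>\<Gamma>. act A ` U \<inter> U \<noteq> {} \<longrightarrow> (\<forall>y\<in>H3. act A y = y))) \<and>
     quotient_map (top_of_set H3) M \<pi> \<and>
     (\<forall>x\<in>H3. \<forall>y\<in>H3. \<pi> x = \<pi> y \<longleftrightarrow> (\<exists>A\<in>\<Gamma>. act A x = y)) \<and>
     (\<exists>V<\<infinity>. structure_volume \<Gamma> id V)"

definition one_torus_cusp :: "'m topology \<Rightarrow> bool" where
  "one_torus_cusp M \<longleftrightarrow>
     (\<exists>K E. compactin M K \<and> closedin M E \<and> K \<union> E = topspace M \<and>
        subtopology M E homeomorphic_space
          prod_topology
            (prod_topology (top_of_set (sphere (0::complex) 1)) (top_of_set (sphere (0::complex) 1)))
            (top_of_set {0::real..}))"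

text \<open>The parabolic fixed points of \<open>\<Gamma>\<close>.\<close>

definition cusps :: "(complex^2^2) set \<Rightarrow> complex option set" where
  "cusps \<Gamma> = {p. \<exists>A\<in>\<Gamma>. A \<noteq> mat 1 \<and> A \<noteq> - mat 1 \<and> (trace A)\<^sup>2 = 4 \<and> mob A p = p}"

text \<open>Local degree, on the sphere of radius \<open>r\<close> around \<open>x\<close>, of a map injective on the ball that it
  bounds. The value is 1 if the map preserves orientation and \<open>-1\<close> if it reverses it.\<close>

definition of_coords :: "(nat \<Rightarrow> real) \<Rightarrow> complex \<times> real" where
  "of_coords u = (Complex (u 0) (u 1), u 2)"

definition to_coords :: "complex \<times> real \<Rightarrow> nat \<Rightarrow> real" where
  "to_coords = (\<lambda>(w, t) i. if i = 0 then Re w else if i = 1 then Im w else if i = 2 then t else 0)"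

definition local_degree ::
  "(complex \<times> real \<Rightarrow> complex \<times> real) \<Rightarrow> complex \<times> real \<Rightarrow> real \<Rightarrow> int" where
  "local_degree h x r = Brouwer_degree2 2 (\<lambda>u. to_coords (sgn (h (x + r *\<^sub>R of_coords u) - h x)))"


section \<open>Hyperbolic cone structures\<close>

text \<open>An oriented, possibly incomplete, hyperbolic structure on the quotient of \<^const>\<open>H3\<close> by \<open>\<Gamma>\<close>,
  given by an equivariant developing map \<open>dev\<close> which is an orientation-preserving local
  homeomorphism. Near each cusp \<open>p\<close> of \<open>\<Gamma>\<close>, the structure either is complete, so that a cusp
  neighbourhood \<open>U\<close> develops homeomorphically onto a horoball, or is completed by adding a closed
  geodesic, so that \<open>U\<close> develops as the universal cover of a tube around a geodesic with that
  geodesic removed. The map \<open>v\<close> is the induced equivariant map on ideal points: \<open>v p\<close> is the centre of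
  the horoball, or an end of the removed geodesic.\<close>

definition cone_structure ::
  "(complex^2^2) set \<Rightarrow> (complex \<times> real \<Rightarrow> complex \<times> real) \<Rightarrow>
   (complex option \<Rightarrow> complex option) \<Rightarrow> bool" where
  "cone_structure \<Gamma> dev v \<longleftrightarrow>
     continuous_on H3 dev \<and> dev ` H3 \<subseteq> H3 \<and>
     (\<forall>x\<in>H3. \<exists>r>0. cball x r \<subseteq> H3 \<and> inj_on dev (cball x r) \<and> local_degree dev x r = 1) \<and>
     (\<forall>A\<in>\<Gamma>. \<exists>B\<in>SL2. (\<forall>x\<in>H3. dev (act A x) = act B (dev x)) \<and>
                     (\<forall>p\<in>cusps \<Gamma>. v (mob A p) = mob B (v p))) \<and>
     (\<forall>p\<in>cusps \<Gamma>. \<exists>U. open U \<and> U \<subseteq> H3 \<and> simply_connected U \<and>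
        (\<exists>g\<in>SL2. \<exists>h>0. mob g None = p \<and> act g ` {(w, t). t > h} \<subseteq> U) \<and>
        (\<forall>A\<in>\<Gamma>. if mob A p = p then act A ` U = U else act A ` U \<inter> U = {}) \<and>
        (\<exists>g\<in>SL2.
           (inj_on dev U \<and> dev ` U = act g ` {(w, t). t > 1} \<and> v p = mob g None) \<or>
           (\<exists>\<kappa>>0. covering_space U dev (act g ` {(w, t). 0 < cmod w \<and> cmod w < \<kappa> * t}) \<and>
                  (v p = mob g None \<or> v p = mob g (Some 0)))))"


section \<open>Ordered ideal triangulations\<close>

text \<open>Tetrahedra are indexed by the finite type \<open>'n\<close>, faces by \<open>'n + 'n\<close>; \<open>x k T\<close>, for \<open>k \<le> 3\<close>, is the
  face of the tetrahedron \<open>T\<close> opposite to its vertex \<open>k\<close>. Since gluings respect the vertex orders, \<open>x\<close>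
  determines them. Points of a tetrahedron are given by barycentric coordinates, and
  \<^const>\<open>simplical_face\<close> \<open>k\<close> is the order-preserving inclusion of the face opposite to vertex \<open>k\<close>.\<close>

definition glued ::
  "(nat \<Rightarrow> 'n \<Rightarrow> 'n + 'n) \<Rightarrow> 'n \<times> (nat \<Rightarrow> real) \<Rightarrow> 'n \<times> (nat \<Rightarrow> real) \<Rightarrow> bool" where
  "glued x = equivclp (\<lambda>(T, p) (T', p'). \<exists>k\<le>3. \<exists>m\<le>3. \<exists>y\<in>standard_simplex 2.
     x k T = x m T' \<and> p = simplical_face k y \<and> p' = simplical_face m y)"

definition ideal_simplex :: "(nat \<Rightarrow> real) set" where
  "ideal_simplex = {p \<in> standard_simplex 3. \<forall>i\<le>3. p i < 1}"

definition ordered_ideal_triangulation ::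
  "'m topology \<Rightarrow> (nat \<Rightarrow> 'n::finite \<Rightarrow> 'n + 'n) \<Rightarrow> ('n \<times> (nat \<Rightarrow> real) \<Rightarrow> 'm) \<Rightarrow> bool" where
  "ordered_ideal_triangulation M x q \<longleftrightarrow>
     (\<forall>j. card {(k, T). k \<le> 3 \<and> x k T = j} = 2) \<and>
     quotient_map (prod_topology (discrete_topology UNIV) (top_of_set ideal_simplex)) M q \<and>
     (\<forall>P \<in> UNIV \<times> ideal_simplex. \<forall>P' \<in> UNIV \<times> ideal_simplex. q P = q P' \<longleftrightarrow> glued x P P')"

text \<open>Lifts \<open>s T\<close> of the tetrahedra to the universal cover, and their signs. In the affine coordinates
  used for \<^const>\<open>local_degree\<close>, the edge vectors 01, 02, 03 are the standard basis vectors.\<close>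

definition bary :: "complex \<times> real \<Rightarrow> nat \<Rightarrow> real" where
  "bary = (\<lambda>(w, t) i. if i = 0 then 1 - Re w - Im w - t else if i = 1 then Re w
                      else if i = 2 then Im w else if i = 3 then t else 0)"

definition tet_lifts ::
  "(complex \<times> real \<Rightarrow> 'm) \<Rightarrow> ('n \<times> (nat \<Rightarrow> real) \<Rightarrow> 'm) \<Rightarrow>
   ('n \<Rightarrow> (nat \<Rightarrow> real) \<Rightarrow> complex \<times> real) \<Rightarrow> bool" where
  "tet_lifts \<pi> q s \<longleftrightarrow>
     (\<forall>T. continuous_on ideal_simplex (s T) \<and> s T ` ideal_simplex \<subseteq> H3 \<and>
          (\<forall>p\<in>ideal_simplex. \<pi> (s T p) = q (T, p)))"

definition tet_sign :: "('n \<Rightarrow> (nat \<Rightarrow> real) \<Rightarrow> complex \<times> real) \<Rightarrow> 'n \<Rightarrow> int" where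
  "tet_sign s T =
     (if local_degree (\<lambda>y. s T (bary y)) (Complex (1/4) (1/4), 1/4) (1/8) = 1 then 1 else - 1)"

definition skip :: "nat \<Rightarrow> nat \<Rightarrow> nat" where
  "skip k a = (if a < k then a else Suc a)"

definition tet_edges :: "('n \<times> nat \<times> nat) set" where
  "tet_edges = {(T, i, j). i < j \<and> j \<le> 3}"

definition edge_glued ::
  "(nat \<Rightarrow> 'n \<Rightarrow> 'n + 'n) \<Rightarrow> 'n \<times> nat \<times> nat \<Rightarrow> 'n \<times> nat \<times> nat \<Rightarrow> bool" where
  "edge_glued x = equivclp (\<lambda>(T, i, j) (T', i', j'). \<exists>k\<le>3. \<exists>m\<le>3. \<exists>a b. a < b \<and> b \<le> 2 \<and>
     x k T = x m T' \<and> i = skip k a \<and> j = skip k b \<and> i' = skip m a \<and> j' = skip m b)"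

definition edges :: "(nat \<Rightarrow> 'n \<Rightarrow> 'n + 'n) \<Rightarrow> ('n \<times> nat \<times> nat) set set" where
  "edges x = {{E \<in> tet_edges. edge_glued x E0 E} | E0. E0 \<in> tet_edges}"

definition edge_sum ::
  "('n \<times> nat \<times> nat) set \<Rightarrow> ('n \<Rightarrow> nat \<Rightarrow> nat \<Rightarrow> 'a::comm_monoid_add) \<Rightarrow> 'a" where
  "edge_sum E w = (\<Sum>(T, i, j)\<in>E. w T i j)"


section \<open>Peripheral curves\<close>

text \<open>The cusp triangulation is realised in \<open>M\<close> by the triangles cutting off the vertices of the
  tetrahedra. Triangle \<open>(T, v)\<close> cuts off the vertex \<open>v\<close> of \<open>T\<close>. Its side \<open>a\<close> lies in the face of \<open>T\<close>
  opposite to vertex \<open>a\<close>, and its corner \<open>w\<close> lies on the edge \<open>vw\<close>. A normal arc \<open>(T, v, a, b)\<close> runs in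
  the triangle \<open>(T, v)\<close> from side \<open>a\<close> to side \<open>b\<close>; the corner that it cuts off is \<open>6 - (v + a + b)\<close>, the
  fourth element of \<open>{0, 1, 2, 3}\<close>.\<close>

definition cusp_torus :: "'m topology \<Rightarrow> ('n \<times> (nat \<Rightarrow> real) \<Rightarrow> 'm) \<Rightarrow> 'm topology" where
  "cusp_torus M q =
     subtopology M (q ` {(T, p). p \<in> standard_simplex 3 \<and> (\<exists>v\<le>3. p v = 3/4)})"

definition link_side :: "nat \<Rightarrow> nat \<Rightarrow> (nat \<Rightarrow> real) set" where
  "link_side v a = {p \<in> standard_simplex 3. p v = 3/4 \<and> (\<forall>j\<le>3. p j = 0 \<longleftrightarrow> j = a)}"

definition link_interior :: "nat \<Rightarrow> (nat \<Rightarrow> real) set" where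
  "link_interior v = {p \<in> standard_simplex 3. p v = 3/4 \<and> (\<forall>j\<le>3. p j > 0)}"

type_synonym 'n normal_curve = "('n \<times> nat \<times> nat \<times> nat) list"

definition arc_follows ::
  "(nat \<Rightarrow> 'n \<Rightarrow> 'n + 'n) \<Rightarrow> 'n \<times> nat \<times> nat \<times> nat \<Rightarrow> 'n \<times> nat \<times> nat \<times> nat \<Rightarrow> bool" where
  "arc_follows x = (\<lambda>(T, v, a, b) (T', v', a', b').
     x b T = x a' T' \<and> (T', a') \<noteq> (T, b) \<and> (\<exists>u\<le>2. v = skip b u \<and> v' = skip a' u))"

definition normal_closed_curve :: "(nat \<Rightarrow> 'n \<Rightarrow> 'n + 'n) \<Rightarrow> 'n normal_curve \<Rightarrow> bool" where
  "normal_closed_curve x \<sigma> \<longleftrightarrow>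
     \<sigma> \<noteq> [] \<and>
     (\<forall>(T, v, a, b) \<in> set \<sigma>. v \<le> 3 \<and> a \<le> 3 \<and> b \<le> 3 \<and> distinct [v, a, b]) \<and>
     (\<forall>i<length \<sigma>. arc_follows x (\<sigma> ! i) (\<sigma> ! (Suc i mod length \<sigma>)))"

definition traced_by ::
  "'m topology \<Rightarrow> ('n \<times> (nat \<Rightarrow> real) \<Rightarrow> 'm) \<Rightarrow> 'n normal_curve \<Rightarrow> (complex \<Rightarrow> 'm) \<Rightarrow> bool" where
  "traced_by M q \<sigma> f \<longleftrightarrow>
     continuous_map (top_of_set (sphere 0 1)) (cusp_torus M q) f \<and>
     (\<forall>i<length \<sigma>. case \<sigma> ! i of (T, v, a, b) \<Rightarrow>
        \<exists>g :: real \<Rightarrow> nat \<Rightarrow> real.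
          continuous_on {0..1} g \<and> g 0 \<in> link_side v a \<and> g 1 \<in> link_side v b \<and>
          (\<forall>t\<in>{0<..<1}. g t \<in> link_interior v) \<and>
          (\<forall>t\<in>{0..1}. f (cis (2 * pi * (real i + t) / real (length \<sigma>))) = q (T, g t)))"

text \<open>As usual, a simple closed curve on the torus is understood to be essential.\<close>

definition peripheral_scc ::
  "'m topology \<Rightarrow> (nat \<Rightarrow> 'n \<Rightarrow> 'n + 'n) \<Rightarrow> ('n \<times> (nat \<Rightarrow> real) \<Rightarrow> 'm) \<Rightarrow>
   'n normal_curve \<Rightarrow> bool" where
  "peripheral_scc M x q \<sigma> \<longleftrightarrow>
     normal_closed_curve x \<sigma> \<and>
     (\<exists>f. traced_by M q \<sigma> f \<and> inj_on f (sphere 0 1) \<and>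
          \<not> (\<exists>c. homotopic_with (\<lambda>_. True) (top_of_set (sphere 0 1)) (cusp_torus M q) f (\<lambda>_. c)))"

definition perm_sign :: "nat list \<Rightarrow> int" where
  "perm_sign p = (\<Prod>j<length p. \<Prod>i<j. sgn (int (p ! j) - int (p ! i)))"

text \<open>A corner counts positively if it is to the left of the curve, the cusp triangulation being
  viewed from the cusp. If \<open>\<epsilon> T = 1\<close>, the corners 1, 2, 3 of triangle \<open>(T, 0)\<close> are then in clockwise
  order; an arc from side \<open>a\<close> to side \<open>b\<close> has its corner \<open>w\<close> on the left iff \<open>w, b, a\<close> are in
  counterclockwise order. Viewing the torus from the other side changes all signs at once.\<close>

definition curve_sum ::
  "('n \<Rightarrow> int) \<Rightarrow> 'n normal_curve \<Rightarrow> ('n \<Rightarrow> nat \<Rightarrow> nat \<Rightarrow> 'a::comm_ring_1) \<Rightarrow> 'a" where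
  "curve_sum \<epsilon> \<sigma> w = (\<Sum>(T, v, a, b)\<leftarrow>\<sigma>.
     let c = 6 - (v + a + b) in of_int (\<epsilon> T * perm_sign [v, c, a, b]) * w T v c)"


section \<open>Angle structures\<close>

type_synonym 'n angles = "(real^'n) \<times> (real^'n) \<times> (real^'n)"

definition dihedral :: "'n::finite angles \<Rightarrow> 'n \<Rightarrow> nat \<Rightarrow> nat \<Rightarrow> real" where
  "dihedral = (\<lambda>(a, b, c) T i j.
     if {i, j} \<in> {{0, 1}, {2, 3}} then a $ T
     else if {i, j} \<in> {{0, 2}, {1, 3}} then b $ T
     else c $ T)"

definition angle_structures :: "(nat \<Rightarrow> 'n::finite \<Rightarrow> 'n + 'n) \<Rightarrow> 'n angles set" where
  "angle_structures x = {(a, b, c).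
     (\<forall>T. a $ T \<in> {0<..<pi} \<and> b $ T \<in> {0<..<pi} \<and> c $ T \<in> {0<..<pi} \<and>
          a $ T + b $ T + c $ T = pi) \<and>
     (\<forall>E\<in>edges x. edge_sum E (dihedral (a, b, c)) = 2 * pi)}"

definition HR :: "('n::finite \<Rightarrow> int) \<Rightarrow> 'n normal_curve \<Rightarrow> 'n angles \<Rightarrow> real" where
  "HR \<epsilon> \<sigma> \<alpha> = curve_sum \<epsilon> \<sigma> (dihedral \<alpha>)"

text \<open>The ideal tetrahedron with vertices 0, 1, \<open>z\<close> and infinity: the part of the upper half-space
  above the triangle 0, 1, \<open>z\<close> and outside the hemisphere through its vertices.\<close>

definition ideal_tet :: "complex \<Rightarrow> (complex \<times> real) set" where
  "ideal_tet z = {(w, t). t > 0 \<and> w \<in> convex hull {0, 1, z} \<and>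
     (\<forall>m R. cmod m = R \<and> cmod (1 - m) = R \<and> cmod (z - m) = R \<longrightarrow> R\<^sup>2 \<le> (cmod (w - m))\<^sup>2 + t\<^sup>2)}"

definition tet_volume :: "real \<Rightarrow> real \<Rightarrow> real \<Rightarrow> real" where
  "tet_volume a b c =
     (let z = (THE z. Im z > 0 \<and> Arg z = a \<and> Arg (1 / (1 - z)) = b \<and> Arg ((z - 1) / z) = c)
      in enn2real (hvol (ideal_tet z)))"

definition Vol :: "'n::finite angles \<Rightarrow> real" where
  "Vol = (\<lambda>(a, b, c). \<Sum>k\<in>UNIV. tet_volume (a $ k) (b $ k) (c $ k))"


section \<open>Shapes and Neumann-Zagier matrices\<close>

definition shape1 :: "complex \<Rightarrow> complex" where
  "shape1 z = 1 / (1 - z)"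

definition shape2 :: "complex \<Rightarrow> complex" where
  "shape2 z = (z - 1) / z"

text \<open>\<open>place \<epsilon> u u' u''\<close> puts quantities attached to \<open>z, z', z''\<close> on the edges of the tetrahedra.\<close>

definition place ::
  "('n::finite \<Rightarrow> int) \<Rightarrow> 'a^'n \<Rightarrow> 'a^'n \<Rightarrow> 'a^'n \<Rightarrow> 'n \<Rightarrow> nat \<Rightarrow> nat \<Rightarrow> 'a" where
  "place \<epsilon> u u' u'' T i j =
     (if {i, j} \<in> {{0, 1}, {2, 3}} then u $ T
      else if {i, j} \<in> {{0, 3}, {1, 2}} then (if \<epsilon> T = 1 then u' $ T else u'' $ T)
      else (if \<epsilon> T = 1 then u'' $ T else u' $ T))"

definition HC :: "('n::finite \<Rightarrow> int) \<Rightarrow> 'n normal_curve \<Rightarrow> complex^'n \<Rightarrow> complex" where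
  "HC \<epsilon> \<sigma> z = curve_sum \<epsilon> \<sigma>
     (place \<epsilon> (\<chi> k. Ln (z $ k)) (\<chi> k. Ln (shape1 (z $ k))) (\<chi> k. Ln (shape2 (z $ k))))"

text \<open>The rows of the matrices are indexed by \<open>'n\<close>; row \<open>r0\<close> (the last one in the usual notation) is the
  one of the curve \<open>l\<close>, and a row \<open>r \<noteq> r0\<close> is the one of the edge \<open>e r\<close>. The entries are integers,
  regarded as elements of whichever ring is needed.\<close>

definition NZ_row ::
  "('n::finite \<Rightarrow> int) \<Rightarrow> ('n \<Rightarrow> ('n \<times> nat \<times> nat) set) \<Rightarrow> 'n \<Rightarrow> 'n normal_curve \<Rightarrow>
   'n \<Rightarrow> ('n \<Rightarrow> nat \<Rightarrow> nat \<Rightarrow> 'a::comm_ring_1) \<Rightarrow> 'a" where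
  "NZ_row \<epsilon> e r0 l r w = (if r = r0 then curve_sum \<epsilon> l w else edge_sum (e r) w)"

definition NZ_G ::
  "('n::finite \<Rightarrow> int) \<Rightarrow> ('n \<Rightarrow> ('n \<times> nat \<times> nat) set) \<Rightarrow> 'n \<Rightarrow> 'n normal_curve \<Rightarrow>
   'a::comm_ring_1^'n^'n" where
  "NZ_G \<epsilon> e r0 l = (\<chi> r k. NZ_row \<epsilon> e r0 l r (place \<epsilon> (axis k 1) 0 0))"

definition NZ_G1 ::
  "('n::finite \<Rightarrow> int) \<Rightarrow> ('n \<Rightarrow> ('n \<times> nat \<times> nat) set) \<Rightarrow> 'n \<Rightarrow> 'n normal_curve \<Rightarrow>
   'a::comm_ring_1^'n^'n" where
  "NZ_G1 \<epsilon> e r0 l = (\<chi> r k. NZ_row \<epsilon> e r0 l r (place \<epsilon> 0 (axis k 1) 0))"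

definition NZ_G2 ::
  "('n::finite \<Rightarrow> int) \<Rightarrow> ('n \<Rightarrow> ('n \<times> nat \<times> nat) set) \<Rightarrow> 'n \<Rightarrow> 'n normal_curve \<Rightarrow>
   'a::comm_ring_1^'n^'n" where
  "NZ_G2 \<epsilon> e r0 l = (\<chi> r k. NZ_row \<epsilon> e r0 l r (place \<epsilon> 0 0 (axis k 1)))"

definition NZ_A ::
  "('n::finite \<Rightarrow> int) \<Rightarrow> ('n \<Rightarrow> ('n \<times> nat \<times> nat) set) \<Rightarrow> 'n \<Rightarrow> 'n normal_curve \<Rightarrow>
   'a::comm_ring_1^'n^'n" where
  "NZ_A \<epsilon> e r0 l = NZ_G \<epsilon> e r0 l - NZ_G1 \<epsilon> e r0 l"

definition NZ_B ::
  "('n::finite \<Rightarrow> int) \<Rightarrow> ('n \<Rightarrow> ('n \<times> nat \<times> nat) set) \<Rightarrow> 'n \<Rightarrow> 'n normal_curve \<Rightarrow>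
   'a::comm_ring_1^'n^'n" where
  "NZ_B \<epsilon> e r0 l = NZ_G2 \<epsilon> e r0 l - NZ_G1 \<epsilon> e r0 l"

text \<open>Independence of edges refers, as in Neumann-Zagier, to the edge equations after elimination of
  \<open>z'\<close>, that is, to the rows of (A|B); these rows do not depend on \<open>l\<close>.\<close>

definition independent_edges ::
  "(nat \<Rightarrow> 'n::finite \<Rightarrow> 'n + 'n) \<Rightarrow> ('n \<Rightarrow> int) \<Rightarrow> ('n \<Rightarrow> ('n \<times> nat \<times> nat) set) \<Rightarrow> 'n \<Rightarrow> bool" where
  "independent_edges x \<epsilon> e r0 \<longleftrightarrow>
     e ` (- {r0}) \<subseteq> edges x \<and>
     (let row = (\<lambda>r. (NZ_A \<epsilon> e r0 [] $ r, NZ_B \<epsilon> e r0 [] $ r) :: (real^'n) \<times> (real^'n))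
      in inj_on row (- {r0}) \<and> independent (row ` (- {r0})))"

definition gluing_equations ::
  "('n::finite \<Rightarrow> int) \<Rightarrow> ('n \<Rightarrow> ('n \<times> nat \<times> nat) set) \<Rightarrow> 'n \<Rightarrow> 'n normal_curve \<Rightarrow>
   complex^'n \<Rightarrow> real \<Rightarrow> bool" where
  "gluing_equations \<epsilon> e r0 l z \<theta> \<longleftrightarrow>
     NZ_G \<epsilon> e r0 l *v (\<chi> k. Ln (z $ k)) + NZ_G1 \<epsilon> e r0 l *v (\<chi> k. Ln (shape1 (z $ k)))
       + NZ_G2 \<epsilon> e r0 l *v (\<chi> k. Ln (shape2 (z $ k)))
     = (\<chi> r. if r = r0 then \<i> * of_real \<theta> else 2 * of_real pi * \<i>)"

text \<open>Convergence to an ideal point in the closed upper half-space.\<close>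

definition tends_to_ideal ::
  "('a \<Rightarrow> complex \<times> real) \<Rightarrow> 'a filter \<Rightarrow> complex option \<Rightarrow> bool" where
  "tends_to_ideal g F p \<longleftrightarrow>
     (case p of None \<Rightarrow> filterlim g at_infinity F | Some w \<Rightarrow> (g \<longlongrightarrow> (w, 0)) F)"

text \<open>The shape of an ideal tetrahedron with vertices \<open>p 0, p 1, p 2, p 3\<close>, with \<open>z\<close> at the edge 01:
  up to an isometry the vertices are infinity, 0, and then 1 and \<open>z\<close> in the order given by the sign.\<close>

definition has_shape :: "int \<Rightarrow> (nat \<Rightarrow> complex option) \<Rightarrow> complex \<Rightarrow> bool" where
  "has_shape \<epsilon> p z \<longleftrightarrow> z \<notin> {0, 1} \<and>
     (\<exists>B\<in>SL2. p 0 = mob B None \<and> p 1 = mob B (Some 0) \<and>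
        p (if \<epsilon> = 1 then 3 else 2) = mob B (Some 1) \<and>
        p (if \<epsilon> = 1 then 2 else 3) = mob B (Some z))"

text \<open>\<open>z\<close> are the shape parameters on the triangulation of the structure inducing \<open>v\<close> on ideal points.\<close>

definition shape_parameters ::
  "('n::finite \<Rightarrow> int) \<Rightarrow> ('n \<Rightarrow> (nat \<Rightarrow> real) \<Rightarrow> complex \<times> real) \<Rightarrow>
   (complex option \<Rightarrow> complex option) \<Rightarrow> complex^'n \<Rightarrow> bool" where
  "shape_parameters \<epsilon> s v z \<longleftrightarrow>
     (\<forall>T. \<exists>p. (\<forall>i\<le>3. tends_to_ideal (s T)
                 (at (\<lambda>j. if j = i then 1 else 0) within ideal_simplex) (p i)) \<and>
              has_shape (\<epsilon> T) (\<lambda>i. v (p i)) (z $ T))"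


section \<open>FAMED triangulations and the partition function\<close>

definition face_matrix :: "(nat \<Rightarrow> 'n::finite \<Rightarrow> 'n + 'n) \<Rightarrow> nat \<Rightarrow> real^('n + 'n)^'n" where
  "face_matrix x k = (\<chi> T j. if x k T = j then 1 else 0)"

definition sign_matrix :: "('n::finite \<Rightarrow> int) \<Rightarrow> real^'n^'n" where
  "sign_matrix \<epsilon> = (\<chi> i j. if i = j then of_int (\<epsilon> i) else 0)"

definition calA :: "(nat \<Rightarrow> 'n::finite \<Rightarrow> 'n + 'n) \<Rightarrow> real^('n + 'n)^('n + 'n)" where
  "calA x = (\<chi> i. case i of
     Inl r \<Rightarrow> (face_matrix x 0 - face_matrix x 1 + face_matrix x 2) $ r
   | Inr r \<Rightarrow> (face_matrix x 2 - face_matrix x 3) $ r)"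

definition calB :: "('n::finite \<Rightarrow> int) \<Rightarrow> real^'n^('n + 'n)" where
  "calB \<epsilon> = (\<chi> i. case i of Inl r \<Rightarrow> 0 | Inr r \<Rightarrow> sign_matrix \<epsilon> $ r)"

definition kinetic :: "(nat \<Rightarrow> 'n::finite \<Rightarrow> 'n + 'n) \<Rightarrow> ('n \<Rightarrow> int) \<Rightarrow> real^'n^'n" where
  "kinetic x \<epsilon> = (let S = face_matrix x 0 ** matrix_inv (calA x) ** calB \<epsilon> in S + transpose S)"

definition FAMED ::
  "(nat \<Rightarrow> 'n::finite \<Rightarrow> 'n + 'n) \<Rightarrow> ('n \<Rightarrow> int) \<Rightarrow> ('n \<Rightarrow> ('n \<times> nat \<times> nat) set) \<Rightarrow> 'n \<Rightarrow>
   'n normal_curve \<Rightarrow> bool" where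
  "FAMED x \<epsilon> e r0 l \<longleftrightarrow>
     angle_structures x \<noteq> {} \<and> det (calA x) \<noteq> 0 \<and> det (NZ_B \<epsilon> e r0 l :: real^'n^'n) \<noteq> 0 \<and>
     matrix_inv (NZ_B \<epsilon> e r0 l) ** NZ_A \<epsilon> e r0 l
       = kinetic x \<epsilon> + (1/2) *\<^sub>R (sign_matrix \<epsilon> + mat 1)"

definition hbar :: "real \<Rightarrow> real" where
  "hbar b = 1 / (b + 1 / b)\<^sup>2"

text \<open>The limit expresses the contour passing just above the real axis; the integral does not depend
  on \<open>\<eta>\<close> once \<open>\<eta>\<close> is small.\<close>

definition qdilog :: "real \<Rightarrow> complex \<Rightarrow> complex" where
  "qdilog b z = exp (1/4 * Lim (at_right 0) (\<lambda>\<eta>. LINT y|lborel.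
     (let w = Complex y \<eta>
      in exp (- 2 * \<i> * z * w) / (sinh (of_real b * w) * sinh (w / of_real b) * w))))"

definition partition_function ::
  "(nat \<Rightarrow> 'n::finite \<Rightarrow> 'n + 'n) \<Rightarrow> ('n \<Rightarrow> int) \<Rightarrow> real \<Rightarrow> 'n angles \<Rightarrow> complex" where
  "partition_function x \<epsilon> b = (\<lambda>(\<alpha>1, \<alpha>2, \<alpha>3).
     let Q = - (1/2) *\<^sub>R kinetic x \<epsilon> in
     LINT t|lborel.
       exp (2 * \<i> * of_real pi * of_real (t \<bullet> (Q *v t))) / of_real \<bar>det (calA x)\<bar> *
       (\<Prod>k\<in>UNIV.
          exp (of_real (1 / sqrt (hbar b) * \<alpha>3 $ k * of_int (\<epsilon> k) * t $ k)) /
          qdilog b (of_int (\<epsilon> k) *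
            (of_real (t $ k) - \<i> / of_real (2 * pi * sqrt (hbar b)) * of_real (pi - \<alpha>1 $ k)))
            powi \<epsilon> k))"


section \<open>Flattenings, 1-loop invariant and potential\<close>

definition strong_flattening ::
  "'m topology \<Rightarrow> (nat \<Rightarrow> 'n::finite \<Rightarrow> 'n + 'n) \<Rightarrow> ('n \<times> (nat \<Rightarrow> real) \<Rightarrow> 'm) \<Rightarrow>
   ('n \<Rightarrow> int) \<Rightarrow> ('n \<Rightarrow> ('n \<times> nat \<times> nat) set) \<Rightarrow> 'n \<Rightarrow> int^'n \<Rightarrow> int^'n \<Rightarrow> int^'n \<Rightarrow> bool" where
  "strong_flattening M x q \<epsilon> e r0 f f1 f2 \<longleftrightarrow>
     (\<forall>k. f $ k + f1 $ k + f2 $ k = 1) \<and>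
     (\<forall>\<sigma>. peripheral_scc M x q \<sigma> \<longrightarrow>
        NZ_G \<epsilon> e r0 \<sigma> *v f + NZ_G1 \<epsilon> e r0 \<sigma> *v f1 + NZ_G2 \<epsilon> e r0 \<sigma> *v f2
          = (\<chi> r. if r = r0 then 0 else 2))"

definition diag :: "'a::zero^'n \<Rightarrow> 'a^'n^'n" where
  "diag u = (\<chi> i j. if i = j then u $ i else 0)"

text \<open>The 1-loop invariant is only defined up to sign; this is the representative with sign \<open>+\<close>.\<close>

definition one_loop ::
  "('n::finite \<Rightarrow> int) \<Rightarrow> ('n \<Rightarrow> ('n \<times> nat \<times> nat) set) \<Rightarrow> 'n \<Rightarrow> 'n normal_curve \<Rightarrow>
   int^'n \<Rightarrow> int^'n \<Rightarrow> complex^'n \<Rightarrow> complex" where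
  "one_loop \<epsilon> e r0 l f f2 z =
     1/2 * det (NZ_A \<epsilon> e r0 l ** diag (\<chi> k. shape2 (z $ k))
                + NZ_B \<epsilon> e r0 l ** matrix_inv (diag z))
         * (\<Prod>k\<in>UNIV. z $ k powi (f2 $ k) * shape2 (z $ k) powi (- f $ k))"

definition Li2 :: "complex \<Rightarrow> complex" where
  "Li2 z = - contour_integral (linepath 0 z) (\<lambda>u. Ln (1 - u) / u)"

definition potential :: "int^'n::finite \<Rightarrow> int^'n \<Rightarrow> complex^'n \<Rightarrow> complex" where
  "potential f f2 z =
     - 1/2 * (\<Sum>k\<in>UNIV. (Ln (z $ k) - \<i> * of_real pi * of_int (f $ k)) *
                          (Ln (shape2 (z $ k)) + \<i> * of_real pi * of_int (f2 $ k)))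
     + (\<Sum>k\<in>UNIV. Li2 (exp (- Ln (z $ k))))"

text \<open>The sign \<open>s\<close> is the one chosen for the 1-loop invariant under the square root.\<close>

definition asymptotic_expansion ::
  "(nat \<Rightarrow> 'n::finite \<Rightarrow> 'n + 'n) \<Rightarrow> ('n \<Rightarrow> int) \<Rightarrow> ('n \<Rightarrow> ('n \<times> nat \<times> nat) set) \<Rightarrow> 'n \<Rightarrow>
   'n normal_curve \<Rightarrow> 'n angles \<Rightarrow> int^'n \<Rightarrow> int^'n \<Rightarrow> complex^'n \<Rightarrow> complex \<Rightarrow> real \<Rightarrow> bool" where
  "asymptotic_expansion x \<epsilon> e r0 l \<alpha> f f2 z s V \<longleftrightarrow>
     (\<exists>g :: real \<Rightarrow> complex. g \<in> O[at_right 0](\<lambda>h. of_real h) \<and>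
        (\<forall>\<^sub>F h in at_right 0. \<forall>b>0. h = hbar b \<longrightarrow>
           cmod (partition_function x \<epsilon> b \<alpha>) =
           cmod (exp (\<i> / of_real pi * potential f f2 z) /
                   (of_real (det (calA x)) *
                    csqrt (2 * of_real (det (matrix_inv (NZ_B \<epsilon> e r0 l :: real^'n^'n))))) *
                 (of_real (exp (- 1 / (2 * pi * h) * V)) /
                    csqrt (s * one_loop \<epsilon> e r0 l f f2 z)) *
                 (1 + g h))))"

end

theory Submission
  imports Defs
begin

text \<open>
  The theorem compares two exponential rates. The hypothesis gives the exact rate of decay of
  \<open>|Z(\<alpha>)|\<close> as \<open>\<hbar>\<close> tends to 0, namely \<open>V\<close>. It therefore suffices that, for every angle structure \<open>\<alpha>'\<close>
  with the same angular holonomy along \<open>l\<close>,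
    \<^item> \<open>|Z(\<alpha>')| = |Z(\<alpha>)|\<close> when \<open>\<hbar>\<close> is small, and
    \<^item> \<open>|Z(\<alpha>')|\<close> is at most \<open>exp (- (Vol(\<alpha>') + o(1)) / (2 pi \<hbar>))\<close>.

  Equality of moduli. Put \<open>u = t - i w\<close> with \<open>w = (pi - a) / (2 pi sqrt \<hbar>)\<close>. In terms of \<open>u\<close>, the integrand
  depends on the angles only through a constant phase, through the contour \<open>\<real>\<^sup>N - i w\<close>, and through the
  coefficient \<open>- 4 pi Q w + \<hbar>\<^bsup>-1/2\<^esup> \<epsilon> c\<close> of the linear term in the exponent. The angles of \<open>\<alpha>\<close> and \<open>\<alpha>'\<close>
  satisfy the same Neumann-Zagier equations, so their difference lies in the kernel of \<open>(A|B)\<close>, and the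
  formula for \<open>B\<^sup>-\<^sup>1 A\<close> in the FAMED condition says precisely that the linear coefficient does not change
  (\<open>kinetic_angle_difference\<close>). What remains is one holomorphic function, integrated over two parallel
  copies of \<open>\<real>\<^sup>N\<close>; the segment from \<open>\<alpha>\<close> to \<open>\<alpha>'\<close> joins the two contours inside the region where this
  function decays (\<open>cmod_integral_state_integrand_eq\<close>).

  Upper bound. For real \<open>t\<close> the quadratic exponential has modulus 1, so the modulus of the integrand is a
  product of functions of one variable. In the variable \<open>X = 2 pi b t\<close>, the factor of a tetrahedron with
  angles \<open>a, b, c\<close> is \<open>exp ((c X - D X) / (2 pi \<hbar>))\<close> up to a bounded factor and a small change of the
  angles, where \<open>D X\<close> is the imaginary part of \<open>Li\<^sub>2 (e\<^bsup>X + i a\<^esup>)\<close>. The function \<open>D\<close> is convex, and its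
  tangent of slope \<open>c\<close> shows that the maximum of \<open>c X - D X\<close> is minus the volume of the ideal tetrahedron
  with these angles (\<open>dilog_profile_ge\<close>, \<open>tet_volume_le_ideal_volume\<close>). The bounded factor comes from
  comparing the quantum with the classical dilogarithm, uniformly on a horizontal line
  (\<open>qdilog_lower_bound\<close>).
\<close>

section \<open>Contour shifts\<close>

text \<open>Cauchy's inequality turns the bound \<open>g\<close> for \<open>F\<close> into a bound for the difference quotients near \<open>w\<close>, and
  dominated convergence does the rest.\<close>

lemma has_field_derivative_lebesgue_integral:
  fixes F :: "'a \<Rightarrow> complex \<Rightarrow> complex"
  assumes S: "open S" "w \<in> S"
    and hol: "\<And>t. F t holomorphic_on S"
    and meas: "\<And>z. z \<in> S \<Longrightarrow> (\<lambda>t. F t z) \<in> borel_measurable M"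
    and bound: "\<And>t z. z \<in> S \<Longrightarrow> cmod (F t z) \<le> g t"
    and g: "integrable M g"
  shows "((\<lambda>z. \<integral>t. F t z \<partial>M) has_field_derivative (\<integral>t. deriv (F t) w \<partial>M)) (at w)"
proof -
  obtain r where r: "r > 0" "cball w (2 * r) \<subseteq> S"
  proof -
    obtain e where "e > 0" "cball w e \<subseteq> S"
      using S open_contains_cball by blast
    then show ?thesis using that[of "e/2"] by auto
  qed
  have sub: "cball z r \<subseteq> S" if "z \<in> cball w r" for z
  proof
    fix u assume "u \<in> cball z r"
    then have "dist w u \<le> 2 * r" using that dist_triangle[of w u z] by auto
    then show "u \<in> S" using r by auto
  qed
  have dF: "(F t has_field_derivative deriv (F t) z) (at z)" if "z \<in> S" for t z
    using hol S(1) that holomorphic_derivI by blast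
  have dbound: "cmod (deriv (F t) z) \<le> g t / r" if "z \<in> cball w r" for t z
  proof -
    have h: "F t holomorphic_on cball z r" using hol sub[OF that] holomorphic_on_subset by blast
    have "cmod ((deriv ^^ 1) (F t) z) \<le> fact 1 * g t / r ^ 1"
    proof (rule Cauchy_inequality)
      show "F t holomorphic_on ball z r" using h ball_subset_cball holomorphic_on_subset by blast
      show "continuous_on (cball z r) (F t)" using h holomorphic_on_imp_continuous_on by blast
      show "0 < r" by fact
      fix x assume "cmod (z - x) = r"
      then have "x \<in> cball z r" by (simp add: dist_norm)
      then show "cmod (F t x) \<le> g t" using sub[OF that] bound by blast
    qed
    then show ?thesis by simp
  qed
  have quot: "cmod ((F t z - F t w) / (z - w)) \<le> g t / r" if "z \<in> cball w r" for t z
  proof (cases "z = w")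
    case True
    have "w \<in> cball w r" using r by auto
    with dbound[of w t] have "0 \<le> g t / r" by (meson norm_ge_zero order_trans)
    then show ?thesis using True by simp
  next
    case False
    have "cmod (F t z - F t w) \<le> g t / r * cmod (z - w)"
    proof (rule field_differentiable_bound[of "cball w r" _ "deriv (F t)"])
      fix u assume u: "u \<in> cball w r"
      then have "u \<in> S" using sub[OF u] r by auto
      then show "(F t has_field_derivative deriv (F t) u) (at u within cball w r)"
        using dF has_field_derivative_at_within by blast
      show "cmod (deriv (F t) u) \<le> g t / r" using dbound u by blast
    qed (use that r in auto)
    then show ?thesis using False r(1) by (simp add: norm_divide divide_simps)
  qed
  have ball: "cball w r \<subseteq> S" using sub[of w] r by auto
  show ?thesis
    unfolding has_field_derivative_iff tendsto_at_iff_sequentially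
  proof (intro allI impI)
    fix X :: "nat \<Rightarrow> complex"
    assume X: "\<forall>i. X i \<in> UNIV - {w}" and lim: "X \<longlonglongrightarrow> w"
    obtain N where N: "\<And>n. n \<ge> N \<Longrightarrow> X n \<in> cball w r"
      using lim r(1) unfolding lim_sequentially by (metis dist_commute less_imp_le mem_cball)
    let ?Y = "\<lambda>n. X (n + N)"
    have Y: "?Y n \<in> cball w r" for n using N by simp
    have YS: "?Y n \<in> S" for n using Y[of n] ball by blast
    have lY: "?Y \<longlonglongrightarrow> w" using lim LIMSEQ_ignore_initial_segment by blast
    let ?q = "\<lambda>n t. (F t (?Y n) - F t w) / (?Y n - w)"
    have mq: "?q n \<in> borel_measurable M" for n
      using meas[OF YS] meas[OF S(2)] by (intro borel_measurable_divide borel_measurable_diff) auto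
    have lq: "(\<lambda>n. ?q n t) \<longlonglongrightarrow> deriv (F t) w" for t
    proof -
      have "((\<lambda>z. (F t z - F t w) / (z - w)) \<longlongrightarrow> deriv (F t) w) (at w)"
        using dF[OF S(2)] has_field_derivative_iff by blast
      then show ?thesis
        unfolding tendsto_at_iff_sequentially using X lY by (auto simp: comp_def)
    qed
    have "(\<lambda>n. \<integral>t. ?q n t \<partial>M) \<longlonglongrightarrow> (\<integral>t. deriv (F t) w \<partial>M)"
    proof (rule integral_dominated_convergence)
      show "(\<lambda>t. deriv (F t) w) \<in> borel_measurable M"
        by (rule borel_measurable_LIMSEQ_metric[where f = ?q]) (use mq lq in auto)
      show "integrable M (\<lambda>t. g t / r)" using g by auto
      show "\<And>i. AE t in M. cmod (?q i t) \<le> g t / r" using quot Y by auto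
    qed (use mq lq in auto)
    moreover have "(\<integral>t. ?q n t \<partial>M) = ((\<integral>t. F t (?Y n) \<partial>M) - (\<integral>t. F t w \<partial>M)) / (?Y n - w)" for n
    proof -
      have I: "integrable M (\<lambda>t. F t z)" if "z \<in> S" for z
        using Bochner_Integration.integrable_bound[OF g meas[OF that]] bound[OF that]
        by (smt (verit, best) AE_I2 norm_ge_zero real_norm_def)
      show ?thesis using I[OF YS] I[OF S(2)] by (subst integral_divide_zero, subst Bochner_Integration.integral_diff) auto
    qed
    ultimately have "(\<lambda>n. ((\<integral>t. F t (?Y n) \<partial>M) - (\<integral>t. F t w \<partial>M)) / (?Y n - w)) \<longlonglongrightarrow> (\<integral>t. deriv (F t) w \<partial>M)"
      by (simp only:)
    then show "((\<lambda>z. ((\<integral>t. F t z \<partial>M) - (\<integral>t. F t w \<partial>M)) / (z - w)) \<circ> X) \<longlonglongrightarrow> (\<integral>t. deriv (F t) w \<partial>M)"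
      unfolding comp_def by (rule LIMSEQ_offset)
  qed
qed

lemma integral_lborel_translate:
  fixes f :: "'a::euclidean_space \<Rightarrow> 'b::{banach, second_countable_topology}"
  assumes "f \<in> borel_measurable borel"
  shows "(\<integral>t. f (c + t) \<partial>lborel) = (\<integral>t. f t \<partial>lborel)"
proof -
  have "(\<integral>t. f t \<partial>lborel) = (\<integral>t. f t \<partial>distr lborel borel ((+) c))"
    by (simp add: lborel_distr_plus)
  also have "\<dots> = (\<integral>t. f (c + t) \<partial>lborel)"
    using assms by (subst integral_distr) auto
  finally show ?thesis by simp
qed

text \<open>Every contour shift below rests on this. The integral is a holomorphic function of \<open>z\<close>. By
  equivariance and translation invariance of Lebesgue measure it does not change when \<open>z\<close> moves in the
  real direction, so its derivative vanishes and it does not change in the imaginary direction either.\<close>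

lemma integral_shift_imaginary:
  fixes F :: "'a::euclidean_space \<Rightarrow> complex \<Rightarrow> complex" and d :: 'a and s0 s1 :: real
  defines "R \<equiv> {z. \<bar>Re z\<bar> < 1 \<and> s0 < Im z \<and> Im z < s1}"
  assumes hol: "\<And>t. F t holomorphic_on R"
    and eqv: "\<And>t z \<sigma>. F t (z + of_real \<sigma>) = F (\<sigma> *\<^sub>R d + t) z"
    and meas: "\<And>z. z \<in> R \<Longrightarrow> (\<lambda>t. F t z) \<in> borel_measurable borel"
    and bound: "\<And>t z. z \<in> R \<Longrightarrow> cmod (F t z) \<le> g t"
    and g: "integrable lborel g"
    and s: "s \<in> {s0<..<s1}" "s' \<in> {s0<..<s1}"
  shows "(\<integral>t. F t (Complex 0 s) \<partial>lborel) = (\<integral>t. F t (Complex 0 s') \<partial>lborel)"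
proof -
  have R: "R = {z. Re z > -1} \<inter> {z. Re z < 1} \<inter> ({z. Im z > s0} \<inter> {z. Im z < s1})"
    unfolding R_def by auto
  have "open R" "convex R"
    unfolding R
    by (intro open_Int convex_Int open_halfspace_Re_gt open_halfspace_Re_lt open_halfspace_Im_gt
        open_halfspace_Im_lt convex_halfspace_Re_gt convex_halfspace_Re_lt convex_halfspace_Im_gt
        convex_halfspace_Im_lt)+
  define J where "J = (\<lambda>z. \<integral>t. F t z \<partial>lborel)"
  \<comment> \<open>The derivative may be computed in the real direction, where \<open>J\<close> is constant.\<close>
  have J0: "(J has_field_derivative 0) (at w)" if w: "w \<in> R" for w
  proof -
    obtain D where D: "(J has_field_derivative D) (at w)"
      using has_field_derivative_lebesgue_integral[OF \<open>open R\<close> w, of F lborel g] hol meas bound g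
      unfolding J_def by auto
    have "((\<lambda>\<sigma>::real. J (w + of_real \<sigma>)) has_vector_derivative D) (at 0)"
    proof -
      have "((\<lambda>\<sigma>::real. w + of_real \<sigma>) has_vector_derivative 1) (at 0)"
        by (auto intro!: derivative_eq_intros)
      from field_vector_diff_chain_at[OF this, of J D] D show ?thesis by (simp add: comp_def)
    qed
    moreover have "J (w + of_real \<sigma>) = J w" for \<sigma>
      unfolding J_def eqv using integral_lborel_translate[OF meas[OF w]] .
    ultimately have "((\<lambda>\<sigma>::real. J w) has_vector_derivative D) (at 0)" by simp
    then have "D = 0" using vector_derivative_unique_at has_vector_derivative_const by blast
    then show ?thesis using D by simp
  qed
  obtain c where "\<And>z. z \<in> R \<Longrightarrow> J z = c"
    using has_field_derivative_zero_constant[OF \<open>convex R\<close>, of J] J0 has_field_derivative_at_within by blast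
  moreover have "Complex 0 s \<in> R" "Complex 0 s' \<in> R" using s by (auto simp: R_def)
  ultimately have "J (Complex 0 s) = J (Complex 0 s')" by metis
  then show ?thesis unfolding J_def .
qed

lemma integral_exp_neg_abs:
  fixes k :: real assumes "k > 0"
  shows "integrable lborel (\<lambda>u. exp (- k * \<bar>u\<bar>))" "(\<integral>u. exp (- k * \<bar>u\<bar>) \<partial>lborel) = 2 / k"
proof -
  have A: "(\<integral>\<^sup>+u. ennreal (exp (- k * u)) * indicator {0..} u \<partial>lborel) = ennreal (1 / k)"
  proof -
    have "(\<integral>\<^sup>+u. ennreal (exp (- k * u)) * indicator {0..} u \<partial>lborel) = ennreal (0 - (- exp (- k * 0) / k))"
    proof (rule nn_integral_FTC_atLeast)
      have "filterlim (\<lambda>x. k * x) at_top at_top"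
        using assms by (intro filterlim_tendsto_pos_mult_at_top[OF tendsto_const _ filterlim_ident])
      then have "((\<lambda>x. exp (- (k * x))) \<longlongrightarrow> 0) at_top"
        by (intro filterlim_compose[OF exp_at_bot]) (simp add: filterlim_uminus_at_top)
      then show "((\<lambda>x. - exp (- k * x) / k) \<longlongrightarrow> 0) at_top"
        using tendsto_divide[OF tendsto_minus, of "\<lambda>x. exp (- (k * x))" 0 at_top "\<lambda>_. k" k] assms by simp
    qed (use assms in \<open>auto intro!: derivative_eq_intros\<close>)
    then show ?thesis by simp
  qed
  have B: "(\<integral>\<^sup>+u. ennreal (exp (- k * \<bar>u\<bar>)) \<partial>lborel) = ennreal (2 / k)"
  proof -
    have "(\<integral>\<^sup>+u. ennreal (exp (- k * \<bar>u\<bar>)) \<partial>lborel) =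
        (\<integral>\<^sup>+u. ennreal (exp (- k * u)) * indicator {0..} u
           + ennreal (exp (- k * (-u))) * indicator {0..} (-u) \<partial>lborel)"
      by (rule nn_integral_cong_AE, rule AE_mp[OF AE_lborel_singleton[of 0]]) (auto split: split_indicator)
    also have "\<dots> = ennreal (1/k) + (\<integral>\<^sup>+u. ennreal (exp (- k * (-u))) * indicator {0..} (-u) \<partial>lborel)"
      by (subst nn_integral_add) (auto simp: A[simplified])
    also have "(\<integral>\<^sup>+u. ennreal (exp (- k * (-u))) * indicator {0..} (-u) \<partial>lborel) = ennreal (1/k)"
      using nn_integral_real_affine[of "\<lambda>u. ennreal (exp (- k * u)) * indicator {0..} u" "-1" 0] A by simp
    also have "ennreal (1/k) + ennreal (1/k) = ennreal (2/k)"
      using assms by (simp flip: ennreal_plus)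
    finally show ?thesis .
  qed
  show "integrable lborel (\<lambda>u. exp (- k * \<bar>u\<bar>))"
    by (rule integrableI_nonneg) (auto simp: B[simplified])
  show "(\<integral>u. exp (- k * \<bar>u\<bar>) \<partial>lborel) = 2 / k"
    using B assms by (subst integral_eq_nn_integral) auto
qed

text \<open>Moving a horizontal line in the plane. A bounded singularity at 0 is removable, so the line may cross
  it. Decay has to be checked only away from the imaginary axis: on the middle part of the strip the
  extended function is bounded by compactness.\<close>

lemma integral_horizontal_shift:
  fixes f :: "complex \<Rightarrow> complex"
  assumes hol: "f holomorphic_on {z. s0 < Im z \<and> Im z < s1} - {0}"
    and sing: "s0 < 0 \<Longrightarrow> 0 < s1 \<Longrightarrow> eventually (\<lambda>z. cmod (f z) \<le> B) (at 0)"
    and bound: "\<And>z. s0 < Im z \<Longrightarrow> Im z < s1 \<Longrightarrow> 1 \<le> \<bar>Re z\<bar> \<Longrightarrow> cmod (f z) \<le> C * exp (- k * \<bar>Re z\<bar>)"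
    and k: "k > 0"
    and s: "s \<in> {s0<..<s1}" "s' \<in> {s0<..<s1}" "s \<noteq> 0" "s' \<noteq> 0"
  shows "(\<integral>u. f (Complex u s) \<partial>lborel) = (\<integral>u. f (Complex u s') \<partial>lborel)"
proof -
  let ?T = "{z. s0 < Im z \<and> Im z < s1}"
  have T: "open ?T"
  proof -
    have "?T = {z. Im z > s0} \<inter> {z. Im z < s1}" by auto
    then show ?thesis by (simp add: open_Int open_halfspace_Im_gt open_halfspace_Im_lt)
  qed
  obtain h where h: "h holomorphic_on ?T" "\<And>z. z \<in> ?T - {0} \<Longrightarrow> h z = f z"
  proof (cases "0 \<in> ?T")
    case True
    then have "0 \<in> interior ?T" using T by (simp add: interior_open)
    from holomorphic_on_extend_bounded[OF hol this] sing True that show ?thesis by auto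
  next
    case False
    then have "?T - {0} = ?T" by blast
    then show ?thesis using hol that by auto
  qed
  \<comment> \<open>A strip with closure inside the given one, so that compactness applies.\<close>
  define r0 where "r0 = (s0 + min s s') / 2"
  define r1 where "r1 = (s1 + max s s') / 2"
  have r: "s0 < r0" "r1 < s1" "s \<in> {r0<..<r1}" "s' \<in> {r0<..<r1}"
    using s by (auto simp: r0_def r1_def min_def max_def)
  let ?T' = "{z. r0 < Im z \<and> Im z < r1}"
  have "compact (h ` cbox (Complex (-1) r0) (Complex 1 r1))"
  proof (rule compact_continuous_image)
    show "continuous_on (cbox (Complex (-1) r0) (Complex 1 r1)) h"
      by (rule continuous_on_subset[OF holomorphic_on_imp_continuous_on[OF h(1)]])
        (use r in \<open>auto simp: in_cbox_complex_iff\<close>)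
  qed auto
  then obtain B' where B': "\<And>z. z \<in> cbox (Complex (-1) r0) (Complex 1 r1) \<Longrightarrow> cmod (h z) \<le> B'"
    by (meson bounded_iff compact_imp_bounded imageI)
  define C' where "C' = max (max C (B' * exp k)) 0"
  have hb: "cmod (h z) \<le> C' * exp (- k * \<bar>Re z\<bar>)" if z: "z \<in> ?T'" for z
  proof (cases "1 \<le> \<bar>Re z\<bar>")
    case True
    then have "z \<noteq> 0" by auto
    with True have "cmod (h z) \<le> C * exp (- k * \<bar>Re z\<bar>)" using bound[of z] z r h(2) by auto
    also have "\<dots> \<le> C' * exp (- k * \<bar>Re z\<bar>)" by (intro mult_right_mono) (auto simp: C'_def)
    finally show ?thesis .
  next
    case False
    then have "cmod (h z) \<le> B'" using z by (intro B') (auto simp: in_cbox_complex_iff)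
    then have "0 \<le> B'" by (meson norm_ge_zero order_trans)
    have "cmod (h z) \<le> B' * exp k * exp (-k)" using \<open>cmod (h z) \<le> B'\<close> by (simp add: exp_minus field_simps)
    also have "\<dots> \<le> B' * exp k * exp (- k * \<bar>Re z\<bar>)"
      using False k \<open>0 \<le> B'\<close> by (intro mult_left_mono) auto
    also have "\<dots> \<le> C' * exp (- k * \<bar>Re z\<bar>)" by (intro mult_right_mono) (auto simp: C'_def)
    finally show ?thesis .
  qed
  have eq: "(\<integral>u. h (of_real u + Complex 0 s) \<partial>lborel) = (\<integral>u. h (of_real u + Complex 0 s') \<partial>lborel)"
  proof (rule integral_shift_imaginary[where F = "\<lambda>u z. h (of_real u + z)" and d = "1::real"
        and ?s0.0 = r0 and ?s1.0 = r1 and g = "\<lambda>u. C' * exp k * exp (- k * \<bar>u\<bar>)"])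
    show "(\<lambda>z. h (of_real t + z)) holomorphic_on {z. \<bar>Re z\<bar> < 1 \<and> r0 < Im z \<and> Im z < r1}" for t
      by (rule holomorphic_on_compose_gen[OF _ h(1), unfolded o_def]) (use r in \<open>auto intro!: holomorphic_intros\<close>)
    show "h (complex_of_real t + (z + complex_of_real \<sigma>)) = h (complex_of_real (\<sigma> *\<^sub>R 1 + t) + z)" for t z \<sigma>
      by (simp add: algebra_simps)
    show "(\<lambda>t. h (complex_of_real t + z)) \<in> borel_measurable borel"
      if "z \<in> {z. \<bar>Re z\<bar> < 1 \<and> r0 < Im z \<and> Im z < r1}" for z
    proof (rule borel_measurable_continuous_onI)
      show "continuous_on UNIV (\<lambda>t. h (complex_of_real t + z))"
        by (rule continuous_on_compose2[OF holomorphic_on_imp_continuous_on[OF h(1)]])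
          (use that r in \<open>auto intro!: continuous_intros\<close>)
    qed
    show "cmod (h (complex_of_real t + z)) \<le> C' * exp k * exp (- k * \<bar>t\<bar>)"
      if "z \<in> {z. \<bar>Re z\<bar> < 1 \<and> r0 < Im z \<and> Im z < r1}" for t z
    proof -
      have "cmod (h (complex_of_real t + z)) \<le> C' * exp (- k * \<bar>t + Re z\<bar>)"
        using hb[of "of_real t + z"] that by auto
      also have "\<dots> \<le> C' * (exp k * exp (- k * \<bar>t\<bar>))"
      proof -
        have "\<bar>t\<bar> - 1 \<le> \<bar>t + Re z\<bar>" using that by auto
        then have "- k * \<bar>t + Re z\<bar> \<le> - k * (\<bar>t\<bar> - 1)" using k by (intro mult_left_mono_neg) auto
        then show ?thesis by (intro mult_left_mono) (auto simp: C'_def algebra_simps simp flip: exp_add)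
      qed
      finally show ?thesis by simp
    qed
    show "integrable lborel (\<lambda>u. C' * exp k * exp (- k * \<bar>u\<bar>))"
      using integral_exp_neg_abs(1)[OF k] by auto
  qed (use r in auto)
  have "h (of_real u + Complex 0 r) = f (Complex u r)" if "r \<in> {s0<..<s1}" "r \<noteq> 0" for u r
  proof -
    have "of_real u + Complex 0 r = Complex u r" by (simp add: complex_eq_iff)
    moreover have "Complex u r \<in> ?T - {0}" using that by (auto simp: complex_eq_iff)
    ultimately show ?thesis using h(2) by metis
  qed
  then show ?thesis using eq s by simp
qed

section \<open>The hyperbolic sine and integrals along the line at height pi/2\<close>

lemma Re_sinh: "Re (sinh z) = sinh (Re z) * cos (Im z)"
  and Im_sinh: "Im (sinh z) = cosh (Re z) * sin (Im z)"
  by (simp_all add: sinh_def cosh_def scaleR_conv_of_real Re_exp Im_exp algebra_simps)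

lemma cmod_sinh_ge_cosh: "\<bar>sin (Im z)\<bar> * cosh (Re z) \<le> cmod (sinh z)"
  using abs_Im_le_cmod[of "sinh z"] by (simp add: Im_sinh abs_mult mult.commute)

lemma cmod_sinh_ge_sinh: "\<bar>sinh (Re z)\<bar> \<le> cmod (sinh z)"
proof -
  have "(cmod (sinh z))\<^sup>2 = (sinh (Re z))\<^sup>2 * (cos (Im z))\<^sup>2 + (1 + (sinh (Re z))\<^sup>2) * (sin (Im z))\<^sup>2"
    by (simp add: cmod_power2 Re_sinh Im_sinh power_mult_distrib cosh_square_eq)
  also have "\<dots> = (sinh (Re z))\<^sup>2 * ((sin (Im z))\<^sup>2 + (cos (Im z))\<^sup>2) + (sin (Im z))\<^sup>2"
    by (simp only: algebra_simps)
  finally have "(cmod (sinh z))\<^sup>2 = (sinh (Re z))\<^sup>2 + (sin (Im z))\<^sup>2" by simp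
  then have "\<bar>sinh (Re z)\<bar>\<^sup>2 \<le> (cmod (sinh z))\<^sup>2" by simp
  then show ?thesis using power2_le_imp_le norm_ge_zero by blast
qed

lemma cosh_ge_exp_abs: "exp \<bar>x\<bar> / 2 \<le> cosh (x::real)"
  by (cases "x \<ge> 0") (auto simp: cosh_def)

lemma abs_sinh_ge_exp: 
  assumes "1 \<le> \<bar>x::real\<bar>" shows "exp \<bar>x\<bar> / 4 \<le> \<bar>sinh x\<bar>"
proof -
  have "exp y / 4 \<le> sinh y" if "1 \<le> y" for y :: real
  proof -
    have "2 \<le> exp y" using exp_ge_add_one_self[of y] that by linarith
    moreover have "exp (-y) \<le> 1" using that by simp
    moreover have "a / 4 \<le> (a - b) / 2" if "2 \<le> a" "b \<le> 1" for a b :: real using that by (simp add: field_simps)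
    ultimately have "exp y / 4 \<le> (exp y - exp (-y)) / 2" by blast
    then show ?thesis by (simp add: sinh_def)
  qed
  from this[OF assms] show ?thesis by (cases "x \<ge> 0") auto
qed

lemma abs_le_abs_sinh: "\<bar>x\<bar> \<le> \<bar>sinh (x::real)\<bar>"
proof -
  have *: "y \<le> sinh y" if "0 \<le> y" for y :: real
  proof -
    have "sinh 0 - 0 \<le> sinh y - y"
    proof (rule DERIV_nonneg_imp_nondecreasing[OF that])
      fix x :: real
      have "((\<lambda>y. sinh y - y) has_real_derivative cosh x - 1) (at x)"
        by (auto intro!: derivative_eq_intros)
      then show "\<exists>d. ((\<lambda>y. sinh y - y) has_real_derivative d) (at x) \<and> 0 \<le> d"
        using cosh_real_ge_1[of x] by (intro exI[of _ "cosh x - 1"]) auto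
    qed
    then show ?thesis by simp
  qed
  show ?thesis using *[of "\<bar>x\<bar>"] by (cases "x \<ge> 0") auto
qed

text \<open>Second order Taylor expansion of the exponential function; the even terms cancel.\<close>

lemma cmod_sinh_minus_self:
  assumes "cmod u \<le> 1/2"
  shows "cmod (sinh u - u) \<le> 2 * cmod u ^ 3" "cmod u / 2 \<le> cmod (sinh u)"
proof -
  have T: "cmod (exp w - (1 + w + w\<^sup>2 / 2)) \<le> exp (1/2) * cmod w ^ 3 / 2" if "cmod w \<le> 1/2" for w
  proof -
    have "cmod (exp w - (\<Sum>i\<le>2. w ^ i / fact i)) \<le> exp \<bar>Re w\<bar> * cmod w ^ (Suc 2) / fact 2"
      by (rule Taylor_exp)
    moreover have "(\<Sum>i\<le>2. w ^ i / fact i) = 1 + w + w\<^sup>2 / 2" by (simp add: numeral_2_eq_2)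
    moreover have "exp \<bar>Re w\<bar> * cmod w ^ 3 / 2 \<le> exp (1/2) * cmod w ^ 3 / 2"
      using that abs_Re_le_cmod[of w] by (intro divide_right_mono mult_right_mono) auto
    ultimately show ?thesis by simp
  qed
  have e: "exp (1/2::real) \<le> 2"
  proof -
    have "exp (1/2::real) ^ 2 \<le> 3" using e_less_272 by (simp flip: exp_double)
    also have "\<dots> \<le> 2\<^sup>2" by simp
    finally show ?thesis by (rule power2_le_imp_le) simp
  qed
  have eq: "sinh u - u = ((exp u - (1 + u + u\<^sup>2/2)) - (exp (-u) - (1 + (-u) + (-u)\<^sup>2/2))) / 2"
    by (simp add: sinh_def scaleR_conv_of_real field_simps)
  have "cmod ((exp u - (1 + u + u\<^sup>2/2)) - (exp (-u) - (1 + (-u) + (-u)\<^sup>2/2)))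
      \<le> exp (1/2) * cmod u ^ 3 / 2 + exp (1/2) * cmod (-u) ^ 3 / 2"
    using assms by (intro order.trans[OF norm_triangle_ineq4 add_mono] T) auto
  then have "cmod (sinh u - u) \<le> (exp (1/2) * cmod u ^ 3 / 2 + exp (1/2) * cmod (-u) ^ 3 / 2) / 2"
    unfolding eq norm_divide by simp
  also have "\<dots> \<le> exp (1/2) * cmod u ^ 3" by simp
  also have "\<dots> \<le> 2 * cmod u ^ 3"
    unfolding norm_minus_cancel using mult_right_mono[OF e, of "cmod u ^ 3"] by simp
  finally show 1: "cmod (sinh u - u) \<le> 2 * cmod u ^ 3" .
  have "2 * cmod u ^ 3 \<le> 2 * cmod u * (1/2)\<^sup>2"
    using mult_left_mono[OF power_mono[OF assms, of 2], of "2 * cmod u"]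
    by (simp add: power3_eq_cube power2_eq_square mult.assoc)
  then have "cmod (sinh u - u) \<le> cmod u / 2" using 1 by (simp add: power2_eq_square)
  then show "cmod u / 2 \<le> cmod (sinh u)"
    using norm_triangle_ineq2[of u "u - sinh u"] by (simp add: norm_minus_commute)
qed

text \<open>The two poles at 0 cancel, and so does the constant term because the difference is odd. This makes the
  quotient by \<open>sinh\<close> in \<open>qdilog_remainder\<close> bounded near 0.\<close>

lemma cmod_inverse_sinh_minus_inverse_small:
  assumes "u \<noteq> 0" and True: "cmod u \<le> 1/2"
  shows "cmod (1 / sinh u - 1 / u) \<le> 4 * cmod u"
proof -
  have p: "cmod u > 0" using assms by simp
  have s: "cmod u / 2 \<le> cmod (sinh u)" "cmod (sinh u - u) \<le> 2 * cmod u ^ 3"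
    using cmod_sinh_minus_self[OF True] by auto
  then have "sinh u \<noteq> 0" using p by auto
  then have "1 / sinh u - 1 / u = - (sinh u - u) / (sinh u * u)" using assms by (simp add: field_simps)
  then have "cmod (1 / sinh u - 1 / u) = cmod (sinh u - u) / (cmod (sinh u) * cmod u)"
    by (simp add: norm_divide norm_mult norm_minus_commute)
  also have "\<dots> \<le> 2 * cmod u ^ 3 / (cmod u / 2 * cmod u)"
    using s p by (intro frac_le mult_mono) auto
  also have "\<dots> = 4 * cmod u" using p by (simp add: field_simps power3_eq_cube)
  finally show ?thesis .
qed

lemma cmod_inverse_sinh_minus_inverse:
  assumes "u \<noteq> 0" "\<bar>Im u\<bar> \<le> 1/4"
  shows "cmod (1 / sinh u - 1 / u) \<le> 5"
proof (cases "cmod u \<le> 1/2")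
  case True
  then show ?thesis using cmod_inverse_sinh_minus_inverse_small[OF assms(1)] by fastforce
next
  case False
  have "(1/2)\<^sup>2 \<le> (cmod u)\<^sup>2" using False by (intro power_mono) auto
  moreover have "(Im u)\<^sup>2 \<le> (1/4)\<^sup>2" using assms(2) by (metis abs_le_square_iff abs_of_nonneg divide_nonneg_nonneg zero_le_numeral zero_le_one)
  ultimately have "(1/2)\<^sup>2 - (1/4)\<^sup>2 \<le> \<bar>Re u\<bar>\<^sup>2" by (simp add: cmod_power2)
  then have "(1/3)\<^sup>2 \<le> \<bar>Re u\<bar>\<^sup>2" by (simp add: power2_eq_square)
  then have "1/3 \<le> \<bar>Re u\<bar>" using power2_le_imp_le abs_ge_zero by blast
  also have "\<dots> \<le> cmod (sinh u)" using abs_le_abs_sinh[of "Re u"] cmod_sinh_ge_sinh[of u] by linarith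
  finally have "1/3 \<le> cmod (sinh u)" .
  then have "1 / cmod (sinh u) \<le> 1/(1/3)" by (intro frac_le) auto
  moreover have "1 / cmod u \<le> 1/(1/2)" using False by (intro frac_le) auto
  ultimately show ?thesis
    using norm_triangle_ineq4[of "1 / sinh u" "1/u"] by (simp add: norm_divide)
qed

lemma sinh_nonzero_strip:
  assumes "0 < \<bar>Im v\<bar>" "\<bar>Im v\<bar> < pi" shows "sinh v \<noteq> (0::complex)"
proof -
  have "sin (Im v) \<noteq> 0" using assms sin_gt_zero[of "\<bar>Im v\<bar>"] by (cases "Im v > 0") auto
  then have "\<bar>sin (Im v)\<bar> * cosh (Re v) > 0" by simp
  then show ?thesis using cmod_sinh_ge_cosh[of v] by auto
qed

lemma sinh_nonzero_strip':
  assumes "\<bar>Im v\<bar> < pi" "v \<noteq> 0" shows "sinh v \<noteq> (0::complex)"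
proof (cases "Im v = 0")
  case True
  then have "Re v \<noteq> 0" using assms by (auto simp: complex_eq_iff)
  then have "\<bar>sinh (Re v)\<bar> > 0" by simp
  then show ?thesis using cmod_sinh_ge_sinh[of v] by auto
qed (use sinh_nonzero_strip assms in auto)

text \<open>The point above \<open>u\<close> on the horizontal line halfway between the poles 0 and \<open>pi i\<close> of \<open>1 / sinh\<close>.\<close>

definition vert :: "real \<Rightarrow> complex" where "vert u = Complex u (pi/2)"

lemma vert_simps [simp]: "Re (vert u) = u" "Im (vert u) = pi/2" "vert u \<noteq> 0"
  by (auto simp: vert_def complex_eq_iff)

lemma sinh_vert: "sinh (vert u) = \<i> * of_real (cosh u)"
  by (simp add: complex_eq_iff Re_sinh Im_sinh)

lemma cmod_vert_ge: "1 \<le> cmod (vert u)"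
  using abs_Im_le_cmod[of "vert u"] pi_gt3 by simp

lemma continuous_on_vert [continuous_intros]: "continuous_on A vert"
  unfolding vert_def Complex_eq by (intro continuous_intros)

lemma cmod_exp_line: "cmod (exp (- \<i> * Z * v / of_real pi)) = exp ((Re Z * Im v + Im Z * Re v) / pi)"
  by (simp add: field_simps)

lemma cmod_exp_line_le:
  assumes "\<bar>Im v\<bar> \<le> pi"
  shows "cmod (exp (- \<i> * Z * v / of_real pi)) \<le> exp (\<bar>Re Z\<bar> + \<bar>Im Z\<bar> / pi * \<bar>Re v\<bar>)"
proof -
  have "Re Z * Im v \<le> \<bar>Re Z\<bar> * \<bar>Im v\<bar>" by (metis abs_ge_self abs_mult)
  also have "\<dots> \<le> \<bar>Re Z\<bar> * pi" using assms by (intro mult_left_mono) auto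
  finally have "Re Z * Im v / pi \<le> \<bar>Re Z\<bar>" by (simp add: field_simps)
  moreover have "Im Z * Re v / pi \<le> \<bar>Im Z\<bar> / pi * \<bar>Re v\<bar>"
    by (simp add: divide_right_mono flip: abs_mult)
  ultimately show ?thesis unfolding cmod_exp_line by (simp add: add_divide_distrib)
qed

text \<open>All functions of dilogarithm type below are integrals of this form, with kernels that have their poles on
  the imaginary axis. For a kernel of size \<open>O (e\<^bsup>- |u|\<^esup>)\<close> along the line, the integral converges and is
  holomorphic for \<open>|Im Z| < pi\<close>, and it is \<open>O (e\<^bsup>Re Z / 2\<^esup>)\<close>.\<close>

definition line_transform :: "(complex \<Rightarrow> complex) \<Rightarrow> complex \<Rightarrow> complex" where
  "line_transform k Z = (\<integral>u. exp (- \<i> * Z * vert u / of_real pi) * k (vert u) \<partial>lborel)"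

definition decaying :: "real \<Rightarrow> (complex \<Rightarrow> complex) \<Rightarrow> bool" where
  "decaying K k \<longleftrightarrow> continuous_on UNIV (\<lambda>u. k (vert u)) \<and> (\<forall>u. cmod (k (vert u)) \<le> K * exp (- \<bar>u\<bar>))"

lemma decayingD: "decaying K k \<Longrightarrow> cmod (k (vert u)) \<le> K * exp (- \<bar>u\<bar>)"
  and decaying_cont: "decaying K k \<Longrightarrow> continuous_on UNIV (\<lambda>u. k (vert u))"
  and decaying_nonneg: "decaying K k \<Longrightarrow> 0 \<le> K"
proof -
  show *: "decaying K k \<Longrightarrow> cmod (k (vert u)) \<le> K * exp (- \<bar>u\<bar>)" for u by (simp add: decaying_def)
  show "decaying K k \<Longrightarrow> 0 \<le> K" using *[of 0] by simp (metis norm_ge_zero order_trans)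
qed (simp add: decaying_def)

lemma decaying_integrand_bound:
  assumes "decaying K k"
  shows "cmod (exp (- \<i> * Z * vert u / of_real pi) * k (vert u))
    \<le> K * exp (Re Z / 2) * exp (- (1 - \<bar>Im Z\<bar> / pi) * \<bar>u\<bar>)"
proof -
  have "Im Z * u \<le> \<bar>Im Z\<bar> * \<bar>u\<bar>" by (metis abs_ge_self abs_mult)
  then have "(Re Z * (pi/2) + Im Z * u) / pi \<le> Re Z / 2 + \<bar>Im Z\<bar> / pi * \<bar>u\<bar>"
    by (simp add: field_simps)
  then have "exp ((Re Z * (pi/2) + Im Z * u) / pi) \<le> exp (Re Z / 2 + \<bar>Im Z\<bar> / pi * \<bar>u\<bar>)" by simp
  then have "cmod (exp (- \<i> * Z * vert u / of_real pi)) * cmod (k (vert u))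
    \<le> exp (Re Z / 2 + \<bar>Im Z\<bar> / pi * \<bar>u\<bar>) * (K * exp (- \<bar>u\<bar>))"
    using decayingD[OF assms, of u] unfolding cmod_exp_line by (intro mult_mono) auto
  also have "\<dots> = K * exp (Re Z / 2) * exp (- (1 - \<bar>Im Z\<bar> / pi) * \<bar>u\<bar>)"
    by (simp add: algebra_simps flip: exp_add)
  finally show ?thesis by (simp add: norm_mult)
qed

lemma decaying_integrand_measurable:
  "decaying K k \<Longrightarrow> (\<lambda>u. exp (- \<i> * Z * vert u / of_real pi) * k (vert u)) \<in> borel_measurable borel"
  by (intro borel_measurable_continuous_onI continuous_intros) (auto simp: decaying_cont)

lemma decaying_integrable:
  assumes "decaying K k" "\<bar>Im Z\<bar> < pi"
  shows "integrable lborel (\<lambda>u. exp (- \<i> * Z * vert u / of_real pi) * k (vert u))"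
proof (rule Bochner_Integration.integrable_bound)
  have "1 - \<bar>Im Z\<bar> / pi > 0" using assms by simp
  from integral_exp_neg_abs(1)[OF this]
  show "integrable lborel (\<lambda>u. K * exp (Re Z / 2) * exp (- (1 - \<bar>Im Z\<bar> / pi) * \<bar>u\<bar>))" by simp
  show "AE u in lborel. norm (exp (- \<i> * Z * vert u / of_real pi) * k (vert u))
      \<le> norm (K * exp (Re Z / 2) * exp (- (1 - \<bar>Im Z\<bar> / pi) * \<bar>u\<bar>))"
    using decaying_integrand_bound[OF assms(1)] decaying_nonneg[OF assms(1)]
    by (intro AE_I2) (simp add: abs_mult)
qed (use decaying_integrand_measurable[OF assms(1)] in simp)

lemma line_transform_bound:
  assumes "decaying K k" "\<bar>Im Z\<bar> < pi"
  shows "cmod (line_transform k Z) \<le> K * exp (Re Z / 2) * (2 / (1 - \<bar>Im Z\<bar> / pi))"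
proof -
  have p: "1 - \<bar>Im Z\<bar> / pi > 0" using assms by simp
  have "cmod (line_transform k Z) \<le> (\<integral>u. K * exp (Re Z / 2) * exp (- (1 - \<bar>Im Z\<bar> / pi) * \<bar>u\<bar>) \<partial>lborel)"
    unfolding line_transform_def
  proof (rule Bochner_Integration.integral_norm_bound_integral)
    show "integrable lborel (\<lambda>u. K * exp (Re Z / 2) * exp (- (1 - \<bar>Im Z\<bar> / pi) * \<bar>u\<bar>))"
      using integral_exp_neg_abs(1)[OF p] by (rule integrable_mult_right)
  qed (rule decaying_integrable[OF assms] decaying_integrand_bound[OF assms(1)])+
  then show ?thesis using integral_exp_neg_abs(2)[OF p] by simp
qed

lemma line_transform_add:
  assumes "decaying K k" "decaying K' k'" "\<bar>Im Z\<bar> < pi"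
  shows "line_transform (\<lambda>v. k v + k' v) Z = line_transform k Z + line_transform k' Z"
  unfolding line_transform_def distrib_left
  using decaying_integrable assms by (intro Bochner_Integration.integral_add) auto

lemma line_transform_cmult: "line_transform (\<lambda>v. c * k v) Z = c * line_transform k Z"
  unfolding line_transform_def by (subst integral_mult_right_zero[symmetric]) (simp add: mult_ac)

lemma line_transform_cong: "(\<And>u. k (vert u) = k' (vert u)) \<Longrightarrow> line_transform k Z = line_transform k' Z"
  unfolding line_transform_def by simp

lemma has_field_derivative_line_transform:
  assumes k: "decaying K k" and Z: "\<bar>Im Z\<bar> < pi"
  shows "(line_transform k has_field_derivative (- \<i> / of_real pi) * line_transform (\<lambda>v. v * k v) Z) (at Z)"
proof -
  define c where "c = (\<bar>Im Z\<bar> + pi) / 2"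
  define S where "S = {w. Im w < c} \<inter> {w. Im w > -c} \<inter> {w. Re w < Re Z + 1}"
  have c: "c < pi" "\<bar>Im Z\<bar> < c" using Z by (auto simp: c_def)
  have S: "open S" "Z \<in> S"
    using c by (auto simp: S_def intro!: open_Int open_halfspace_Im_lt open_halfspace_Im_gt open_halfspace_Re_lt)
  let ?F = "\<lambda>u w. exp (- \<i> * w * vert u / of_real pi) * k (vert u)"
  have d: "(?F u has_field_derivative (- \<i> / of_real pi) * (exp (- \<i> * w * vert u / of_real pi) * (vert u * k (vert u)))) (at w)"
    for u w by (auto intro!: derivative_eq_intros)
  have "((\<lambda>w. \<integral>u. ?F u w \<partial>lborel) has_field_derivative (\<integral>u. deriv (?F u) Z \<partial>lborel)) (at Z)"
  proof (rule has_field_derivative_lebesgue_integral[OF S])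
    show "?F u holomorphic_on S" for u by (intro holomorphic_intros) auto
    show "(\<lambda>u. ?F u w) \<in> borel_measurable lborel" for w
      using decaying_integrand_measurable[OF k] by simp
    show "cmod (?F u w) \<le> K * exp ((Re Z + 1) / 2) * exp (- (1 - c / pi) * \<bar>u\<bar>)" if "w \<in> S" for u w
    proof -
      have w: "\<bar>Im w\<bar> \<le> c" "Re w \<le> Re Z + 1" using that by (auto simp: S_def)
      have "\<bar>Im w\<bar> / pi \<le> c / pi" using w by (intro divide_right_mono) auto
      then have "- (1 - \<bar>Im w\<bar> / pi) * \<bar>u\<bar> \<le> - (1 - c / pi) * \<bar>u\<bar>" by (intro mult_right_mono) auto
      then have "K * exp (Re w / 2) * exp (- (1 - \<bar>Im w\<bar> / pi) * \<bar>u\<bar>)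
         \<le> K * exp ((Re Z + 1) / 2) * exp (- (1 - c / pi) * \<bar>u\<bar>)"
        using w decaying_nonneg[OF k] by (intro mult_mono) auto
      then show ?thesis using decaying_integrand_bound[OF k, of w u] by linarith
    qed
    have "1 - c / pi > 0" using c by simp
    from integral_exp_neg_abs(1)[OF this]
    show "integrable lborel (\<lambda>u. K * exp ((Re Z + 1) / 2) * exp (- (1 - c / pi) * \<bar>u\<bar>))" by simp
  qed
  moreover have "(\<integral>u. deriv (?F u) Z \<partial>lborel) = (- \<i> / of_real pi) * line_transform (\<lambda>v. v * k v) Z"
    unfolding line_transform_def DERIV_imp_deriv[OF d] by (rule integral_mult_right_zero)
  ultimately show ?thesis unfolding line_transform_def by simp
qed

lemma holomorphic_on_sinh [holomorphic_intros]:
  "f holomorphic_on A \<Longrightarrow> (\<lambda>z. sinh (f z :: complex)) holomorphic_on A"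
  unfolding sinh_def scaleR_conv_of_real by (intro holomorphic_intros) auto

lemma integral_inverse_cosh:
  "(\<integral>u. 1 / cosh u \<partial>lborel) = pi" "integrable lborel (\<lambda>u::real. 1 / cosh u)"
proof -
  have A: "((\<lambda>u. 2 * arctan (exp u)) has_real_derivative 1 / cosh x) (at x)" for x :: real
  proof -
    have "((\<lambda>u. 2 * arctan (exp u)) has_real_derivative 2 * (inverse (1 + (exp x)\<^sup>2) * exp x)) (at x)"
      by (auto intro!: derivative_eq_intros simp: field_simps)
    moreover have "2 * (inverse (1 + (exp x)\<^sup>2) * exp x) = 1 / cosh x"
    proof -
      have "1 + (exp x)\<^sup>2 \<noteq> 0" by (metis add_pos_nonneg less_irrefl zero_le_power2 zero_less_one)
      then show ?thesis by (simp add: cosh_def exp_minus divide_simps power2_eq_square)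
    qed
    ultimately show ?thesis by simp
  qed
  have lims: "((\<lambda>u. 2 * arctan (exp u)) \<longlongrightarrow> 0) at_bot" "((\<lambda>u. 2 * arctan (exp u)) \<longlongrightarrow> pi) at_top"
  proof -
    have "((\<lambda>u. 2 * arctan (exp u)) \<longlongrightarrow> 2 * arctan 0) (at_bot :: real filter)"
      by (intro tendsto_intros exp_at_bot)
    then show "((\<lambda>u. 2 * arctan (exp u)) \<longlongrightarrow> 0) (at_bot :: real filter)" by simp
    have "((\<lambda>u. 2 * arctan (exp u)) \<longlongrightarrow> 2 * (pi/2)) (at_top :: real filter)"
      by (intro tendsto_mult tendsto_const filterlim_compose[OF tendsto_arctan_at_top exp_at_top])
    then show "((\<lambda>u. 2 * arctan (exp u)) \<longlongrightarrow> pi) (at_top :: real filter)" by simp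
  qed
  have I: "set_integrable lborel (einterval (-\<infinity>) \<infinity>) (\<lambda>u::real. 1 / cosh u)"
      "(LBINT u=-\<infinity>..\<infinity>. 1 / cosh u) = pi - 0"
    by (rule interval_integral_FTC_nonneg[where F = "\<lambda>u. 2 * arctan (exp u)" and A = 0 and B = pi];
        use lims in \<open>auto intro!: A continuous_intros simp: ereal_tendsto_simps cosh_real_nonneg\<close>)+
  show "integrable lborel (\<lambda>u::real. 1 / cosh u)"
    using I(1) by (simp add: set_integrable_def)
  show "(\<integral>u. 1 / cosh u \<partial>lborel) = pi"
    using I(2) by (simp add: interval_lebesgue_integral_def set_lebesgue_integral_def)
qed

lemma decaying_divide_sinh:
  assumes "continuous_on UNIV (\<lambda>u. g (vert u))" "\<And>u. cmod (g (vert u)) \<le> K"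
  shows "decaying (2 * K) (\<lambda>v. g v / sinh v)"
proof -
  have "cmod (g (vert u) / sinh (vert u)) \<le> 2 * K * exp (- \<bar>u\<bar>)" for u
  proof -
    have "0 \<le> K" using assms(2)[of u] norm_ge_zero order_trans by blast
    then have "K / cosh u \<le> K / (exp \<bar>u\<bar> / 2)" using cosh_ge_exp_abs[of u] by (intro frac_le) auto
    moreover have "cmod (g (vert u)) / cosh u \<le> K / cosh u" using assms(2) by (intro divide_right_mono) auto
    moreover have "cmod (g (vert u) / sinh (vert u)) = cmod (g (vert u)) / cosh u"
      by (simp add: sinh_vert norm_divide norm_mult)
    ultimately have "cmod (g (vert u) / sinh (vert u)) \<le> K / (exp \<bar>u\<bar> / 2)" by linarith
    then show ?thesis by (simp add: exp_minus field_simps)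
  qed
  moreover have "continuous_on UNIV (\<lambda>u. g (vert u) / sinh (vert u))"
    unfolding sinh_vert using assms(1) by (intro continuous_intros) auto
  ultimately show ?thesis unfolding decaying_def by blast
qed

lemma one_plus_exp_nonzero:
  assumes "\<bar>Im Z\<bar> < pi" shows "1 + exp Z \<noteq> 0"
proof
  assume "1 + exp Z = 0"
  then have "exp Z = exp (\<i> * of_real pi)" by (simp add: add_eq_0_iff minus_equation_iff)
  then obtain n :: int where "Z = \<i> * of_real pi + (of_int (2 * n) * of_real pi) * \<i>"
    by (subst (asm) exp_eq) (auto simp: mult_ac)
  then have "Im Z = (1 + 2 * of_int n) * pi" by (simp add: algebra_simps)
  then have "\<bar>1 + 2 * real_of_int n\<bar> * pi < 1 * pi" using assms by (simp add: abs_mult)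
  then have "\<bar>1 + 2 * real_of_int n\<bar> < 1" using mult_less_cancel_right_pos[OF pi_gt_zero] by blast
  then have "\<bar>1 + 2 * n\<bar> < 1" by linarith
  then show False by presburger
qed

text \<open>Shifting the line down by \<open>pi i\<close> multiplies the integrand by \<open>- e\<^bsup>- Z\<^esup>\<close>, and the line crosses the pole at 0.
  Subtracting \<open>1 / sinh v\<close>, whose integral along the line is \<open>- i pi\<close>, removes the pole, so that the shifted
  integrals give a linear equation for the transform.\<close>

lemma line_transform_inverse_sinh:
  assumes Z: "\<bar>Im Z\<bar> < pi"
  shows "line_transform (\<lambda>v. 1 / sinh v) Z = - 2 * of_real pi * \<i> * exp Z / (1 + exp Z)"
proof -
  define E where "E = (\<lambda>v. exp (- \<i> * Z * v / of_real pi))"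
  define f where "f = (\<lambda>v. (E v - 1) / sinh v)"
  define k where "k = 1 - \<bar>Im Z\<bar> / pi"
  have k: "0 < k" "k \<le> 1" using Z by (auto simp: k_def)
  have p2: "pi/2 < 2" "- (pi/2) > -2" "- (pi/2) < 2" using pi_less_4 pi_gt_zero by linarith+
  have shift: "(\<integral>u. f (Complex u (pi/2)) \<partial>lborel) = (\<integral>u. f (Complex u (- (pi/2))) \<partial>lborel)"
  proof (rule integral_horizontal_shift[where ?s0.0 = "-2" and ?s1.0 = 2])
    show "f holomorphic_on {z. - 2 < Im z \<and> Im z < 2} - {0}"
      unfolding f_def E_def
    proof (intro holomorphic_intros)
      fix v assume "v \<in> {z. - 2 < Im z \<and> Im z < 2} - {0}"
      then show "sinh v \<noteq> 0" using pi_gt3 by (intro sinh_nonzero_strip') auto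
    qed simp
    show "\<forall>\<^sub>F v in at 0. cmod (f v) \<le> cmod (- \<i> * Z / of_real pi) + 1"
    proof -
      have "(E has_field_derivative (- \<i> * Z / of_real pi)) (at 0)"
        unfolding E_def by (auto intro!: derivative_eq_intros)
      then have 1: "((\<lambda>v. (E v - 1) / v) \<longlongrightarrow> - \<i> * Z / of_real pi) (at 0)"
        by (simp add: has_field_derivative_iff E_def)
      have "(sinh has_field_derivative (1::complex)) (at 0)"
        by (auto intro!: derivative_eq_intros)
      then have 2: "((\<lambda>v::complex. sinh v / v) \<longlongrightarrow> 1) (at 0)"
        by (simp add: has_field_derivative_iff)
      have "((\<lambda>v. ((E v - 1) / v) / (sinh v / v)) \<longlongrightarrow> (- \<i> * Z / of_real pi) / 1) (at 0)"
        by (intro tendsto_divide 1 2) simp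
      from this[unfolded div_by_1] have "(f \<longlongrightarrow> - \<i> * Z / of_real pi) (at 0)"
        by (rule Lim_transform_eventually) (auto simp: eventually_at_filter f_def)
      then have "((\<lambda>v. cmod (f v)) \<longlongrightarrow> cmod (- \<i> * Z / of_real pi)) (at 0)" by (rule tendsto_norm)
      then have "\<forall>\<^sub>F v in at 0. cmod (f v) < cmod (- \<i> * Z / of_real pi) + 1" by (rule order_tendstoD) simp
      then show ?thesis by (rule eventually_mono) simp
    qed
    show "cmod (f v) \<le> 4 * (exp (\<bar>Re Z\<bar>) + 1) * exp (- k * \<bar>Re v\<bar>)"
      if v: "- 2 < Im v" "Im v < 2" "1 \<le> \<bar>Re v\<bar>" for v
    proof -
      let ?x = "\<bar>Re v\<bar>"
      have "cmod (E v) \<le> exp (\<bar>Re Z\<bar> + \<bar>Im Z\<bar> / pi * ?x)"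
        unfolding E_def using v pi_gt3 by (intro cmod_exp_line_le) auto
      also have "\<dots> = exp \<bar>Re Z\<bar> * exp (\<bar>Im Z\<bar> / pi * ?x)" by (simp add: exp_add)
      finally have "cmod (E v - 1) \<le> exp \<bar>Re Z\<bar> * exp (\<bar>Im Z\<bar> / pi * ?x) + 1"
        using norm_triangle_ineq4[of "E v" 1] by simp
      also have "\<dots> \<le> exp \<bar>Re Z\<bar> * exp (\<bar>Im Z\<bar> / pi * ?x) + exp (\<bar>Im Z\<bar> / pi * ?x)"
        by simp
      finally have E: "cmod (E v - 1) \<le> (exp \<bar>Re Z\<bar> + 1) * exp (\<bar>Im Z\<bar> / pi * ?x)"
        by (simp add: algebra_simps)
      have s: "exp ?x / 4 \<le> cmod (sinh v)"
        using abs_sinh_ge_exp[OF v(3)] cmod_sinh_ge_sinh[of v] by linarith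
      have "cmod (f v) \<le> (exp \<bar>Re Z\<bar> + 1) * exp (\<bar>Im Z\<bar> / pi * ?x) / (exp ?x / 4)"
        unfolding f_def norm_divide using E s by (intro frac_le) auto
      also have "\<dots> = 4 * (exp (\<bar>Re Z\<bar>) + 1) * (exp (\<bar>Im Z\<bar> / pi * ?x) / exp ?x)" by simp
      also have "exp (\<bar>Im Z\<bar> / pi * ?x) / exp ?x = exp (- k * ?x)"
        by (simp add: k_def algebra_simps flip: exp_diff)
      finally show ?thesis .
    qed
    show "pi/2 \<in> {-2<..<2}" "- (pi/2) \<in> {-2<..<2}"
      unfolding greaterThanLessThan_iff using p2 pi_gt_zero by (intro conjI; linarith)+
  qed (use k in auto)
  let ?I = "line_transform (\<lambda>v. 1 / sinh v) Z"
  have dec: "decaying (2 * 1) (\<lambda>v. 1 / sinh v)"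
    by (rule decaying_divide_sinh) auto
  have int1: "integrable lborel (\<lambda>u. E (vert u) * (1 / sinh (vert u)))"
    using decaying_integrable[OF dec Z] unfolding E_def .
  have I: "?I = (\<integral>u. E (vert u) * (1 / sinh (vert u)) \<partial>lborel)"
    by (simp add: line_transform_def E_def)
  have int2: "integrable lborel (\<lambda>u. 1 / sinh (vert u))"
    using decaying_integrable[OF dec, of 0] by simp
  have I0: "(\<integral>u. 1 / sinh (vert u) \<partial>lborel) = - \<i> * of_real pi"
  proof -
    have "(\<integral>u. 1 / sinh (vert u) \<partial>lborel) = (\<integral>u. - \<i> * of_real (1 / cosh u) \<partial>lborel)"
      by (rule Bochner_Integration.integral_cong) (auto simp: sinh_vert field_simps)
    also have "\<dots> = - \<i> * of_real pi"
      by (simp only: integral_mult_right_zero integral_complex_of_real integral_inverse_cosh)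
    finally show ?thesis .
  qed
  have "(\<integral>u. f (Complex u (pi/2)) \<partial>lborel) = (\<integral>u. E (vert u) * (1 / sinh (vert u)) - 1 / sinh (vert u) \<partial>lborel)"
    by (simp add: f_def diff_divide_distrib flip: vert_def)
  also have "\<dots> = ?I + \<i> * of_real pi"
    using int1 int2 by (subst Bochner_Integration.integral_diff) (auto simp: I I0)
  finally have up: "(\<integral>u. f (Complex u (pi/2)) \<partial>lborel) = ?I + \<i> * of_real pi" .
  have "f (Complex u (- (pi/2))) = - exp (- Z) * (E (vert u) * (1 / sinh (vert u))) + 1 / sinh (vert u)" for u
  proof -
    have low: "Complex u (- (pi/2)) = vert u - \<i> * of_real pi" by (simp add: vert_def complex_eq_iff)
    have "sinh (vert u - \<i> * of_real pi) = - sinh (vert u)"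
      by (simp add: complex_eq_iff Re_sinh Im_sinh)
    moreover have "E (vert u - \<i> * of_real pi) = E (vert u) * exp (- Z)"
    proof -
      have "- \<i> * Z * (vert u - \<i> * of_real pi) / of_real pi = - \<i> * Z * vert u / of_real pi + (- Z)"
        by (simp add: field_simps)
      then show ?thesis unfolding E_def by (simp only: exp_add)
    qed
    ultimately show ?thesis unfolding low f_def by (simp add: field_simps diff_divide_distrib)
  qed
  then have "(\<integral>u. f (Complex u (- (pi/2))) \<partial>lborel)
      = (\<integral>u. - exp (- Z) * (E (vert u) * (1 / sinh (vert u))) + 1 / sinh (vert u) \<partial>lborel)" by simp
  also have "\<dots> = - exp (- Z) * ?I - \<i> * of_real pi"
    unfolding Bochner_Integration.integral_add[OF integrable_mult_right[OF int1] int2]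
      integral_mult_right_zero I[symmetric] I0 by simp
  finally have "?I + \<i> * of_real pi = - exp (- Z) * ?I - \<i> * of_real pi" using up shift by simp
  then have "?I + exp (- Z) * ?I = - 2 * of_real pi * \<i>"
  proof -
    have "p + q = - 2 * r * s" if "p + s * r = - q' * p - s * r" "q = q' * p" for p q q' r s :: complex
    proof -
      have "p + q = (p + s * r) + q' * p - s * r" using that(2) by simp
      also have "\<dots> = - 2 * r * s" unfolding that(1) by simp
      finally show ?thesis .
    qed
    from this[OF _ refl] show "?I + \<i> * of_real pi = - exp (- Z) * ?I - \<i> * of_real pi \<Longrightarrow> ?thesis" .
  qed
  then have "exp Z * ?I + (exp Z * exp (- Z)) * ?I = exp Z * (- 2 * of_real pi * \<i>)"
    by (simp only: distrib_left[symmetric] mult.assoc)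
  then have "?I * (1 + exp Z) = - 2 * of_real pi * \<i> * exp Z"
    unfolding exp_minus_inverse by (simp add: algebra_simps)
  then show ?thesis using one_plus_exp_nonzero[OF Z] by (simp add: field_simps)
qed

section \<open>The Lobachevsky function and the classical dilogarithm\<close>

text \<open>A crude consequence of the concavity of the sine, used to dominate its logarithm by those of \<open>u\<close> and
  \<open>pi - u\<close>.\<close>

lemma sin_ge_parabola:
  assumes "u \<in> {0..pi}" shows "u * (pi - u) / pi\<^sup>2 \<le> sin u"
proof -
  have half: "t * (pi - t) / pi\<^sup>2 \<le> sin t" if t: "t \<in> {0..pi/2}" for t
  proof -
    have "convex_on {0..pi/2} (\<lambda>x. - sin x)"
      by (rule f''_ge0_imp_convex[where f' = "\<lambda>x. - cos x" and f'' = "\<lambda>x. sin x"])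
        (auto intro!: derivative_eq_intros sin_ge_zero)
    from convex_onD_Icc'[OF this t] have A: "2 * t / pi \<le> sin t" by simp
    have "t * (pi - t) \<le> t * (2 * pi)" using t pi_gt_zero by (intro mult_left_mono) auto
    then have "t * (pi - t) / pi\<^sup>2 \<le> t * (2 * pi) / pi\<^sup>2" by (intro divide_right_mono) auto
    also have "\<dots> = 2 * t / pi" by (simp add: power2_eq_square)
    finally show ?thesis using A by linarith
  qed
  show ?thesis
  proof (cases "u \<le> pi/2")
    case True then show ?thesis using half assms by auto
  next
    case False
    then have "pi - u \<in> {0..pi/2}" using assms by (auto simp: field_simps)
    from half[OF this] show ?thesis by (simp add: mult.commute)
  qed
qed

lemma x_ln_x_tendsto_0: "((\<lambda>x::real. x * ln x) \<longlongrightarrow> 0) (at_right 0)"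
  unfolding filterlim_at_right_to_top
proof (rule Lim_transform_eventually)
  show "((\<lambda>x::real. - (ln x / x)) \<longlongrightarrow> 0) at_top"
    using tendsto_minus[OF ln_x_over_x_tendsto_0] by simp
  show "\<forall>\<^sub>F x::real in at_top. - (ln x / x) = inverse x * ln (inverse x)"
    using eventually_gt_at_top[of 0] by eventually_elim (simp add: ln_inverse divide_inverse)
qed

lemma ln_integrable_on: "0 \<le> b \<Longrightarrow> ln integrable_on {0..b::real}"
proof -
  assume b: "0 \<le> b"
  have "continuous_on {0..b} (\<lambda>x. x * ln x - x)"
    unfolding continuous_on_eq_continuous_within
  proof
    fix x assume x: "x \<in> {0..b}"
    show "continuous (at x within {0..b}) (\<lambda>x. x * ln x - x)"
    proof (cases "x = 0")
      case True
      have "((\<lambda>x::real. x * ln x - x) \<longlongrightarrow> 0 - 0) (at_right 0)"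
        by (intro tendsto_diff x_ln_x_tendsto_0 tendsto_ident_at)
      then have "((\<lambda>x::real. x * ln x - x) \<longlongrightarrow> 0) (at 0 within {0..})"
        by (simp add: at_within_Ici_at_right)
      then have "((\<lambda>x::real. x * ln x - x) \<longlongrightarrow> 0) (at 0 within {0..b})"
        by (rule tendsto_within_subset) auto
      then show ?thesis using True by (simp add: continuous_within)
    next
      case False
      then show ?thesis using x by (intro continuous_intros) auto
    qed
  qed
  moreover have "((\<lambda>x. x * ln x - x) has_vector_derivative ln x) (at x)" if "x \<in> {0<..<b}" for x
    using that by (auto intro!: derivative_eq_intros simp flip: has_real_derivative_iff_has_vector_derivative)
  ultimately show ?thesis
    using fundamental_theorem_of_calculus_interior[OF b] has_integral_integrable by blast
qed

lemma ln_sin_integrable: "(\<lambda>u. ln (sin u)) integrable_on {0..pi}"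
proof (rule measurable_bounded_by_integrable_imp_integrable)
  show "(\<lambda>u. ln (sin u)) \<in> borel_measurable (lebesgue_on {0..pi})"
    by (intro measurable_restrict_space1 measurable_completion) simp
  have "(\<lambda>u. ln (pi - u)) integrable_on {0..pi}"
  proof -
    have "(\<lambda>u. ln ((-1) *\<^sub>R u + pi)) integrable_on (\<lambda>x. (1 / (-1)) *\<^sub>R x + - ((1 / (-1)) *\<^sub>R pi)) ` cbox 0 pi"
      using ln_integrable_on[of pi] by (intro integrable_affinity) auto
    moreover have "(\<lambda>x. (1 / (-1)) *\<^sub>R x + - ((1 / (-1)) *\<^sub>R pi)) ` cbox 0 pi = {0..pi}"
      by (auto simp: image_iff intro: bexI[of _ "pi - _"])
    ultimately show ?thesis by (simp add: add.commute)
  qed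
  then show "(\<lambda>u. 2 * ln pi - ln u - ln (pi - u)) integrable_on {0..pi}"
    using ln_integrable_on[of pi] by (intro integrable_diff) auto
  show "norm (ln (sin u)) \<le> 2 * ln pi - ln u - ln (pi - u)" if u: "u \<in> {0..pi}" for u
  proof (cases "u = 0 \<or> u = pi")
    case True
    have "0 \<le> ln pi" using pi_gt3 by (intro ln_ge_zero) auto
    then show ?thesis using True by auto
  next
    case False
    then have u: "0 < u" "u < pi" using u by auto
    then have s: "0 < sin u" "sin u \<le> 1" by (auto intro: sin_gt_zero)
    have "ln (u * (pi - u) / pi\<^sup>2) \<le> ln (sin u)"
      using u sin_ge_parabola[of u] by (subst ln_le_cancel_iff) (auto intro: sin_gt_zero)
    also have "ln (u * (pi - u) / pi\<^sup>2) = ln u + ln (pi - u) - 2 * ln pi"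
      using u by (simp add: ln_div ln_mult ln_realpow)
    finally show ?thesis using s by simp
  qed
qed auto

text \<open>The usual Lobachevsky function has \<open>ln (2 sin u)\<close> in place of \<open>ln (sin u)\<close> and so differs by a multiple of
  \<open>\<theta>\<close>. For angles with sum \<open>pi\<close> this difference is accounted for by the last term of \<open>ideal_volume\<close>.\<close>

definition lobachevsky :: "real \<Rightarrow> real" where
  "lobachevsky \<theta> = - integral {0..\<theta>} (\<lambda>u. ln (sin u))"

lemma lobachevsky_0 [simp]: "lobachevsky 0 = 0"
  by (simp add: lobachevsky_def)

lemma continuous_on_lobachevsky: "continuous_on {0..pi} lobachevsky"
  unfolding lobachevsky_def[abs_def]
  by (intro continuous_on_minus indefinite_integral_continuous_1 ln_sin_integrable)

lemma lobachevsky_has_derivative: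
  assumes "0 < \<theta>" "\<theta> < pi"
  shows "(lobachevsky has_real_derivative - ln (sin \<theta>)) (at \<theta>)"
proof -
  have "((\<lambda>u. integral {0..u} (\<lambda>u. ln (sin u))) has_vector_derivative ln (sin \<theta>)) (at \<theta> within ({0..pi} - {}))"
  proof (rule integral_has_vector_derivative_continuous_at[OF ln_sin_integrable])
    have "isCont (\<lambda>u. ln (sin u)) \<theta>" using sin_gt_zero[OF assms] by (intro continuous_intros) auto
    then show "continuous (at \<theta> within ({0..pi} - {})) (\<lambda>u. ln (sin u))"
      using continuous_at_imp_continuous_at_within by blast
  qed (use assms in auto)
  then have "((\<lambda>u. integral {0..u} (\<lambda>u. ln (sin u))) has_vector_derivative ln (sin \<theta>)) (at \<theta>)"
    using assms at_within_interior[of \<theta> "{0..pi}"] by simp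
  from has_vector_derivative_minus[OF this] show ?thesis
    by (simp add: lobachevsky_def[abs_def] has_real_derivative_iff_has_vector_derivative)
qed

lemma lobachevsky_derivative_intro [derivative_intros]:
  assumes "(f has_real_derivative f') (at x)" "0 < f x" "f x < pi"
  shows "((\<lambda>x. lobachevsky (f x)) has_real_derivative - ln (sin (f x)) * f') (at x)"
  using DERIV_chain2[OF lobachevsky_has_derivative[OF assms(2,3)] assms(1)] .

lemma lobachevsky_reflect:
  assumes "\<theta> \<in> {0..pi}" shows "lobachevsky (pi - \<theta>) = lobachevsky pi - lobachevsky \<theta>"
proof (cases "\<theta> = 0")
  case False
  have "lobachevsky (pi - \<theta>) + lobachevsky \<theta> = lobachevsky (pi - 0) + lobachevsky 0"
  proof (rule DERIV_isconst_end[where f = "\<lambda>t. lobachevsky (pi - t) + lobachevsky t"])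
    show "continuous_on {0..\<theta>} (\<lambda>t. lobachevsky (pi - t) + lobachevsky t)"
      using assms by (intro continuous_on_add continuous_on_compose2[OF continuous_on_lobachevsky] continuous_intros) auto
    show "((\<lambda>t. lobachevsky (pi - t) + lobachevsky t) has_real_derivative 0) (at t)" if "0 < t" "t < \<theta>" for t
      using that assms by (auto intro!: derivative_eq_intros)
  qed (use False assms in auto)
  then show ?thesis by simp
qed simp

text \<open>Milnor's formula for the volume of the ideal tetrahedron with dihedral angles \<open>a, b, c\<close>.\<close>

definition ideal_volume :: "real \<Rightarrow> real \<Rightarrow> real \<Rightarrow> real" where
  "ideal_volume a b c = lobachevsky a + lobachevsky b + lobachevsky c - lobachevsky pi"

text \<open>This is \<open>Li\<^sub>2 (- e\<^sup>Z) / (2 pi i)\<close>. Divided by \<open>b\<^sup>2\<close>, its kernel is the leading term, for small \<open>b\<close>, of the kernel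
  of the quantum dilogarithm. Its elementary second derivative and its decay at minus infinity make it
  explicit.\<close>

definition classical_dilog :: "complex \<Rightarrow> complex" where
  "classical_dilog Z = 1/4 * line_transform (\<lambda>v. 1 / v\<^sup>2 / sinh v) Z"

definition classical_dilog' :: "complex \<Rightarrow> complex" where
  "classical_dilog' Z = - \<i> / (4 * of_real pi) * line_transform (\<lambda>v. 1 / v / sinh v) Z"

lemma cont_inverse_vert: "continuous_on UNIV (\<lambda>u. 1 / vert u ^ n)"
  by (intro continuous_intros) auto

lemma decaying_dilog_kernel: "decaying (2 * 1) (\<lambda>v. 1 / v ^ n / sinh v)"
proof (rule decaying_divide_sinh)
  show "cmod (1 / vert u ^ n) \<le> 1" for u
    using one_le_power[OF cmod_vert_ge[of u], of n] by (simp add: norm_divide norm_power divide_le_eq)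
qed (rule cont_inverse_vert)

lemma classical_dilog_derivs:
  assumes Z: "\<bar>Im Z\<bar> < pi"
  shows "(classical_dilog has_field_derivative classical_dilog' Z) (at Z)"
    and "(classical_dilog' has_field_derivative (\<i> / (2 * of_real pi) * (exp Z / (1 + exp Z)))) (at Z)"
proof -
  have 1: "line_transform (\<lambda>v. v * (1 / v\<^sup>2 / sinh v)) Z = line_transform (\<lambda>v. 1 / v / sinh v) Z"
    by (rule line_transform_cong) (simp add: power2_eq_square)
  have 2: "line_transform (\<lambda>v. v * (1 / v / sinh v)) Z = line_transform (\<lambda>v. 1 / sinh v) Z"
    by (rule line_transform_cong) simp
  show "(classical_dilog has_field_derivative classical_dilog' Z) (at Z)"
    unfolding classical_dilog_def[abs_def]
    by (rule DERIV_cong[OF DERIV_cmult[OF has_field_derivative_line_transform[OF decaying_dilog_kernel Z]]])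
      (subst 1, simp add: classical_dilog'_def)
  show "(classical_dilog' has_field_derivative (\<i> / (2 * of_real pi) * (exp Z / (1 + exp Z)))) (at Z)"
    unfolding classical_dilog'_def[abs_def]
    by (rule DERIV_cong[OF DERIV_cmult[OF
            has_field_derivative_line_transform[OF decaying_dilog_kernel[of 1, unfolded power_one_right] Z]]])
      (subst 2, simp add: line_transform_inverse_sinh[OF Z])
qed

section \<open>Legendre transform of the classical dilogarithm\<close>

text \<open>The imaginary part of \<open>Li\<^sub>2 (e\<^bsup>X + i A\<^esup>)\<close>; its derivative is the argument of \<open>1 / (1 - e\<^bsup>X + i A\<^esup>)\<close>.\<close>

definition dilog_profile :: "real \<Rightarrow> real \<Rightarrow> real" where
  "dilog_profile A X = 2 * pi * Re (classical_dilog (Complex X (A - pi)))"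

definition dilog_profile' :: "real \<Rightarrow> real \<Rightarrow> real" where
  "dilog_profile' A X = 2 * pi * Re (classical_dilog' (Complex X (A - pi)))"

lemma has_real_derivative_Re_horizontal:
  assumes "(g has_field_derivative g') (at (Complex X c))"
  shows "((\<lambda>X. Re (g (Complex X c))) has_real_derivative Re g') (at X)"
proof -
  have "((\<lambda>X. of_real X + Complex 0 c) has_vector_derivative 1) (at X)"
    by (auto intro!: derivative_eq_intros)
  moreover have eq: "(\<lambda>X. of_real X + Complex 0 c) = (\<lambda>X. Complex X c)"
    by (auto simp: complex_eq_iff)
  ultimately have "((\<lambda>X. Complex X c) has_vector_derivative 1) (at X)" by simp
  from field_vector_diff_chain_at[OF this assms]
  have "((\<lambda>X. g (Complex X c)) has_vector_derivative g') (at X)" by (simp add: comp_def)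
  from bounded_linear.has_vector_derivative[OF bounded_linear_Re this]
  show ?thesis by (simp add: has_real_derivative_iff_has_vector_derivative)
qed

lemma dilog_profile_derivs:
  assumes A: "0 < A" "A < pi"
  shows "(dilog_profile A has_real_derivative dilog_profile' A X) (at X)"
    and "(dilog_profile' A has_real_derivative
      exp X * sin A / ((1 - exp X * cos A)\<^sup>2 + (exp X * sin A)\<^sup>2)) (at X)"
proof -
  let ?Z = "Complex X (A - pi)"
  have Z: "\<bar>Im ?Z\<bar> < pi" using A by simp
  note D = classical_dilog_derivs[OF Z]
  show "(dilog_profile A has_real_derivative dilog_profile' A X) (at X)"
    unfolding dilog_profile_def[abs_def] dilog_profile'_def
    by (rule DERIV_cmult[OF has_real_derivative_Re_horizontal[OF D(1)]])
  have w: "exp ?Z = - (of_real (exp X) * cis A)"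
    by (simp add: complex_eq_iff Re_exp Im_exp cos_diff sin_diff)
  have "2 * pi * Re (\<i> / (2 * of_real pi) * (exp ?Z / (1 + exp ?Z))) = - Im (exp ?Z / (1 + exp ?Z))"
  proof -
    have "2 * pi * Re (\<i> / (2 * of_real pi) * q) = - Im q" for q
    proof -
      have "\<i> / (2 * of_real pi) * q = \<i> * q / of_real (2 * pi)" by simp
      then show ?thesis by (simp only: Re_divide_of_real) simp
    qed
    then show ?thesis .
  qed
  also have "\<dots> = exp X * sin A / ((1 - exp X * cos A)\<^sup>2 + (exp X * sin A)\<^sup>2)"
    unfolding w by (simp add: Im_divide diff_divide_distrib add_divide_distrib algebra_simps)
  finally show "(dilog_profile' A has_real_derivative
      exp X * sin A / ((1 - exp X * cos A)\<^sup>2 + (exp X * sin A)\<^sup>2)) (at X)"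
    unfolding dilog_profile'_def[abs_def]
    using DERIV_cmult[OF has_real_derivative_Re_horizontal[OF D(2)], of "2 * pi"] by simp
qed

lemma dilog_profile_tendsto_0:
  assumes A: "0 < A" "A < pi"
  shows "(dilog_profile A \<longlongrightarrow> 0) at_bot" "(dilog_profile' A \<longlongrightarrow> 0) at_bot"
proof -
  have e: "((\<lambda>X. c * exp (X / 2)) \<longlongrightarrow> 0) at_bot" for c :: real
  proof -
    have "filterlim (\<lambda>X::real. 1/2 * X) at_bot at_bot"
      by (rule filterlim_tendsto_pos_mult_at_bot[OF tendsto_const _ filterlim_ident]) simp
    from filterlim_compose[OF exp_at_bot this] have "((\<lambda>X::real. exp (X / 2)) \<longlongrightarrow> 0) at_bot" by simp
    from tendsto_mult_right_zero[OF this] show ?thesis .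
  qed
  have bound: "cmod (line_transform (\<lambda>v. 1 / v ^ n / sinh v) (Complex X (A - pi)))
      \<le> (4 / (1 - \<bar>A - pi\<bar> / pi)) * exp (X / 2)" for n X
    using line_transform_bound[OF decaying_dilog_kernel[of n], of "Complex X (A - pi)"] A by simp
  show "(dilog_profile A \<longlongrightarrow> 0) at_bot"
  proof (rule Lim_null_comparison)
    show "\<forall>\<^sub>F X in at_bot. norm (dilog_profile A X) \<le> (2 * pi * (4 / (1 - \<bar>A - pi\<bar> / pi))) * exp (X / 2)"
    proof (rule always_eventually, rule allI)
      fix X
      have "\<bar>Re (classical_dilog (Complex X (A - pi)))\<bar> \<le> cmod (classical_dilog (Complex X (A - pi)))"
        by (rule abs_Re_le_cmod)
      also have "\<dots> \<le> cmod (line_transform (\<lambda>v. 1 / v\<^sup>2 / sinh v) (Complex X (A - pi)))"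
        by (simp add: classical_dilog_def norm_divide)
      finally show "norm (dilog_profile A X) \<le> (2 * pi * (4 / (1 - \<bar>A - pi\<bar> / pi))) * exp (X / 2)"
        using bound[of 2 X] unfolding dilog_profile_def
        by (simp only: real_norm_def abs_mult mult.assoc) (intro mult_mono order.refl; auto)
    qed
  qed (rule e)
  show "(dilog_profile' A \<longlongrightarrow> 0) at_bot"
  proof (rule Lim_null_comparison)
    show "\<forall>\<^sub>F X in at_bot. norm (dilog_profile' A X) \<le> (2 * pi * (4 / (1 - \<bar>A - pi\<bar> / pi))) * exp (X / 2)"
    proof (rule always_eventually, rule allI)
      fix X
      let ?L = "line_transform (\<lambda>v. 1 / v / sinh v) (Complex X (A - pi))"
      have "\<bar>Re (classical_dilog' (Complex X (A - pi)))\<bar> \<le> cmod (classical_dilog' (Complex X (A - pi)))"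
        by (rule abs_Re_le_cmod)
      also have "\<dots> = cmod ?L / (4 * pi)"
        by (simp add: classical_dilog'_def norm_divide norm_mult)
      also have "\<dots> \<le> cmod ?L / 1"
        using pi_gt3 by (intro divide_left_mono) auto
      finally show "norm (dilog_profile' A X) \<le> (2 * pi * (4 / (1 - \<bar>A - pi\<bar> / pi))) * exp (X / 2)"
        using bound[of 1 X] unfolding dilog_profile'_def
        by (simp only: real_norm_def abs_mult mult.assoc power_one_right) (intro mult_mono order.refl; auto)
    qed
  qed (rule e)
qed

lemma sine_rule_identity:
  fixes A k :: real
  shows "(sin (A + k))\<^sup>2 - 2 * sin k * sin (A + k) * cos A + (sin k)\<^sup>2 = (sin A)\<^sup>2"
proof -
  have 1: "(cos A)\<^sup>2 = 1 - (sin A)\<^sup>2" "(cos k)\<^sup>2 = 1 - (sin k)\<^sup>2" by (simp_all add: cos_squared_eq)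
  have "(sin (A + k))\<^sup>2 - 2 * sin k * sin (A + k) * cos A + (sin k)\<^sup>2
     = (sin A)\<^sup>2 * (cos k)\<^sup>2 - (cos A)\<^sup>2 * (sin k)\<^sup>2 + (sin k)\<^sup>2"
    unfolding sin_add by (simp add: power2_eq_square algebra_simps)
  also have "\<dots> = (sin A)\<^sup>2" unfolding 1 by (simp add: algebra_simps)
  finally show ?thesis .
qed

lemma eq_limit_of_zero_derivative:
  fixes g :: "real \<Rightarrow> real"
  assumes "a < b" "\<And>x. a < x \<Longrightarrow> x < b \<Longrightarrow> (g has_real_derivative 0) (at x)"
    and "(g \<longlongrightarrow> L) (at_right a)" "a < x" "x < b"
  shows "g x = L"
proof -
  obtain c where c: "\<And>x. x \<in> {a<..<b} \<Longrightarrow> g x = c"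
    using has_field_derivative_zero_constant[of "{a<..<b}" g] assms(2) has_field_derivative_at_within
    by (metis convex_real_interval(8) greaterThanLessThan_iff)
  have "((\<lambda>_. c) \<longlongrightarrow> L) (at_right a)"
  proof (rule Lim_transform_eventually[OF assms(3)])
    show "\<forall>\<^sub>F x in at_right a. g x = c"
      using eventually_at_right_real[OF assms(1)] by (rule eventually_mono) (rule c)
  qed
  then have "c = L" using tendsto_const_iff trivial_limit_at_right_real by blast
  then show ?thesis using c assms(4,5) by auto
qed

context
  fixes A :: real
  assumes A: "0 < A" "A < pi"
begin

text \<open>By the law of sines, \<open>sin k / sin (A + k)\<close> is the quotient of the sides opposite to the angles \<open>k\<close> and
  \<open>pi - A - k\<close> in a triangle whose third angle is \<open>A\<close>. Hence, if \<open>e\<^sup>X\<close> has this value, then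
  \<open>\<zeta> = e\<^bsup>X + i A\<^esup>\<close> is the shape for which \<open>1 / (1 - \<zeta>)\<close> has argument \<open>k\<close>. In terms of \<open>k\<close>, with \<open>k\<close> tending
  to 0 as \<open>X\<close> tends to minus infinity, the profile and its derivative become explicit.\<close>

lemma critical_point_tendsto:
  "filterlim (\<lambda>k. ln (sin k / sin (A + k))) at_bot (at_right 0)"
  "((\<lambda>k. k * ln (sin k / sin (A + k))) \<longlongrightarrow> 0) (at_right 0)"
proof -
  have sA: "sin A > 0" using A by (rule sin_gt_zero)
  have ev: "\<forall>\<^sub>F k in at_right 0. k \<in> {0<..<pi - A}" using A by (intro eventually_at_right_real) auto
  have "((\<lambda>k. sin k / sin (A + k)) \<longlongrightarrow> sin 0 / sin (A + 0)) (at_right 0)"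
    using sA by (intro tendsto_intros) auto
  moreover have pos: "\<forall>\<^sub>F k in at_right 0. sin k / sin (A + k) > 0"
    using ev by (rule eventually_mono) (use A in \<open>auto intro!: divide_pos_pos sin_gt_zero\<close>)
  ultimately have "filterlim (\<lambda>k. sin k / sin (A + k)) (at_right 0) (at_right 0)"
    by (auto simp: filterlim_at elim: eventually_mono)
  from filterlim_compose[OF ln_at_0 this]
  show "filterlim (\<lambda>k. ln (sin k / sin (A + k))) at_bot (at_right 0)" .
  have s0: "filterlim sin (at_right 0) (at_right (0::real))"
  proof -
    have "(sin \<longlongrightarrow> sin 0) (at_right (0::real))" by (intro tendsto_intros)
    moreover have "\<forall>\<^sub>F k in at_right 0. sin k > (0::real)"
      using ev by (rule eventually_mono) (use A in \<open>auto intro!: sin_gt_zero\<close>)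
    ultimately show ?thesis by (auto simp: filterlim_at elim: eventually_mono)
  qed
  have 1: "((\<lambda>k. sin k * ln (sin k)) \<longlongrightarrow> 0) (at_right (0::real))"
    using filterlim_compose[OF x_ln_x_tendsto_0 s0] .
  have "(sin has_real_derivative 1) (at 0)" by (auto intro!: derivative_eq_intros)
  then have "((\<lambda>k. sin k / k) \<longlongrightarrow> (1::real)) (at 0)" by (simp add: has_field_derivative_iff)
  then have 2: "((\<lambda>k. sin k / k) \<longlongrightarrow> (1::real)) (at_right 0)" by (rule filterlim_mono) (auto simp: at_le)
  have "((\<lambda>k. (sin k * ln (sin k)) / (sin k / k) - k * ln (sin (A + k))) \<longlongrightarrow> 0 / 1 - 0 * ln (sin (A + 0))) (at_right 0)"
    using sA by (intro tendsto_intros 1 2) auto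
  then have "((\<lambda>k. (sin k * ln (sin k)) / (sin k / k) - k * ln (sin (A + k))) \<longlongrightarrow> 0) (at_right 0)" by simp
  then show "((\<lambda>k. k * ln (sin k / sin (A + k))) \<longlongrightarrow> 0) (at_right 0)"
  proof (rule Lim_transform_eventually)
    show "\<forall>\<^sub>F k in at_right 0. (sin k * ln (sin k)) / (sin k / k) - k * ln (sin (A + k)) = k * ln (sin k / sin (A + k))"
      using ev
    proof (rule eventually_mono)
      fix k assume k: "k \<in> {0<..<pi - A}"
      then have "sin k > 0" "sin (A + k) > 0" using A by (auto intro!: sin_gt_zero)
      then show "(sin k * ln (sin k)) / (sin k / k) - k * ln (sin (A + k)) = k * ln (sin k / sin (A + k))"
        using k by (simp add: ln_div field_simps)
    qed
  qed
qed

lemma critical_point_derivative: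
  assumes k: "0 < k" "k < pi - A"
  shows "((\<lambda>k. ln (sin k / sin (A + k))) has_real_derivative sin A / (sin k * sin (A + k))) (at k)"
proof -
  have s: "sin k > 0" "sin (A + k) > 0" using A k by (auto intro!: sin_gt_zero)
  have "((\<lambda>k. ln (sin k / sin (A + k))) has_real_derivative
      (cos k * sin (A + k) - sin k * cos (A + k)) / (sin (A + k) * sin (A + k)) / (sin k / sin (A + k))) (at k)"
    using s by (auto intro!: derivative_eq_intros)
  moreover have "cos k * sin (A + k) - sin k * cos (A + k) = sin A"
    using sin_diff[of "A + k" k] by (simp add: algebra_simps)
  ultimately show ?thesis using s by (simp add: field_simps)
qed

text \<open>As functions of \<open>k\<close>, both sides have derivative 1 and tend to 0 at 0.\<close>

lemma dilog_profile'_critical_point: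
  assumes k: "0 < k" "k < pi - A"
  shows "dilog_profile' A (ln (sin k / sin (A + k))) = k"
proof -
  define x where "x = (\<lambda>k. ln (sin k / sin (A + k)))"
  have "dilog_profile' A (x k) - k = 0"
  proof (rule eq_limit_of_zero_derivative[where g = "\<lambda>k. dilog_profile' A (x k) - k" and b = "pi - A"])
    have "((\<lambda>k. dilog_profile' A (x k) - k) \<longlongrightarrow> 0 - 0) (at_right 0)"
      unfolding x_def
      by (intro tendsto_diff filterlim_compose[OF dilog_profile_tendsto_0(2)[OF A]] critical_point_tendsto(1) tendsto_ident_at)
    then show "((\<lambda>k. dilog_profile' A (x k) - k) \<longlongrightarrow> 0) (at_right 0)" by simp
    fix k assume k: "0 < k" "k < pi - A"
    have s: "sin k > 0" "sin (A + k) > 0" "sin A > 0" using A k by (auto intro!: sin_gt_zero)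
    define r where "r = sin k / sin (A + k)"
    have r: "exp (x k) = r" "r > 0" using s by (auto simp: x_def r_def)
    have "(1 - r * p)\<^sup>2 + (r * q)\<^sup>2 = 1 - 2 * r * p + r\<^sup>2 * (q\<^sup>2 + p\<^sup>2)" for p q :: real
      by (simp add: power2_eq_square algebra_simps)
    from this[of "cos A" "sin A"]
    \<comment> \<open>The law of cosines, in the triangle with sides 1 and \<open>r\<close> enclosing the angle \<open>A\<close>.\<close>
    have "(1 - r * cos A)\<^sup>2 + (r * sin A)\<^sup>2 = 1 - 2 * r * cos A + r\<^sup>2 * ((sin A)\<^sup>2 + (cos A)\<^sup>2)" .
    also have "\<dots> = ((sin (A + k))\<^sup>2 - 2 * sin k * sin (A + k) * cos A + (sin k)\<^sup>2) / (sin (A + k))\<^sup>2"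
      using s by (simp add: r_def power2_eq_square field_simps)
    also have "\<dots> = (sin A)\<^sup>2 / (sin (A + k))\<^sup>2" by (simp only: sine_rule_identity)
    finally have d: "(1 - r * cos A)\<^sup>2 + (r * sin A)\<^sup>2 = (sin A)\<^sup>2 / (sin (A + k))\<^sup>2" .
    have "((\<lambda>k. dilog_profile' A (x k)) has_real_derivative
        (r * sin A / ((sin A)\<^sup>2 / (sin (A + k))\<^sup>2)) * (sin A / (sin k * sin (A + k)))) (at k)"
      using DERIV_chain2[where g = x, OF dilog_profile_derivs(2)[OF A] critical_point_derivative[OF k, folded x_def]]
      unfolding r d .
    moreover have "(r * sin A / ((sin A)\<^sup>2 / (sin (A + k))\<^sup>2)) * (sin A / (sin k * sin (A + k))) = 1"
      using s by (simp add: r_def power2_eq_square)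
    ultimately show "((\<lambda>k. dilog_profile' A (x k) - k) has_real_derivative 0) (at k)"
      by (auto intro!: derivative_eq_intros)
  qed (use A k in auto)
  then show ?thesis by (simp add: x_def)
qed

text \<open>Both sides have the same derivative in \<open>k\<close>, by the previous lemma, and tend to 0 at 0. This identifies the
  Legendre transform of the profile with the volume.\<close>

lemma dilog_profile_critical_point:
  assumes k: "0 < k" "k < pi - A"
  shows "dilog_profile A (ln (sin k / sin (A + k)))
    = k * ln (sin k / sin (A + k)) + ideal_volume A k (pi - A - k)"
proof -
  define x where "x = (\<lambda>k. ln (sin k / sin (A + k)))"
  let ?g = "\<lambda>k. dilog_profile A (x k) - k * x k - (lobachevsky k - lobachevsky (A + k))"
  have "?g k = 0 - 0 - (lobachevsky 0 - lobachevsky (A + 0))"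
  proof (rule eq_limit_of_zero_derivative[where g = ?g and b = "pi - A"])
    have c: "continuous_on {0..pi - A} (\<lambda>k. lobachevsky k - lobachevsky (A + k))"
      using A by (intro continuous_on_diff continuous_on_compose2[OF continuous_on_lobachevsky] continuous_intros) auto
    have "((\<lambda>k. lobachevsky k - lobachevsky (A + k)) \<longlongrightarrow> lobachevsky 0 - lobachevsky (A + 0)) (at 0 within {0..pi-A})"
      using A by (intro c[unfolded continuous_on, rule_format]) auto
    then have "((\<lambda>k. lobachevsky k - lobachevsky (A + k)) \<longlongrightarrow> lobachevsky 0 - lobachevsky (A + 0)) (at_right 0)"
      using A by (simp add: at_within_Icc_at_right)
    then show "(?g \<longlongrightarrow> 0 - 0 - (lobachevsky 0 - lobachevsky (A + 0))) (at_right 0)"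
      unfolding x_def
      by (intro tendsto_diff[OF tendsto_diff] filterlim_compose[OF dilog_profile_tendsto_0(1)[OF A]] critical_point_tendsto; assumption?)
    fix k assume k: "0 < k" "k < pi - A"
    have s: "sin k > 0" "sin (A + k) > 0" using A k by (auto intro!: sin_gt_zero)
    let ?x' = "sin A / (sin k * sin (A + k))"
    have x': "(x has_real_derivative ?x') (at k)"
      unfolding x_def by (rule critical_point_derivative[OF k])
    have "((\<lambda>k. dilog_profile A (x k)) has_real_derivative k * ?x') (at k)"
      using DERIV_chain2[where g = x, OF dilog_profile_derivs(1)[OF A] x']
      using dilog_profile'_critical_point[OF k] by (simp add: x_def)
    then have "(?g has_real_derivative k * ?x' - (1 * x k + ?x' * k) - (- ln (sin k) - - ln (sin (A + k)))) (at k)"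
      using k A
      by (intro DERIV_diff DERIV_mult DERIV_ident x' lobachevsky_has_derivative)
        (auto intro!: derivative_eq_intros)
    moreover have "k * ?x' - (1 * x k + ?x' * k) - (- ln (sin k) - - ln (sin (A + k))) = 0"
      using s by (simp add: x_def ln_div)
    ultimately show "(?g has_real_derivative 0) (at k)" by simp
  qed (use A k in auto)
  moreover have "lobachevsky (A + k) = lobachevsky pi - lobachevsky (pi - A - k)"
    using lobachevsky_reflect[of "A + k"] A k by (simp add: algebra_simps)
  ultimately show ?thesis by (simp add: x_def ideal_volume_def)
qed

text \<open>The left-hand side is the tangent of slope \<open>k\<close> to a convex function.\<close>

lemma dilog_profile_ge:
  assumes k: "0 < k" "k < pi - A"
  shows "k * X + ideal_volume A k (pi - A - k) \<le> dilog_profile A X"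
proof -
  let ?x = "ln (sin k / sin (A + k))"
  have "convex_on UNIV (dilog_profile A)"
  proof (rule f''_ge0_imp_convex)
    show "0 \<le> exp X * sin A / ((1 - exp X * cos A)\<^sup>2 + (exp X * sin A)\<^sup>2)" for X
      using sin_gt_zero[OF A] by (intro divide_nonneg_nonneg) auto
  qed (use dilog_profile_derivs[OF A] in auto)
  then have "dilog_profile' A ?x * (X - ?x) \<le> dilog_profile A X - dilog_profile A ?x"
    by (rule convex_on_imp_above_tangent) (use dilog_profile_derivs[OF A] in auto)
  then show ?thesis
    unfolding dilog_profile'_critical_point[OF k] dilog_profile_critical_point[OF k]
    by (simp add: algebra_simps)
qed

end

section \<open>Volume of an ideal tetrahedron\<close>

lemma cot_add_cot: "sin x \<noteq> 0 \<Longrightarrow> sin y \<noteq> 0 \<Longrightarrow> cos x / sin x + cos y / sin y = sin (x + y) / (sin x * sin y)" for x y :: real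
  by (simp add: sin_add field_simps)

lemma cot_diff_cot: "sin x \<noteq> 0 \<Longrightarrow> sin y \<noteq> 0 \<Longrightarrow> cos x / sin x - cos y / sin y = sin (y - x) / (sin x * sin y)" for x y :: real
  by (simp add: sin_diff field_simps)

lemma measurable_Complex_pair [measurable]: "(\<lambda>(x, y). Complex x y) \<in> borel_measurable (lborel \<Otimes>\<^sub>M lborel)"
  unfolding Complex_eq by measurable

lemma lborel_complex: "(lborel :: complex measure) = distr (lborel \<Otimes>\<^sub>M lborel) borel (\<lambda>(x, y). Complex x y)"
proof (rule lborel_eqI)
  fix l u :: complex assume le: "\<And>b. b \<in> Basis \<Longrightarrow> l \<bullet> b \<le> u \<bullet> b"
  have lu: "Re l \<le> Re u" "Im l \<le> Im u" using le[of 1] le[of \<i>] by (auto simp: Basis_complex_def)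
  have "(\<lambda>(x, y). Complex x y) -` box l u \<inter> space (lborel \<Otimes>\<^sub>M lborel) = {Re l<..<Re u} \<times> {Im l<..<Im u}"
    by (auto simp: box_def Basis_complex_def space_pair_measure)
  then have "emeasure (distr (lborel \<Otimes>\<^sub>M lborel) borel (\<lambda>(x, y). Complex x y)) (box l u)
     = emeasure (lborel \<Otimes>\<^sub>M lborel) ({Re l<..<Re u} \<times> {Im l<..<Im u})"
    by (subst emeasure_distr) auto
  also have "\<dots> = ennreal (Re u - Re l) * ennreal (Im u - Im l)"
    using lu by (subst lborel.emeasure_pair_measure_Times) auto
  also have "\<dots> = ennreal (\<Prod>b\<in>Basis. (u - l) \<bullet> b)"
    using lu by (simp add: Basis_complex_def ennreal_mult'')
  finally show "emeasure (distr (lborel \<Otimes>\<^sub>M lborel) borel (\<lambda>(x, y). Complex x y)) (box l u)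
     = ennreal (\<Prod>b\<in>Basis. (u - l) \<bullet> b)" .
qed simp

context
  fixes a b c :: real
  assumes abc: "0 < a" "0 < b" "0 < c" "a + b + c = pi"
begin

private definition "ca = cos a / sin a"
private definition "cb = cos b / sin b"
private definition "cc = cos c / sin c"

private lemma sin_pos: "0 < sin a" "0 < sin b" "0 < sin c"
  using abc by (auto intro!: sin_gt_zero)

private lemma cot_sums:
  "cb + cc = sin a / (sin b * sin c)" "ca + cc = sin b / (sin a * sin c)" "ca + cb = sin c / (sin a * sin b)"
proof -
  have e: "b + c = pi - a" "a + c = pi - b" "a + b = pi - c" using abc by auto
  show "cb + cc = sin a / (sin b * sin c)" "ca + cc = sin b / (sin a * sin c)" "ca + cb = sin c / (sin a * sin b)"
    unfolding ca_def cb_def cc_def using sin_pos by (simp_all add: cot_add_cot e)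
qed

private lemma cot_pos: "0 < cb + cc" "0 < ca + cc" "0 < ca + cb"
  using sin_pos by (auto simp: cot_sums intro!: divide_pos_pos)

private lemma cot_relation: "ca * cb + ca * cc + cb * cc = 1"
proof -
  have e: "a = pi - (b + c)" using abc by simp
  have "cos a = - cos (b + c)" unfolding e by (rule cos_pi_minus)
  then have ca: "cos a = sin b * sin c - cos b * cos c" by (simp add: cos_add)
  have sa: "sin a = sin b * cos c + cos b * sin c"
    unfolding e sin_pi_minus by (rule sin_add)
  have "ca * (cb + cc) + cb * cc = 1"
    unfolding cot_sums using sin_pos by (simp add: ca_def cb_def cc_def ca field_simps)
  then show ?thesis by (simp add: algebra_simps)
qed

text \<open>The density in \<open>m\<close> of the volume over the rays \<open>x = m y\<close> of the base triangle. With \<open>m = cot p\<close> the argument of the logarithm is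
  \<open>sin (p + b) sin (p + c) / (sin p sin (a - p))\<close>.\<close>

private definition "dens m = 1 / (2 * (1 + m\<^sup>2)) * ln ((m + cc) * (m + cb) / ((cb + cc) * (m - ca)))"

text \<open>An antiderivative in \<open>p\<close> is a combination of Lobachevsky functions. It is continuous up to both ends of
  the range of \<open>p\<close>, from 0 to \<open>a\<close>, although the density has logarithmic singularities there.\<close>

private lemma dens_integral:
  "(\<integral>\<^sup>+m. ennreal (dens m) * indicator {ca<..} m \<partial>lborel) = ennreal (ideal_volume a b c)"
  "0 \<le> ideal_volume a b c"
proof -
  define T where "T = (\<lambda>p. (- lobachevsky (p + c) - lobachevsky (p + b) + lobachevsky p - lobachevsky (a - p)) / 2)"
  define F where "F = (\<lambda>m. - T (pi/2 - arctan m))"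
  have Tc: "continuous_on {0..a} T"
    unfolding T_def using abc
    by (intro continuous_intros continuous_on_compose2[OF continuous_on_lobachevsky]) auto
  have ca_arctan: "arctan ca = pi/2 - a"
  proof -
    have "ca = tan (pi/2 - a)" by (simp add: ca_def tan_def sin_diff cos_diff)
    then show ?thesis using abc by (simp add: arctan_tan)
  qed
  have range: "0 < pi/2 - arctan m" "pi/2 - arctan m < a" if "ca < m" for m
    using arctan_ubound[of m] arctan_monotone[OF that] ca_arctan by auto
  have deriv: "(F has_real_derivative dens m) (at m)" if m: "ca < m" for m
  proof -
    define p where "p = pi/2 - arctan m"
    note p = range[OF m, folded p_def]
    have mp: "m = cos p / sin p"
    proof -
      have "m = tan (pi/2 - p)" by (simp add: p_def tan_arctan)
      then show ?thesis by (simp add: tan_def sin_diff cos_diff)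
    qed
    have s: "sin p > 0" "sin (p + c) > 0" "sin (p + b) > 0" "sin (a - p) > 0"
      using p abc by (auto intro!: sin_gt_zero)
    let ?D = "- ((- (- ln (sin (p + c)) * (- inverse (1 + m\<^sup>2))) - (- ln (sin (p + b)) * (- inverse (1 + m\<^sup>2)))
        + (- ln (sin p) * (- inverse (1 + m\<^sup>2))) - (- ln (sin (a - p)) * inverse (1 + m\<^sup>2))) / 2)"
    have "(F has_real_derivative ?D) (at m)"
      unfolding F_def T_def p_def using p[unfolded p_def] abc
      by (auto intro!: derivative_eq_intros)
    moreover have "?D = 1 / (2 * (1 + m\<^sup>2)) * (ln (sin (p + c)) + ln (sin (p + b)) - ln (sin p) - ln (sin (a - p)))"
    proof -
      have "- ((- (- x * (- i)) - (- y * (- i)) + (- z * (- i)) - (- w * i)) / 2) = i / 2 * (x + y - z - w)"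
        for x y z w i :: real by (simp add: field_simps)
      moreover have "inverse (1 + m\<^sup>2) / 2 = 1 / (2 * (1 + m\<^sup>2))" by (simp add: inverse_eq_divide)
      ultimately show ?thesis by (simp only:)
    qed
    moreover have "ln (sin (p + c)) + ln (sin (p + b)) - ln (sin p) - ln (sin (a - p))
      = ln ((m + cc) * (m + cb) / ((cb + cc) * (m - ca)))"
    proof -
      have "(m + cc) * (m + cb) / ((cb + cc) * (m - ca)) = sin (p + c) * sin (p + b) / (sin p * sin (a - p))"
      proof -
        have "m + cc = sin (p + c) / (sin p * sin c)" "m + cb = sin (p + b) / (sin p * sin b)"
          "m - ca = sin (a - p) / (sin p * sin a)"
          unfolding mp cc_def cb_def ca_def using s sin_pos by (simp_all add: cot_add_cot cot_diff_cot)
        then show ?thesis using s sin_pos by (simp add: cot_sums)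
      qed
      then show ?thesis using s by (simp add: ln_mult ln_div)
    qed
    ultimately show ?thesis by (simp only: dens_def)
  qed
  have nonneg: "0 \<le> dens m" if m: "ca < m" for m
  proof -
    have pos: "0 < (cb + cc) * (m - ca)" using m cot_pos by simp
    have "(m + cc) * (m + cb) - (cb + cc) * (m - ca) = m\<^sup>2 + (ca * cb + ca * cc + cb * cc)"
      by (simp add: algebra_simps power2_eq_square)
    then have "(cb + cc) * (m - ca) \<le> (m + cc) * (m + cb)" 
      unfolding cot_relation using zero_le_power2[of m] by linarith
    then have "1 \<le> (m + cc) * (m + cb) / ((cb + cc) * (m - ca))" using pos by simp
    then show ?thesis unfolding dens_def by (intro mult_nonneg_nonneg ln_ge_zero) auto
  qed
  have cont: "isCont dens m" if m: "ca < m" for m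
  proof -
    have "0 < m + cc" "0 < m + cb" "0 < (cb + cc) * (m - ca)" using m cot_pos by auto
    moreover have "2 * (1 + m\<^sup>2) \<noteq> 0" using add_pos_nonneg[of 1 "m\<^sup>2"] by simp
    ultimately show ?thesis unfolding dens_def by (intro continuous_intros) auto
  qed
  have limA: "(F \<longlongrightarrow> - T a) (at_right ca)"
  proof -
    have "filterlim (\<lambda>m. pi/2 - arctan m) (at a within {0..a}) (at_right ca)"
    proof (subst filterlim_at, intro conjI)
      have "((\<lambda>m. pi/2 - arctan m) \<longlongrightarrow> pi/2 - arctan ca) (at_right ca)"
        by (intro tendsto_intros)
      then show "((\<lambda>m. pi/2 - arctan m) \<longlongrightarrow> a) (at_right ca)" using ca_arctan by simp
      show "\<forall>\<^sub>F m in at_right ca. pi / 2 - arctan m \<in> {0..a} \<and> pi / 2 - arctan m \<noteq> a"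
        using eventually_at_right_less[of ca]
      proof (rule eventually_mono)
        fix m assume "ca < m"
        from range[OF this] show "pi / 2 - arctan m \<in> {0..a} \<and> pi / 2 - arctan m \<noteq> a" by auto
      qed
    qed
    moreover have "(T \<longlongrightarrow> T a) (at a within {0..a})"
      using abc by (intro Tc[unfolded continuous_on, rule_format]) auto
    ultimately show ?thesis unfolding F_def by (intro tendsto_minus) (rule filterlim_compose)
  qed
  have limB: "(F \<longlongrightarrow> - T 0) at_top"
  proof -
    have "filterlim (\<lambda>m. pi/2 - arctan m) (at 0 within {0..a}) at_top"
    proof (subst filterlim_at, intro conjI)
      have "((\<lambda>m. pi/2 - arctan m) \<longlongrightarrow> pi/2 - pi/2) at_top"
        by (intro tendsto_diff tendsto_const tendsto_arctan_at_top)
      then show "((\<lambda>m. pi/2 - arctan m) \<longlongrightarrow> 0) at_top" by simp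
      show "\<forall>\<^sub>F m in at_top. pi / 2 - arctan m \<in> {0..a} \<and> pi / 2 - arctan m \<noteq> 0"
        using eventually_gt_at_top[of ca]
      proof (rule eventually_mono)
        fix m assume "ca < m"
        from range[OF this] show "pi / 2 - arctan m \<in> {0..a} \<and> pi / 2 - arctan m \<noteq> 0" by auto
      qed
    qed
    moreover have "(T \<longlongrightarrow> T 0) (at 0 within {0..a})"
      using abc by (intro Tc[unfolded continuous_on, rule_format]) auto
    ultimately show ?thesis unfolding F_def by (intro tendsto_minus) (rule filterlim_compose)
  qed
  have I: "set_integrable lborel (einterval (ereal ca) \<infinity>) dens"
      "(LBINT m=ereal ca..\<infinity>. dens m) = - T 0 - (- T a)"
    by (rule interval_integral_FTC_nonneg[where F = F];
        use limA limB in \<open>auto intro!: deriv cont nonneg simp: ereal_tendsto_simps\<close>)+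
  have e: "einterval (ereal ca) \<infinity> = {ca<..}" by (auto simp: einterval_def)
  have val: "- T 0 - (- T a) = ideal_volume a b c"
  proof -
    have "lobachevsky (a + c) = lobachevsky pi - lobachevsky b" "lobachevsky (a + b) = lobachevsky pi - lobachevsky c"
    proof -
      have e: "a + c = pi - b" "a + b = pi - c" using abc by simp_all
      show "lobachevsky (a + c) = lobachevsky pi - lobachevsky b" "lobachevsky (a + b) = lobachevsky pi - lobachevsky c"
        unfolding e using abc by (intro lobachevsky_reflect; simp)+
    qed
    then show ?thesis by (simp add: T_def ideal_volume_def field_simps)
  qed
  have int: "integrable lborel (\<lambda>m. dens m * indicator {ca<..} m)"
    using I(1) unfolding e set_integrable_def by (simp add: mult.commute)
  have lint: "(\<integral>m. dens m * indicator {ca<..} m \<partial>lborel) = ideal_volume a b c"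
    using I(2) unfolding val by (simp add: interval_lebesgue_integral_def e set_lebesgue_integral_def mult.commute)
  have nn: "0 \<le> dens m * indicator {ca<..} m" for m using nonneg by (auto split: split_indicator)
  show "0 \<le> ideal_volume a b c" unfolding lint[symmetric] using nn by (intro Bochner_Integration.integral_nonneg) auto
  have "(\<integral>\<^sup>+m. ennreal (dens m * indicator {ca<..} m) \<partial>lborel) = ennreal (ideal_volume a b c)"
    using nn_integral_eq_integral[OF int] nn lint by simp
  moreover have "ennreal (dens m * indicator {ca<..} m) = ennreal (dens m) * indicator {ca<..} m" for m
    by (auto split: split_indicator)
  ultimately show "(\<integral>\<^sup>+m. ennreal (dens m) * indicator {ca<..} m \<partial>lborel) = ennreal (ideal_volume a b c)"
    by simp
qed

lemma ideal_volume_nonneg: "0 \<le> ideal_volume a b c" by (rule dens_integral(2))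

text \<open>The squared height at which the vertical line over \<open>(x, y)\<close> meets the hemisphere through 0, 1 and the
  third vertex, that is, minus the power of \<open>(x, y)\<close> with respect to the circle through these points. That
  circle has centre \<open>(1/2, cc/2)\<close>.\<close>

private definition "circ x y = x - x\<^sup>2 - y\<^sup>2 + y * cc"

text \<open>The ideal tetrahedron with vertices 0, 1, \<open>apex\<close> and infinity, with its sides given by their slopes.\<close>

private definition "region x y t \<longleftrightarrow> 0 < t \<and> 0 \<le> y \<and> y * ca \<le> x \<and> x + y * cb \<le> 1 \<and> circ x y \<le> t\<^sup>2"

text \<open>The hyperbolic volume density, restricted to \<open>region\<close>.\<close>

private definition "hdens x y t = (if region x y t then ennreal (1 / t ^ 3) else 0)"

private lemma hdens_measurable [measurable]:
  fixes f g h :: "'x \<Rightarrow> real"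
  assumes [measurable]: "f \<in> borel_measurable M" "g \<in> borel_measurable M" "h \<in> borel_measurable M"
  shows "(\<lambda>q. hdens (f q) (g q) (h q)) \<in> borel_measurable M"
  unfolding hdens_def region_def circ_def by measurable

private lemma inner_integral:
  assumes "0 < P" shows "(\<integral>\<^sup>+t. ennreal (1 / t ^ 3) * indicator {t. 0 < t \<and> P \<le> t\<^sup>2} t \<partial>lborel) = ennreal (1 / (2 * P))"
proof -
  have eq: "{t::real. 0 < t \<and> P \<le> t\<^sup>2} = {sqrt P..}"
  proof -
    have "0 < t \<and> P \<le> t\<^sup>2 \<longleftrightarrow> sqrt P \<le> t" for t :: real
    proof
      assume "0 < t \<and> P \<le> t\<^sup>2"
      then show "sqrt P \<le> t" by (intro real_le_lsqrt) auto
    next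
      assume t: "sqrt P \<le> t"
      have "0 < sqrt P" using assms by simp
      moreover have "(sqrt P)\<^sup>2 \<le> t\<^sup>2" using t assms by (intro power_mono) auto
      moreover have "0 < t" using \<open>0 < sqrt P\<close> t by linarith
      ultimately show "0 < t \<and> P \<le> t\<^sup>2" using assms by simp
    qed
    then show ?thesis by auto
  qed
  have s: "0 < sqrt P" using assms by simp
  have "(\<integral>\<^sup>+t. ennreal (1 / t ^ 3) * indicator {sqrt P..} t \<partial>lborel) = ennreal (0 - (- 1 / (2 * (sqrt P)\<^sup>2)))"
  proof (rule nn_integral_FTC_atLeast)
    show "((\<lambda>t. - 1 / (2 * t\<^sup>2)) has_real_derivative 1 / t ^ 3) (at t)" if "sqrt P \<le> t" for t
    proof -
      have "t \<noteq> 0" using that s by auto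
      then show ?thesis by (auto intro!: derivative_eq_intros simp: field_simps power2_eq_square power3_eq_cube)
    qed
    have "((\<lambda>t::real. inverse t * inverse t * (- 1 / 2)) \<longlongrightarrow> 0 * 0 * (- 1 / 2)) at_top"
      by (intro tendsto_mult tendsto_const tendsto_inverse_0_at_top filterlim_ident)
    moreover have "(\<lambda>t::real. inverse t * inverse t * (- 1 / 2)) = (\<lambda>t. - 1 / (2 * t\<^sup>2))"
      by (rule ext) (simp add: field_simps power2_eq_square)
    ultimately show "((\<lambda>t::real. - 1 / (2 * t\<^sup>2)) \<longlongrightarrow> 0) at_top" by simp
    show "0 \<le> 1 / t ^ 3" if "sqrt P \<le> t" for t
      using less_le_trans[OF s that] by simp
  qed simp
  then show ?thesis unfolding eq using assms by simp
qed

text \<open>The circle passes through 0, so along the ray \<open>x = y m\<close> the function \<open>circ\<close> is \<open>y\<close> times an affine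
  function of \<open>y\<close>. The factor \<open>y\<close> of the change of variables cancels, and the integral is a logarithm.\<close>

private lemma slope_integral:
  assumes m: "ca < m"
  shows "(\<integral>\<^sup>+y. ennreal \<bar>y\<bar> * (\<integral>\<^sup>+t. hdens (y * m) y t \<partial>lborel) \<partial>lborel) = ennreal (dens m)"
proof -
  define Y where "Y = 1 / (m + cb)"
  define Q where "Q = 1 + m\<^sup>2"
  have mb: "0 < m + cb" and mc: "0 < m + cc" using m cot_pos by auto
  have Q: "Q > 0" unfolding Q_def using zero_le_power2[of m] by linarith
  have Y: "0 < Y" using mb by (simp add: Y_def)
  have num: "(m + cc) * (m + cb) - Q = (cb + cc) * (m - ca)"
    using cot_relation by (simp add: Q_def algebra_simps power2_eq_square)
  have pos: "0 < m + cc - y * Q" if "y \<le> Y" for y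
  proof -
    have "y * Q \<le> Y * Q" using that Q by (intro mult_right_mono) auto
    moreover have "0 < m + cc - Y * Q"
    proof -
      have "m + cc - Y * Q = ((cb + cc) * (m - ca)) / (m + cb)"
        unfolding num[symmetric] Y_def using mb by (simp add: field_simps)
      then show ?thesis using mb m cot_pos by simp
    qed
    ultimately show ?thesis by linarith
  qed
  have pw: "circ (y * m) y = y * (m + cc - y * Q)" for y
    by (simp add: circ_def Q_def power2_eq_square algebra_simps)
  have inner: "ennreal \<bar>y\<bar> * (\<integral>\<^sup>+t. hdens (y * m) y t \<partial>lborel)
    = ennreal (1 / (2 * (m + cc - y * Q))) * indicator {0..Y} y" if "y \<noteq> 0" for y
  proof (cases "y \<in> {0..Y}")
    case True
    then have y: "0 < y" "y \<le> Y" using that by auto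
    have P: "0 < circ (y * m) y" unfolding pw using y pos by (intro mult_pos_pos) auto
    have "region (y * m) y t \<longleftrightarrow> 0 < t \<and> circ (y * m) y \<le> t\<^sup>2" for t
    proof -
      have "y * ca \<le> y * m" using y m by (intro mult_left_mono) auto
      moreover have "y * m + y * cb \<le> 1" using y(2) mb by (simp add: Y_def field_simps)
      ultimately show ?thesis using y by (auto simp: region_def)
    qed
    then have "(\<integral>\<^sup>+t. hdens (y * m) y t \<partial>lborel)
        = (\<integral>\<^sup>+t. ennreal (1 / t ^ 3) * indicator {t. 0 < t \<and> circ (y * m) y \<le> t\<^sup>2} t \<partial>lborel)"
      by (intro nn_integral_cong) (auto simp: hdens_def)
    also have "\<dots> = ennreal (1 / (2 * circ (y * m) y))" by (rule inner_integral[OF P])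
    finally have "ennreal \<bar>y\<bar> * (\<integral>\<^sup>+t. hdens (y * m) y t \<partial>lborel) = ennreal (\<bar>y\<bar> * (1 / (2 * circ (y * m) y)))"
      using y P by (simp only: ennreal_mult'[symmetric] abs_ge_zero)
    also have "\<bar>y\<bar> * (1 / (2 * circ (y * m) y)) = 1 / (2 * (m + cc - y * Q))"
      unfolding pw using y by simp
    finally show ?thesis using True by simp
  next
    case False
    have "\<not> region (y * m) y t" for t
    proof
      assume "region (y * m) y t"
      then have "0 \<le> y" "y * m + y * cb \<le> 1" by (auto simp: region_def)
      then show False using False mb by (auto simp: Y_def field_simps)
    qed
    then show ?thesis using False by (simp add: hdens_def)
  qed
  have "(\<integral>\<^sup>+y. ennreal \<bar>y\<bar> * (\<integral>\<^sup>+t. hdens (y * m) y t \<partial>lborel) \<partial>lborel)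
     = (\<integral>\<^sup>+y. ennreal (1 / (2 * (m + cc - y * Q))) * indicator {0..Y} y \<partial>lborel)"
    by (rule nn_integral_cong_AE, rule AE_mp[OF AE_lborel_singleton[of 0]], rule AE_I2) (use inner in auto)
  also have "\<dots> = ennreal (- ln (m + cc - Y * Q) / (2 * Q) - (- ln (m + cc - 0 * Q) / (2 * Q)))"
  proof (rule nn_integral_FTC_Icc)
    show "((\<lambda>y. - ln (m + cc - y * Q) / (2 * Q)) has_real_derivative 1 / (2 * (m + cc - y * Q))) (at y)"
      if "y \<in> {0..Y}" for y
    proof -
      have yY: "y \<le> Y" using that by simp
      have "((\<lambda>y. m + cc - y * Q) has_real_derivative 0 - 1 * Q) (at y)"
        by (auto intro!: derivative_eq_intros)
      from DERIV_cdivide[OF DERIV_minus[OF DERIV_chain2[OF DERIV_ln[OF pos[OF yY]] this]], of "2 * Q"]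
      have "((\<lambda>y. - ln (m + cc - y * Q) / (2 * Q)) has_real_derivative
          - (inverse (m + cc - y * Q) * (0 - 1 * Q)) / (2 * Q)) (at y)" .
      moreover have "- (inverse D * (0 - 1 * Q)) / (2 * Q) = 1 / (2 * D)" for D
        using Q by (simp add: inverse_eq_divide)
      ultimately show ?thesis by (simp only:)
    qed
    show "0 \<le> 1 / (2 * (m + cc - y * Q))" if "y \<in> {0..Y}" for y
      using pos[of y] that by simp
  qed (use Y in auto)
  also have "- ln (m + cc - Y * Q) / (2 * Q) - (- ln (m + cc - 0 * Q) / (2 * Q)) = dens m"
  proof -
    have "- ln (m + cc - Y * Q) / (2 * Q) - (- ln (m + cc - 0 * Q) / (2 * Q))
      = 1 / (2 * Q) * ln ((m + cc) / (m + cc - Y * Q))"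
      using pos[of Y] mc Q by (simp add: ln_div diff_divide_distrib)
    also have "(m + cc) / (m + cc - Y * Q) = (m + cc) * (m + cb) / ((cb + cc) * (m - ca))"
      unfolding num[symmetric] Y_def using mb by (simp add: field_simps)
    finally show ?thesis by (simp add: dens_def Q_def)
  qed
  finally show ?thesis .
qed

text \<open>Integration over the height, then over the rays through the vertex 0 of the base triangle.\<close>

private lemma region_volume:
  "(\<integral>\<^sup>+q. hdens (Re (fst q)) (Im (fst q)) (snd q) \<partial>(lborel :: (complex \<times> real) measure)) \<le> ennreal (ideal_volume a b c)"
proof -
  define G where "G = (\<lambda>x y. \<integral>\<^sup>+t. hdens x y t \<partial>lborel)"
  have Gm [measurable]: "(\<lambda>p. G (f p) (g p)) \<in> borel_measurable M"
    if [measurable]: "f \<in> borel_measurable M" "g \<in> borel_measurable M" for f g :: "'x \<Rightarrow> real" and M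
    unfolding G_def by measurable
  have "(\<integral>\<^sup>+q. hdens (Re (fst q)) (Im (fst q)) (snd q) \<partial>(lborel :: (complex \<times> real) measure))
    = (\<integral>\<^sup>+w. G (Re w) (Im w) \<partial>lborel)"
    unfolding G_def lborel_prod[symmetric]
    by (subst lborel.nn_integral_fst[symmetric]) (auto)
  also have "\<dots> = (\<integral>\<^sup>+p. G (fst p) (snd p) \<partial>(lborel \<Otimes>\<^sub>M lborel))"
    unfolding lborel_complex
    by (subst nn_integral_distr[OF measurable_Complex_pair]) (auto simp: case_prod_beta)
  also have "\<dots> = (\<integral>\<^sup>+y. \<integral>\<^sup>+x. G x y \<partial>lborel \<partial>lborel)"
    by (subst lborel_pair.nn_integral_snd[symmetric]) auto
  also have "\<dots> = (\<integral>\<^sup>+y. \<integral>\<^sup>+m. ennreal \<bar>y\<bar> * G (y * m) y \<partial>lborel \<partial>lborel)"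
  proof (rule nn_integral_cong_AE, rule AE_mp[OF AE_lborel_singleton[of 0]], rule AE_I2, rule impI)
    fix y :: real assume "y \<noteq> 0"
    have "(\<integral>\<^sup>+x. G x y \<partial>lborel) = ennreal \<bar>y\<bar> * (\<integral>\<^sup>+m. G (0 + y * m) y \<partial>lborel)"
      by (rule nn_integral_real_affine) (use \<open>y \<noteq> 0\<close> in auto)
    then show "(\<integral>\<^sup>+x. G x y \<partial>lborel) = (\<integral>\<^sup>+m. ennreal \<bar>y\<bar> * G (y * m) y \<partial>lborel)"
      by (simp add: nn_integral_cmult)
  qed
  also have "\<dots> = (\<integral>\<^sup>+m. \<integral>\<^sup>+y. ennreal \<bar>y\<bar> * G (y * m) y \<partial>lborel \<partial>lborel)"
    by (rule lborel_pair.Fubini') (measurable)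
  also have "\<dots> \<le> (\<integral>\<^sup>+m. ennreal (dens m) * indicator {ca<..} m \<partial>lborel)"
  proof (rule nn_integral_mono_AE, rule AE_mp[OF AE_lborel_singleton[of ca]], rule AE_I2, rule impI)
    fix m assume "m \<noteq> ca"
    show "(\<integral>\<^sup>+y. ennreal \<bar>y\<bar> * G (y * m) y \<partial>lborel) \<le> ennreal (dens m) * indicator {ca<..} m"
    proof (cases "ca < m")
      case True
      then show ?thesis using slope_integral[OF True] by (simp add: G_def)
    next
      case False
      then have m: "m < ca" using \<open>m \<noteq> ca\<close> by auto
      have "ennreal \<bar>y\<bar> * G (y * m) y = 0" for y
      proof (cases "y = 0")
        case False
        have "\<not> region (y * m) y t" for t
        proof
          assume "region (y * m) y t"
          then have "0 \<le> y" "y * ca \<le> y * m" by (auto simp: region_def)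
          then show False using False m by simp
        qed
        then show ?thesis by (simp add: G_def hdens_def)
      qed simp
      then have "(\<integral>\<^sup>+y. ennreal \<bar>y\<bar> * G (y * m) y \<partial>lborel) = 0" by (simp only: nn_integral_0_iff_AE nn_integral_const) simp
      then show ?thesis by simp
    qed
  qed
  also have "\<dots> = ennreal (ideal_volume a b c)" by (rule dens_integral(1))
  finally show ?thesis .
qed

text \<open>The third finite vertex, so that the base triangle has angles \<open>a, b, c\<close> at 0, 1 and \<open>apex\<close>.\<close>

private definition "apex = of_real (sin b / sin c) * cis a"

private lemma apex_Re_Im: "Re apex = sin b * cos a / sin c" "Im apex = sin b * sin a / sin c"
  by (simp_all add: apex_def)

lemma hvol_ideal_tet_apex_le: "hvol (ideal_tet apex) \<le> ennreal (ideal_volume a b c)"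
proof -
  have "region (Re w) (Im w) t" if "(w, t) \<in> ideal_tet apex" for w t
  proof -
    have t: "0 < t" and w: "w \<in> convex hull {0, 1, apex}"
      and circ: "\<And>m R. cmod m = R \<and> cmod (1 - m) = R \<and> cmod (apex - m) = R \<Longrightarrow> R\<^sup>2 \<le> (cmod (w - m))\<^sup>2 + t\<^sup>2"
      using that by (auto simp: ideal_tet_def)
    obtain p q r where pqr: "0 \<le> p" "0 \<le> q" "0 \<le> r" "p + q + r = 1"
      "w = p *\<^sub>R 0 + q *\<^sub>R 1 + r *\<^sub>R apex"
      using w unfolding convex_hull_3 by auto
    have w': "Re w = q + r * Re apex" "Im w = r * Im apex" using pqr(5) by auto
    have e1: "Im apex * ca = Re apex" using sin_pos by (simp add: apex_Re_Im ca_def)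
    have e2: "Re apex + Im apex * cb = 1"
    proof -
      have "c = pi - (a + b)" using abc by simp
      then have "sin c = sin (a + b)" by (simp only: sin_pi_minus)
      have "Re apex + Im apex * cb = (sin a * cos b + cos a * sin b) / sin c"
        using sin_pos by (simp add: apex_Re_Im cb_def add_divide_distrib)
      also have "\<dots> = 1" unfolding sin_add[symmetric] \<open>sin c = sin (a + b)\<close>[symmetric] using sin_pos by simp
      finally show ?thesis .
    qed
    have e3: "(cmod apex)\<^sup>2 = Re apex + Im apex * cc"
    proof -
      have "b = pi - (a + c)" using abc by simp
      then have sb: "sin b = sin (a + c)" by (simp only: sin_pi_minus)
      have "Re apex + Im apex * cc = sin b * (sin a * cos c + cos a * sin c) / (sin c)\<^sup>2"
        using sin_pos by (simp add: apex_Re_Im cc_def field_simps power2_eq_square)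
      also have "\<dots> = (sin b / sin c)\<^sup>2" unfolding sb sin_add by (simp add: power2_eq_square)
      also have "\<dots> = (cmod apex)\<^sup>2" by (simp add: apex_def norm_mult norm_divide power_divide)
      finally show ?thesis by simp
    qed
    have "Im w \<ge> 0" unfolding w' using pqr sin_pos by (simp add: apex_Re_Im)
    moreover have "Im w * ca \<le> Re w" using pqr e1 by (simp add: w' mult.assoc)
    moreover have "Re w + Im w * cb \<le> 1"
    proof -
      have "Re w + Im w * cb = q + r * (Re apex + Im apex * cb)" by (simp add: w' algebra_simps)
      then show ?thesis using pqr e2 by simp
    qed
    moreover have "circ (Re w) (Im w) \<le> t\<^sup>2"
    proof -
      define m where "m = Complex (1/2) (cc/2)"
      have m2: "(cmod (u - m))\<^sup>2 = (cmod u)\<^sup>2 - Re u - Im u * cc + (cmod m)\<^sup>2" for u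
        unfolding cmod_power2 m_def by (simp add: power2_eq_square algebra_simps)
      have "(cmod (1 - m))\<^sup>2 = (cmod m)\<^sup>2" "(cmod (apex - m))\<^sup>2 = (cmod m)\<^sup>2"
        unfolding m2 by (simp_all add: e3)
      then have "cmod (1 - m) = cmod m" "cmod (apex - m) = cmod m" by (simp_all add: power2_eq_iff_nonneg)
      with circ[of m "cmod m"] have "(cmod m)\<^sup>2 \<le> (cmod (w - m))\<^sup>2 + t\<^sup>2" by simp
      then show ?thesis unfolding m2 circ_def by (simp add: cmod_power2 algebra_simps)
    qed
    ultimately show ?thesis using t by (simp add: region_def)
  qed
  then have "hvol (ideal_tet apex) \<le> (\<integral>\<^sup>+q. hdens (Re (fst q)) (Im (fst q)) (snd q) \<partial>lborel)"
    unfolding hvol_def by (intro nn_integral_mono) (auto simp: hdens_def split: split_indicator)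
  then show ?thesis using region_volume by simp
qed

private lemma apex_args:
  "Im apex > 0" "Arg apex = a" "Arg (1 / (1 - apex)) = b" "Arg ((apex - 1) / apex) = c"
proof -
  have e: "c = pi - (a + b)" using abc by simp
  have sc: "sin c = sin a * cos b + cos a * sin b" unfolding e sin_pi_minus by (rule sin_add)
  have p: "-pi < a" "-pi < b" "-pi < c" "a \<le> pi" "b \<le> pi" "c \<le> pi" using abc by auto
  show "Im apex > 0" using sin_pos by (simp add: apex_Re_Im)
  show "Arg apex = a"
  proof (rule Arg_unique)
    show "of_real (sin b / sin c) * exp (\<i> * of_real a) = apex" unfolding apex_def cis_conv_exp ..
  qed (use sin_pos p in auto)
  have 1: "1 - apex = of_real (sin a / sin c) * cis (- b)"
  proof (rule complex_eqI)
    have "sin c - sin b * cos a = sin a * cos b" unfolding sc by simp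
    then have "(sin c - sin b * cos a) / sin c = sin a * cos b / sin c" by simp
    then show "Re (1 - apex) = Re (of_real (sin a / sin c) * cis (- b))"
      using sin_pos by (simp add: apex_Re_Im diff_divide_distrib)
  qed (simp add: apex_Re_Im)
  show "Arg (1 / (1 - apex)) = b"
  proof (rule Arg_unique[where r = "sin c / sin a"])
    show "of_real (sin c / sin a) * exp (\<i> * of_real b) = 1 / (1 - apex)"
    proof -
      have "1 / (1 - apex) = inverse (of_real (sin a / sin c)) * inverse (cis (- b))"
        unfolding 1 by (simp add: inverse_eq_divide)
      also have "inverse (cis (- b)) = exp (\<i> * of_real b)" unfolding cis_inverse minus_minus by (rule cis_conv_exp)
      finally show ?thesis using sin_pos by simp
    qed
  qed (use sin_pos p in auto)
  show "Arg ((apex - 1) / apex) = c"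
  proof (rule Arg_unique[where r = "sin a / sin b"])
    have "(apex - 1) / apex = - (1 - apex) / apex" by simp
    also have "\<dots> = of_real (sin a / sin b) * (- cis (- b) / cis a)"
      unfolding 1 unfolding apex_def using sin_pos by simp
    also have "- cis (- b) / cis a = cis c"
      unfolding e by (simp add: complex_eq_iff cis_divide cos_diff sin_diff cos_add sin_add)
    finally show "of_real (sin a / sin b) * exp (\<i> * of_real c) = (apex - 1) / apex"
      by (simp only: cis_conv_exp)
  qed (use sin_pos p in auto)
qed

private lemma apex_unique:
  assumes z: "Im z > 0" "Arg z = a" "Arg (1 / (1 - z)) = b"
  shows "z = apex"
proof -
  have nz: "z \<noteq> 0" "1 - z \<noteq> 0" using z(1) by (auto simp: complex_eq_iff)
  then have nz': "1 / (1 - z) \<noteq> 0" by simp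
  define r where "r = cmod z"
  define s where "s = inverse (cmod (1 / (1 - z)))"
  have zr: "z = of_real r * cis a"
    using Arg_eq[OF nz(1)] unfolding z(2) r_def cis_conv_exp .
  have "1 / (1 - z) = of_real (cmod (1 / (1 - z))) * cis b"
    using Arg_eq[OF nz'] unfolding z(3) cis_conv_exp .
  then have "inverse (1 / (1 - z)) = inverse (of_real (cmod (1 / (1 - z))) * cis b)" by simp
  then have "1 - z = of_real s * cis (- b)"
    unfolding inverse_mult_distrib cis_inverse s_def of_real_inverse by simp
  then have "1 - of_real r * cis a = of_real s * cis (- b)" unfolding zr .
  then have re: "1 - r * cos a = s * cos b" and im: "r * sin a = s * sin b"
    by (auto simp: complex_eq_iff)
  have e: "c = pi - (a + b)" using abc by simp
  have sc: "sin c = sin a * cos b + cos a * sin b" unfolding e sin_pi_minus by (rule sin_add)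
  have "r * sin c = (r * sin a) * cos b + (r * cos a) * sin b" unfolding sc by (simp only: distrib_left mult.assoc)
  also have "r * cos a = 1 - s * cos b" using re by simp
  also have "(r * sin a) * cos b + (1 - s * cos b) * sin b = sin b" unfolding im by (simp add: left_diff_distrib)
  finally have "r * sin c = sin b" .
  then have "r = sin b / sin c" using sin_pos by (simp add: field_simps)
  then show ?thesis unfolding zr apex_def by simp
qed

lemma tet_volume_le_ideal_volume: "tet_volume a b c \<le> ideal_volume a b c"
proof -
  have "(THE z. Im z > 0 \<and> Arg z = a \<and> Arg (1 / (1 - z)) = b \<and> Arg ((z - 1) / z) = c) = apex"
    using apex_args apex_unique by (intro the_equality) (blast, blast)
  then have "tet_volume a b c = enn2real (hvol (ideal_tet apex))" by (simp add: tet_volume_def)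
  also have "\<dots> \<le> ideal_volume a b c"
    using enn2real_mono[OF hvol_ideal_tet_apex_le] ideal_volume_nonneg by simp
  finally show ?thesis .
qed

end

section \<open>Semiclassical bound for the quantum dilogarithm\<close>

text \<open>The kernel of \<open>qdilog b\<close>, with \<open>\<beta> = b\<^sup>2\<close>, after the substitution \<open>w = b v\<close>.\<close>

definition qdilog_kernel :: "real \<Rightarrow> complex \<Rightarrow> complex" where
  "qdilog_kernel \<beta> v = 1 / v / sinh (of_real \<beta> * v) / sinh v"

lemma sinh_scaled_vert_nonzero: "0 < \<beta> \<Longrightarrow> \<beta> \<le> 1 \<Longrightarrow> sinh (of_real \<beta> * vert u) \<noteq> 0"
proof (rule sinh_nonzero_strip)
  assume b: "0 < \<beta>" "\<beta> \<le> 1"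
  then have "\<beta> * pi \<le> 1 * pi" by (intro mult_right_mono) auto
  then have "\<beta> * pi < pi * 2" using pi_gt_zero by linarith
  then show "\<bar>Im (of_real \<beta> * vert u)\<bar> < pi" "0 < \<bar>Im (of_real \<beta> * vert u)\<bar>" using b by auto
qed

lemma continuous_on_sinh_complex [continuous_intros]:
  "continuous_on A f \<Longrightarrow> continuous_on A (\<lambda>x. sinh (f x :: complex))"
  unfolding sinh_def scaleR_conv_of_real by (intro continuous_intros)

lemma decaying_qdilog_kernel:
  assumes b: "0 < \<beta>" "\<beta> \<le> 1"
  obtains K where "decaying K (qdilog_kernel \<beta>)"
proof -
  have p: "0 < sin (\<beta> * (pi/2))"
  proof (rule sin_gt_zero)
    have "\<beta> * (pi/2) \<le> 1 * (pi/2)" using b by (intro mult_right_mono) auto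
    then show "\<beta> * (pi/2) < pi" using pi_gt_zero by simp
  qed (use b in simp)
  have "decaying (2 * (1 / sin (\<beta> * (pi/2)))) (\<lambda>v. (1 / v / sinh (of_real \<beta> * v)) / sinh v)"
  proof (rule decaying_divide_sinh)
    show "continuous_on UNIV (\<lambda>u. 1 / vert u / sinh (of_real \<beta> * vert u))"
      using sinh_scaled_vert_nonzero[OF b] by (intro continuous_intros) auto
    fix u
    have "sin (\<beta> * (pi/2)) * 1 \<le> \<bar>sin (\<beta> * (pi/2))\<bar> * cosh (\<beta> * u)"
      using p cosh_real_ge_1 by (intro mult_mono) auto
    also have "\<dots> \<le> cmod (sinh (of_real \<beta> * vert u))"
      using cmod_sinh_ge_cosh[of "of_real \<beta> * vert u"] by simp
    finally have "1 * sin (\<beta> * (pi/2)) \<le> cmod (vert u) * cmod (sinh (of_real \<beta> * vert u))"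
      using cmod_vert_ge[of u] p by (intro mult_mono) auto
    then have "1 / (cmod (vert u) * cmod (sinh (of_real \<beta> * vert u))) \<le> 1 / sin (\<beta> * (pi/2))"
      using p by (intro frac_le) auto
    then show "cmod (1 / vert u / sinh (of_real \<beta> * vert u)) \<le> 1 / sin (\<beta> * (pi/2))"
      by (simp add: norm_divide norm_mult)
  qed
  then show ?thesis using that by (simp add: qdilog_kernel_def[abs_def])
qed

text \<open>The integrand has no pole with imaginary part strictly between 0 and \<open>pi b\<close>, so the integral under the
  limit does not depend on \<open>\<eta>\<close>. At \<open>\<eta> = b pi / 2\<close> the substitution \<open>w = b v\<close> maps it to the line at height
  \<open>pi / 2\<close>.\<close>

lemma qdilog_eq_exp_line_transform:
  assumes b: "0 < b" "b \<le> 1" and z: "\<bar>2 * pi * b * Im z\<bar> < pi"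
  shows "qdilog b z = exp (1/4 * line_transform (qdilog_kernel (b\<^sup>2)) (of_real (2 * pi * b) * z))"
proof -
  define f where "f = (\<lambda>w. exp (- 2 * \<i> * z * w) / (sinh (of_real b * w) * sinh (w / of_real b) * w))"
  have b2: "b\<^sup>2 \<le> 1" using b by (simp add: power_le_one)
  have shift: "(\<integral>u. f (Complex u \<eta>) \<partial>lborel) = (\<integral>u. f (Complex u (b * (pi/2))) \<partial>lborel)"
    if \<eta>: "0 < \<eta>" "\<eta> < pi * b" for \<eta>
  proof (rule integral_horizontal_shift[where ?s0.0 = 0 and ?s1.0 = "pi * b"])
    show "f holomorphic_on {w. 0 < Im w \<and> Im w < pi * b} - {0}"
      unfolding f_def
    proof (intro holomorphic_intros)
      fix w assume "w \<in> {w. 0 < Im w \<and> Im w < pi * b} - {0}"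
      then have w: "0 < Im w" "Im w < pi * b" "w \<noteq> 0" by auto
      have "sinh (of_real b * w) \<noteq> 0"
      proof (rule sinh_nonzero_strip)
        have "b * Im w \<le> 1 * Im w" using b w by (intro mult_right_mono) auto
        also have "\<dots> < pi * b" using w by simp
        also have "pi * b \<le> pi * 1" using b by (intro mult_left_mono) auto
        finally show "\<bar>Im (of_real b * w)\<bar> < pi" using b w by simp
      qed (use b w in auto)
      moreover have "sinh (w / of_real b) \<noteq> 0"
        by (rule sinh_nonzero_strip) (use b w in \<open>auto simp: field_simps\<close>)
      ultimately show "sinh (of_real b * w) * sinh (w / of_real b) * w \<noteq> 0" using w by simp
    qed (use b in auto)
    show "0 < 1 / b - 2 * \<bar>Im z\<bar>"
    proof -
      have "pi * (2 * b * \<bar>Im z\<bar>) < pi * 1" using z b by (simp add: abs_mult mult_ac)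
      then have "2 * b * \<bar>Im z\<bar> < 1" by (subst (asm) mult_less_cancel_left_pos) auto
      then show ?thesis using b by (simp add: field_simps)
    qed
    fix w assume w: "0 < Im w" "Im w < pi * b" "1 \<le> \<bar>Re w\<bar>"
    have "Re z * Im w \<le> \<bar>Re z\<bar> * (pi * b)"
      using w by (intro mult_mono) auto
    moreover have "Im z * Re w \<le> \<bar>Im z\<bar> * \<bar>Re w\<bar>" by (metis abs_ge_self abs_mult)
    ultimately have "cmod (exp (- 2 * \<i> * z * w)) \<le> exp (2 * (\<bar>Re z\<bar> * (pi * b)) + 2 * \<bar>Im z\<bar> * \<bar>Re w\<bar>)"
      by (simp add: algebra_simps)
    moreover have "b * (exp (\<bar>Re w\<bar> / b) / 4) * 1 \<le> cmod (sinh (of_real b * w)) * cmod (sinh (w / of_real b)) * cmod w"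
    proof (intro mult_mono)
      have "b * 1 \<le> b * \<bar>Re w\<bar>" using w b by (intro mult_left_mono) auto
      also have "\<dots> = \<bar>b * Re w\<bar>" using b by (simp add: abs_mult)
      also have "\<dots> \<le> cmod (sinh (of_real b * w))"
        using abs_le_abs_sinh[of "b * Re w"] cmod_sinh_ge_sinh[of "of_real b * w"] by simp
      finally show "b \<le> cmod (sinh (of_real b * w))" by simp
      have "1 \<le> \<bar>Re w / b\<bar>"
      proof -
        have "1 * b \<le> \<bar>Re w\<bar>" using w b by simp
        then show ?thesis using b by (simp add: abs_divide field_simps)
      qed
      from abs_sinh_ge_exp[OF this]
      show "exp (\<bar>Re w\<bar> / b) / 4 \<le> cmod (sinh (w / of_real b))"
        using cmod_sinh_ge_sinh[of "w / of_real b"] b by (simp add: abs_divide)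
      show "1 \<le> cmod w" using abs_Re_le_cmod[of w] w by linarith
    qed (use b in auto)
    ultimately have "cmod (f w) \<le> exp (2 * (\<bar>Re z\<bar> * (pi * b)) + 2 * \<bar>Im z\<bar> * \<bar>Re w\<bar>) / (b * (exp (\<bar>Re w\<bar> / b) / 4) * 1)"
      unfolding f_def norm_divide norm_mult using b by (intro frac_le) auto
    also have "\<dots> = 4 / b * exp (2 * (\<bar>Re z\<bar> * (pi * b))) * (exp (2 * \<bar>Im z\<bar> * \<bar>Re w\<bar>) / exp (\<bar>Re w\<bar> / b))"
      by (simp add: exp_add)
    also have "exp (2 * \<bar>Im z\<bar> * \<bar>Re w\<bar>) / exp (\<bar>Re w\<bar> / b) = exp (- (1 / b - 2 * \<bar>Im z\<bar>) * \<bar>Re w\<bar>)"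
      by (simp add: algebra_simps flip: exp_diff)
    finally show "cmod (f w) \<le> 4 / b * exp (2 * (\<bar>Re z\<bar> * (pi * b))) * exp (- (1 / b - 2 * \<bar>Im z\<bar>) * \<bar>Re w\<bar>)" .
  qed (use \<eta> b in auto)
  have scale: "(\<integral>u. f (Complex u (b * (pi/2))) \<partial>lborel) = line_transform (qdilog_kernel (b\<^sup>2)) (of_real (2 * pi * b) * z)"
  proof -
    have "(\<integral>u. f (Complex u (b * (pi/2))) \<partial>lborel) = \<bar>b\<bar> *\<^sub>R (\<integral>u. f (Complex (0 + b * u) (b * (pi/2))) \<partial>lborel)"
      using b by (intro lborel_integral_real_affine) auto
    also have "\<dots> = (\<integral>u. of_real b * f (Complex (b * u) (b * (pi/2))) \<partial>lborel)"
      using b by (simp add: scaleR_conv_of_real)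
    also have "\<dots> = line_transform (qdilog_kernel (b\<^sup>2)) (of_real (2 * pi * b) * z)"
      unfolding line_transform_def
    proof (rule Bochner_Integration.integral_cong[OF refl])
      fix u
      have c: "Complex (b * u) (b * (pi/2)) = of_real b * vert u" by (simp add: vert_def complex_eq_iff)
      have e: "- 2 * \<i> * z * (of_real b * vert u) = - \<i> * (of_real (2 * pi * b) * z) * vert u / of_real pi"
        by (simp add: field_simps)
      have s: "of_real b * (of_real b * vert u) = of_real (b\<^sup>2) * vert u" "of_real b * vert u / of_real b = vert u"
        using b by (auto simp: power2_eq_square)
      show "of_real b * f (Complex (b * u) (b * (pi/2))) =
         exp (- \<i> * (of_real (2 * pi * b) * z) * vert u / of_real pi) * qdilog_kernel (b\<^sup>2) (vert u)"
        unfolding c f_def e s qdilog_kernel_def using b by simp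
    qed
    finally show ?thesis .
  qed
  have "((\<lambda>\<eta>. LINT y|lborel. f (Complex y \<eta>)) \<longlongrightarrow> line_transform (qdilog_kernel (b\<^sup>2)) (of_real (2 * pi * b) * z)) (at_right 0)"
  proof (rule tendsto_eventually)
    have "\<forall>\<^sub>F \<eta> in at_right 0. \<eta> \<in> {0<..<pi * b}" using b by (intro eventually_at_right_real) auto
    then show "\<forall>\<^sub>F \<eta> in at_right 0. (LINT y|lborel. f (Complex y \<eta>)) = line_transform (qdilog_kernel (b\<^sup>2)) (of_real (2 * pi * b) * z)"
      by (rule eventually_mono) (use shift scale in auto)
  qed
  then have "Lim (at_right 0) (\<lambda>\<eta>. LINT y|lborel. f (Complex y \<eta>)) = line_transform (qdilog_kernel (b\<^sup>2)) (of_real (2 * pi * b) * z)"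
    by (intro tendsto_Lim) auto
  then show ?thesis unfolding qdilog_def f_def Let_def by simp
qed

lemma holomorphic_on_qdilog:
  assumes b: "0 < b" "b \<le> 1"
  shows "qdilog b holomorphic_on {z. \<bar>2 * pi * b * Im z\<bar> < pi}"
proof -
  let ?S = "{z. \<bar>2 * pi * b * Im z\<bar> < pi}"
  have b2: "0 < b\<^sup>2" "b\<^sup>2 \<le> 1" using b by (auto simp: power_le_one)
  obtain K where K: "decaying K (qdilog_kernel (b\<^sup>2))" using decaying_qdilog_kernel[OF b2] .
  have h: "line_transform (qdilog_kernel (b\<^sup>2)) holomorphic_on {Z. \<bar>Im Z\<bar> < pi}"
    unfolding holomorphic_on_def
    using has_field_derivative_line_transform[OF K] has_field_derivative_at_within field_differentiable_def by blast
  have "(\<lambda>z. exp (1/4 * line_transform (qdilog_kernel (b\<^sup>2)) (of_real (2 * pi * b) * z))) holomorphic_on ?S"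
    by (intro holomorphic_on_exp[unfolded o_def] holomorphic_on_mult holomorphic_on_const holomorphic_on_exp'
        holomorphic_on_compose_gen[OF _ h, unfolded o_def]) (auto intro!: holomorphic_intros)
  then show ?thesis
    by (rule holomorphic_transform) (use qdilog_eq_exp_line_transform[OF b] in auto)
qed

lemma sinh_cnj: "sinh (cnj z) = cnj (sinh z)"
  by (simp add: complex_eq_iff Re_sinh Im_sinh)

text \<open>The reflection \<open>v \<mapsto> - cnj v\<close> preserves the line.\<close>

lemma line_transform_cnj:
  assumes "\<And>u. k (vert (- u)) = - cnj (k (vert u))"
  shows "line_transform k (cnj Z) = - cnj (line_transform k Z)"
proof -
  have v: "vert (- u) = - cnj (vert u)" for u by (simp add: vert_def complex_eq_iff)
  have "line_transform k (cnj Z) = \<bar>-1\<bar> *\<^sub>R (\<integral>u. exp (- \<i> * cnj Z * vert (0 + (-1) * u) / of_real pi) * k (vert (0 + (-1) * u)) \<partial>lborel)"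
    unfolding line_transform_def by (rule lborel_integral_real_affine) simp
  also have "\<dots> = (\<integral>u. - cnj (exp (- \<i> * Z * vert u / of_real pi) * k (vert u)) \<partial>lborel)"
    by (simp add: assms) (simp add: v exp_cnj)
  also have "\<dots> = - cnj (line_transform k Z)"
    unfolding line_transform_def by (simp only: Bochner_Integration.integral_minus Bochner_Integration.integral_cnj)
  finally show ?thesis .
qed

text \<open>The logarithm of \<open>qdilog b\<close> at \<open>cnj z\<close> is minus the conjugate of the one at \<open>z\<close>.\<close>

lemma cmod_qdilog_cnj:
  assumes b: "0 < b" "b \<le> 1" and z: "\<bar>2 * pi * b * Im z\<bar> < pi"
  shows "cmod (qdilog b (cnj z)) = inverse (cmod (qdilog b z))"
proof -
  have v: "vert (- u) = - cnj (vert u)" for u by (simp add: vert_def complex_eq_iff)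
  have z': "\<bar>2 * pi * b * Im (cnj z)\<bar> < pi" using z by simp
  have "line_transform (qdilog_kernel (b\<^sup>2)) (cnj (of_real (2 * pi * b) * z))
    = - cnj (line_transform (qdilog_kernel (b\<^sup>2)) (of_real (2 * pi * b) * z))"
  proof (rule line_transform_cnj)
    fix u
    have "of_real (b\<^sup>2) * vert (- u) = - cnj (of_real (b\<^sup>2) * vert u)" by (simp add: v)
    then show "qdilog_kernel (b\<^sup>2) (vert (- u)) = - cnj (qdilog_kernel (b\<^sup>2) (vert u))"
      unfolding qdilog_kernel_def by (simp only: v sinh_minus sinh_cnj) simp
  qed
  then show ?thesis
    unfolding qdilog_eq_exp_line_transform[OF b z] qdilog_eq_exp_line_transform[OF b z'] norm_exp_eq_Re
    by (simp add: exp_minus)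
qed

text \<open>What replacing \<open>sinh (\<beta> v)\<close> by \<open>\<beta> v\<close> in the kernel leaves over is this function divided by \<open>v\<close>. Multiplication
  by \<open>v\<close> corresponds to differentiation, so this is the kernel of the derivative of the error.\<close>

definition qdilog_remainder :: "real \<Rightarrow> complex \<Rightarrow> complex" where
  "qdilog_remainder \<beta> v = (1 / sinh (of_real \<beta> * v) - 1 / (of_real \<beta> * v)) / sinh v"

lemma qdilog_remainder_bound:
  assumes b: "0 < \<beta>" "\<beta> \<le> 1/8" and v: "v \<noteq> 0" "\<bar>Im v\<bar> \<le> 2"
  shows "cmod (1 / sinh (of_real \<beta> * v) - 1 / (of_real \<beta> * v)) \<le> 5"
proof (rule cmod_inverse_sinh_minus_inverse)
  have "\<beta> * \<bar>Im v\<bar> \<le> 1/8 * 2" using b v by (intro mult_mono) auto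
  then show "\<bar>Im (of_real \<beta> * v)\<bar> \<le> 1/4" using b by (simp add: abs_mult)
qed (use b v in auto)

lemma decaying_remainder:
  assumes b: "0 < \<beta>" "\<beta> \<le> 1/8"
  shows "decaying 10 (qdilog_remainder \<beta>)" "decaying 10 (\<lambda>v. 1 / v * qdilog_remainder \<beta> v)"
proof -
  let ?g = "\<lambda>v. 1 / sinh (of_real \<beta> * v) - 1 / (of_real \<beta> * v)"
  have c: "continuous_on UNIV (\<lambda>u. ?g (vert u))"
    using sinh_scaled_vert_nonzero[of \<beta>] b by (intro continuous_intros) auto
  have n: "cmod (?g (vert u)) \<le> 5" for u
    using qdilog_remainder_bound[OF b, of "vert u"] pi_less_4 by simp
  show "decaying 10 (qdilog_remainder \<beta>)"
    unfolding qdilog_remainder_def[abs_def] using decaying_divide_sinh[OF c n] by simp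
  have n': "cmod (1 / vert u * ?g (vert u)) \<le> 5" for u
  proof -
    have "cmod (?g (vert u)) / cmod (vert u) \<le> 5 / 1"
      using n[of u] cmod_vert_ge[of u] by (intro frac_le) auto
    then show ?thesis by (simp add: norm_mult norm_divide)
  qed
  have "continuous_on UNIV (\<lambda>u. 1 / vert u * ?g (vert u))"
    by (intro continuous_on_mult[OF _ c] continuous_intros) auto
  from decaying_divide_sinh[OF this n']
  show "decaying 10 (\<lambda>v. 1 / v * qdilog_remainder \<beta> v)"
    unfolding qdilog_remainder_def[abs_def] by (simp add: mult.assoc)
qed

text \<open>The kernel is even and its singularity at 0 is removable, so the line may be moved to its mirror image
  below the real axis. There the transform decays as \<open>Re Z\<close> tends to plus infinity.\<close>

lemma line_transform_remainder_even:
  assumes b: "0 < \<beta>" "\<beta> \<le> 1/8" and Z: "\<bar>Im Z\<bar> < pi"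
  shows "line_transform (qdilog_remainder \<beta>) (- Z) = line_transform (qdilog_remainder \<beta>) Z"
proof -
  define f where "f = (\<lambda>v. exp (- \<i> * Z * v / of_real pi) * qdilog_remainder \<beta> v)"
  define k where "k = 1 - \<bar>Im Z\<bar> / pi"
  have k: "0 < k" using Z by (simp add: k_def)
  have p2: "pi/2 < 2" "- (pi/2) > -2" "- (pi/2) < 2" using pi_less_4 pi_gt_zero by linarith+
  have shift: "(\<integral>u. f (Complex u (pi/2)) \<partial>lborel) = (\<integral>u. f (Complex u (- (pi/2))) \<partial>lborel)"
  proof (rule integral_horizontal_shift[where ?s0.0 = "-2" and ?s1.0 = 2])
    show "f holomorphic_on {z. - 2 < Im z \<and> Im z < 2} - {0}"
      unfolding f_def qdilog_remainder_def
    proof (intro holomorphic_intros)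
      fix v assume "v \<in> {z. - 2 < Im z \<and> Im z < 2} - {0}"
      then have v: "\<bar>Im v\<bar> < 2" "v \<noteq> 0" by auto
      show "sinh v \<noteq> 0" using v pi_gt3 by (intro sinh_nonzero_strip') auto
      show "of_real \<beta> * v \<noteq> 0" using v b by simp
      have "\<beta> * \<bar>Im v\<bar> \<le> 1 * 2" using b v by (intro mult_mono) auto
      then show "sinh (of_real \<beta> * v) \<noteq> 0"
        using v b pi_gt3 by (intro sinh_nonzero_strip') (auto simp: abs_mult)
    qed auto
    show "\<forall>\<^sub>F v in at 0. cmod (f v) \<le> exp (cmod Z) * 8"
      unfolding eventually_at
    proof (intro exI[of _ "1/2"] conjI ballI impI)
      fix v :: complex assume "v \<noteq> 0 \<and> dist v 0 < 1/2"
      then have v: "v \<noteq> 0" "cmod v < 1/2" by auto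
      have s: "cmod v / 2 \<le> cmod (sinh v)" using cmod_sinh_minus_self(2)[of v] v by simp
      have "\<beta> * cmod v \<le> 1 * (1/2)" using b v by (intro mult_mono) auto
      then have "cmod (1 / sinh (of_real \<beta> * v) - 1 / (of_real \<beta> * v)) \<le> 4 * cmod (of_real \<beta> * v)"
        using v b by (intro cmod_inverse_sinh_minus_inverse_small) (auto simp: norm_mult)
      also have "\<dots> \<le> 4 * (1 * cmod v)" using b v by (auto simp: norm_mult)
      finally have "cmod (qdilog_remainder \<beta> v) \<le> (4 * (1 * cmod v)) / (cmod v / 2)"
        unfolding qdilog_remainder_def norm_divide[of "_ - _"] using s v by (intro frac_le) auto
      also have "\<dots> = 8" using v by simp
      finally have R: "cmod (qdilog_remainder \<beta> v) \<le> 8" .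
      have "cmod (exp (- \<i> * Z * v / of_real pi)) \<le> exp (cmod (- \<i> * Z * v / of_real pi))"
        by (rule norm_exp)
      also have "cmod (- \<i> * Z * v / of_real pi) = cmod Z * (cmod v / pi)"
        by (simp add: norm_mult norm_divide)
      also have "exp (cmod Z * (cmod v / pi)) \<le> exp (cmod Z * 1)"
        using v pi_gt3 by (subst exp_le_cancel_iff, intro mult_left_mono) auto
      finally show "cmod (f v) \<le> exp (cmod Z) * 8"
        unfolding f_def norm_mult using R by (intro mult_mono) auto
    qed simp
    show "cmod (f v) \<le> 20 * exp \<bar>Re Z\<bar> * exp (- k * \<bar>Re v\<bar>)"
      if v: "- 2 < Im v" "Im v < 2" "1 \<le> \<bar>Re v\<bar>" for v
    proof -
      let ?x = "\<bar>Re v\<bar>"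
      have "v \<noteq> 0" using v by auto
      have E: "cmod (exp (- \<i> * Z * v / of_real pi)) \<le> exp (\<bar>Re Z\<bar> + \<bar>Im Z\<bar> / pi * ?x)"
        using v pi_gt3 by (intro cmod_exp_line_le) auto
      have s: "exp ?x / 4 \<le> cmod (sinh v)"
        using abs_sinh_ge_exp[OF v(3)] cmod_sinh_ge_sinh[of v] by linarith
      have R: "cmod (qdilog_remainder \<beta> v) \<le> 5 / (exp ?x / 4)"
        unfolding qdilog_remainder_def norm_divide[of "_ - _"]
        using qdilog_remainder_bound[OF b \<open>v \<noteq> 0\<close>] v s by (intro frac_le) auto
      have "cmod (f v) \<le> exp (\<bar>Re Z\<bar> + \<bar>Im Z\<bar> / pi * ?x) * (5 / (exp ?x / 4))"
        unfolding f_def norm_mult using E R by (intro mult_mono) auto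
      also have "\<dots> = 20 * exp \<bar>Re Z\<bar> * (exp (\<bar>Im Z\<bar> / pi * ?x) / exp ?x)"
        by (simp add: exp_add)
      also have "exp (\<bar>Im Z\<bar> / pi * ?x) / exp ?x = exp (- k * ?x)"
        by (simp add: k_def algebra_simps flip: exp_diff)
      finally show ?thesis .
    qed
    show "pi/2 \<in> {-2<..<2}" "- (pi/2) \<in> {-2<..<2}"
      unfolding greaterThanLessThan_iff using p2 pi_gt_zero by (intro conjI; linarith)+
  qed (use k in auto)
  have up: "(\<integral>u. f (Complex u (pi/2)) \<partial>lborel) = line_transform (qdilog_remainder \<beta>) Z"
    by (simp add: f_def line_transform_def vert_def)
  have "(\<integral>u. f (Complex u (- (pi/2))) \<partial>lborel) = \<bar>-1\<bar> *\<^sub>R (\<integral>u. f (Complex (0 + (-1) * u) (- (pi/2))) \<partial>lborel)"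
    by (rule lborel_integral_real_affine) simp
  also have "\<dots> = (\<integral>u. exp (- \<i> * (- Z) * vert u / of_real pi) * qdilog_remainder \<beta> (vert u) \<partial>lborel)"
  proof -
    have c: "Complex (- u) (- (pi/2)) = - vert u" for u by (simp add: vert_def complex_eq_iff)
    have e: "qdilog_remainder \<beta> (- v) = qdilog_remainder \<beta> v" for v
      by (simp add: qdilog_remainder_def minus_divide_left[symmetric] diff_divide_distrib)
    have "f (Complex (0 + (-1) * u) (- (pi/2))) = exp (- \<i> * (- Z) * vert u / of_real pi) * qdilog_remainder \<beta> (vert u)" for u
      by (simp add: c f_def e)
    then show ?thesis by simp
  qed
  also have "\<dots> = line_transform (qdilog_remainder \<beta>) (- Z)" by (simp add: line_transform_def)
  finally show ?thesis using shift up by simp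
qed

lemma qdilog_log_decomposition:
  assumes b: "0 < \<beta>" "\<beta> \<le> 1/8" and Z: "\<bar>Im Z\<bar> < pi"
  shows "1/4 * line_transform (qdilog_kernel \<beta>) Z
    = of_real (1 / \<beta>) * classical_dilog Z + 1/4 * line_transform (\<lambda>v. 1 / v * qdilog_remainder \<beta> v) Z"
proof -
  have "line_transform (qdilog_kernel \<beta>) Z
      = line_transform (\<lambda>v. of_real (1 / \<beta>) * (1 / v\<^sup>2 / sinh v) + 1 / v * qdilog_remainder \<beta> v) Z"
    by (rule line_transform_cong) (simp add: qdilog_kernel_def qdilog_remainder_def power2_eq_square diff_divide_distrib right_diff_distrib mult.commute)
  also have "\<dots> = line_transform (\<lambda>v. of_real (1 / \<beta>) * (1 / v\<^sup>2 / sinh v)) Z + line_transform (\<lambda>v. 1 / v * qdilog_remainder \<beta> v) Z"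
  proof (rule line_transform_add[OF _ decaying_remainder(2)[OF b] Z])
    have d: "decaying (2 * 1) (\<lambda>v. 1 / v\<^sup>2 / sinh v)" by (rule decaying_dilog_kernel)
    show "decaying (1 / \<beta> * 2) (\<lambda>v. of_real (1 / \<beta>) * (1 / v\<^sup>2 / sinh v))"
      unfolding decaying_def
    proof (intro conjI allI)
      show "continuous_on UNIV (\<lambda>u. of_real (1 / \<beta>) * (1 / (vert u)\<^sup>2 / sinh (vert u)))"
        by (intro continuous_on_mult continuous_on_const decaying_cont[OF d])
      fix u show "cmod (of_real (1 / \<beta>) * (1 / (vert u)\<^sup>2 / sinh (vert u))) \<le> 1 / \<beta> * 2 * exp (- \<bar>u\<bar>)"
        unfolding norm_mult mult.assoc using decayingD[OF d, of u] b by (intro mult_mono) (auto simp: norm_divide)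
    qed
  qed
  also have "line_transform (\<lambda>v. of_real (1 / \<beta>) * (1 / v\<^sup>2 / sinh v)) Z = of_real (1 / \<beta>) * (4 * classical_dilog Z)"
    unfolding line_transform_cmult classical_dilog_def by simp
  finally show ?thesis by simp
qed

text \<open>The error made by the classical dilogarithm is bounded uniformly in \<open>\<beta>\<close>. To the left of 0 it is
  \<open>O (e\<^bsup>X / 2\<^esup>)\<close>; to the right its derivative is \<open>O (e\<^bsup>- X / 2\<^esup>)\<close> by evenness, hence integrable.\<close>

lemma Re_line_transform_remainder_ge:
  assumes b: "0 < \<beta>" "\<beta> \<le> 1/8" and A: "0 < A" "A < pi"
  shows "- (120 / A) \<le> Re (line_transform (\<lambda>v. 1 / v * qdilog_remainder \<beta> v) (Complex X (A - pi)))"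
proof -
  define E where "E = line_transform (\<lambda>v. 1 / v * qdilog_remainder \<beta> v)"
  define e where "e X = Re (E (Complex X (A - pi)))" for X
  define e' where "e' X = Re ((- \<i> / of_real pi) * line_transform (qdilog_remainder \<beta>) (Complex X (A - pi)))" for X
  have Z: "\<bar>Im (Complex X (A - pi))\<bar> < pi" for X using A by simp
  have q: "2 / (1 - \<bar>Im (Complex X (A - pi))\<bar> / pi) = 2 * pi / A" for X
    using A by (simp add: field_simps)
  have der: "(e has_real_derivative e' X) (at X)" for X
  proof -
    have "line_transform (\<lambda>v. v * (1 / v * qdilog_remainder \<beta> v)) = line_transform (qdilog_remainder \<beta>)"
      by (rule ext, rule line_transform_cong) simp
    then have "(E has_field_derivative (- \<i> / of_real pi) * line_transform (qdilog_remainder \<beta>) (Complex X (A - pi))) (at (Complex X (A - pi)))"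
      unfolding E_def using has_field_derivative_line_transform[OF decaying_remainder(2)[OF b] Z] by simp
    then show ?thesis unfolding e_def e'_def by (rule has_real_derivative_Re_horizontal)
  qed
  have neg: "\<bar>e X\<bar> \<le> 20 * pi / A" if "X \<le> 0" for X
  proof -
    have "\<bar>e X\<bar> \<le> 10 * exp (X / 2) * (2 * pi / A)"
      using abs_Re_le_cmod[of "E (Complex X (A - pi))"]
        line_transform_bound[OF decaying_remainder(2)[OF b] Z[of X]]
      unfolding e_def E_def q by simp
    also have "\<dots> \<le> 10 * 1 * (2 * pi / A)"
      using that A by (intro mult_right_mono mult_left_mono) auto
    finally show ?thesis by simp
  qed
  have derb: "\<bar>e' X\<bar> \<le> 20 / A * exp (- X / 2)" for X
  proof -
    have Z': "\<bar>Im (- Complex X (A - pi))\<bar> < pi" using A by simp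
    have q': "2 / (1 - \<bar>Im (- Complex X (A - pi))\<bar> / pi) = 2 * pi / A" using A by (simp add: field_simps)
    have "cmod (line_transform (qdilog_remainder \<beta>) (Complex X (A - pi))) \<le> 10 * exp (- X / 2) * (2 * pi / A)"
      using line_transform_bound[OF decaying_remainder(1)[OF b] Z']
      unfolding line_transform_remainder_even[OF b Z] q' by simp
    then have "cmod ((- \<i> / of_real pi) * line_transform (qdilog_remainder \<beta>) (Complex X (A - pi)))
      \<le> 1 / pi * (10 * exp (- X / 2) * (2 * pi / A))"
      unfolding norm_mult by (intro mult_mono) (auto simp: norm_divide)
    also have "\<dots> = 20 / A * exp (- X / 2)" by simp
    finally show ?thesis unfolding e'_def using abs_Re_le_cmod order_trans by blast
  qed
  \<comment> \<open>For positive \<open>X\<close>, add to \<open>e\<close> an explicit function whose derivative dominates that of \<open>e\<close>.\<close>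
  have "- (20 * pi / A) - 40 / A \<le> e X"
  proof (cases "X \<le> 0")
    case True
    have "0 \<le> 40 / A" using A by simp
    then show ?thesis using neg[OF True] by linarith
  next
    case False
    have "e 0 - 40 / A * exp (- 0 / 2) \<le> e X - 40 / A * exp (- X / 2)"
    proof (rule DERIV_nonneg_imp_nondecreasing[where f = "\<lambda>x. e x - 40 / A * exp (- x / 2)"])
      fix x
      have "((\<lambda>x. e x - 40 / A * exp (- x / 2)) has_real_derivative e' x + 20 / A * exp (- x / 2)) (at x)"
        using A by (auto intro!: derivative_eq_intros der)
      then show "\<exists>y. ((\<lambda>x. e x - 40 / A * exp (- x / 2)) has_real_derivative y) (at x) \<and> 0 \<le> y"
        using derb[of x] by (intro exI[of _ "e' x + 20 / A * exp (- x / 2)"]) auto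
    qed (use False in auto)
    moreover have "0 \<le> 40 / A * exp (- X / 2)" using A by simp
    moreover have "\<bar>e 0\<bar> \<le> 20 * pi / A" by (rule neg) simp
    ultimately show ?thesis by simp
  qed
  moreover have "20 * pi / A + 40 / A \<le> 120 / A"
    using A pi_less_4 by (simp add: field_simps)
  ultimately show ?thesis unfolding e_def E_def by linarith
qed

text \<open>The kernel of the logarithm splits into the classical one, divided by \<open>b\<^sup>2\<close>, and one with bounded transform.\<close>

lemma qdilog_lower_bound:
  assumes b: "0 < b" "b\<^sup>2 \<le> 1/8" and A: "0 < A" "A < pi"
    and z: "of_real (2 * pi * b) * z = Complex X (A - pi)"
  shows "exp (dilog_profile A X / (2 * pi * b\<^sup>2) - 30 / A) \<le> cmod (qdilog b z)"
proof -
  have b1: "b \<le> 1" using power2_le_imp_le[of b 1] b by simp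
  have b2: "0 < b\<^sup>2" using b by simp
  have iz: "2 * pi * b * Im z = A - pi" using arg_cong[OF z, of Im] by simp
  then have z': "\<bar>2 * pi * b * Im z\<bar> < pi" using A by simp
  have Z: "\<bar>Im (Complex X (A - pi))\<bar> < pi" using A by simp
  have "cmod (qdilog b z) = exp (Re (1/4 * line_transform (qdilog_kernel (b\<^sup>2)) (Complex X (A - pi))))"
    unfolding qdilog_eq_exp_line_transform[OF b(1) b1 z'] norm_exp_eq_Re z ..
  also have "Re (1/4 * line_transform (qdilog_kernel (b\<^sup>2)) (Complex X (A - pi)))
    = 1 / b\<^sup>2 * Re (classical_dilog (Complex X (A - pi)))
     + 1/4 * Re (line_transform (\<lambda>v. 1 / v * qdilog_remainder (b\<^sup>2) v) (Complex X (A - pi)))"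
    unfolding qdilog_log_decomposition[OF b2 b(2) Z] by simp
  also have "1 / b\<^sup>2 * Re (classical_dilog (Complex X (A - pi))) = dilog_profile A X / (2 * pi * b\<^sup>2)"
    by (simp add: dilog_profile_def)
  finally show ?thesis
    using Re_line_transform_remainder_ge[OF b2 b(2) A, of X] by simp
qed

section \<open>The factor of one tetrahedron\<close>

lemma hbar_eq: "0 < b \<Longrightarrow> hbar b = (b / (1 + b\<^sup>2))\<^sup>2"
proof -
  assume b: "0 < b"
  have "b + 1 / b = (1 + b\<^sup>2) / b" using b by (simp add: field_simps power2_eq_square)
  then show "hbar b = (b / (1 + b\<^sup>2))\<^sup>2" by (simp add: hbar_def power_divide)
qed

lemma sqrt_hbar: "0 < b \<Longrightarrow> sqrt (hbar b) = b / (1 + b\<^sup>2)"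
proof -
  assume b: "0 < b"
  have "0 \<le> b / (1 + b\<^sup>2)" using b by (intro divide_nonneg_nonneg add_nonneg_nonneg) auto
  with hbar_eq[OF b] show ?thesis by (simp only: real_sqrt_unique)
qed

text \<open>Tangents of slopes \<open>c\<close> and \<open>c \<plusminus> \<mu>\<close>, the latter two with their nonnegative constant terms dropped.\<close>

lemma profile_exponent_bounds:
  assumes abc: "0 < a" "0 < b" "0 < c" "a + b + c = pi"
  shows "c * X - dilog_profile a X \<le> - ideal_volume a b c"
    and "0 < \<mu> \<Longrightarrow> \<mu> < b \<Longrightarrow> \<mu> < c \<Longrightarrow> c * X - dilog_profile a X \<le> - \<mu> * \<bar>X\<bar>"
proof -
  have a: "0 < a" "a < pi" using abc by auto
  have p: "pi - a - c = b" using abc by simp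
  show "c * X - dilog_profile a X \<le> - ideal_volume a b c"
    using dilog_profile_ge[OF a, of c X] abc by (simp add: p ideal_volume_def)
  assume m: "0 < \<mu>" "\<mu> < b" "\<mu> < c"
  have n: "0 \<le> ideal_volume a k (pi - a - k)" if "0 < k" "k < pi - a" for k
    using that a by (intro ideal_volume_nonneg) auto
  have "(c + \<mu>) * X \<le> dilog_profile a X"
    using dilog_profile_ge[OF a, of "c + \<mu>" X] n[of "c + \<mu>"] m abc by simp
  moreover have "(c - \<mu>) * X \<le> dilog_profile a X"
    using dilog_profile_ge[OF a, of "c - \<mu>" X] n[of "c - \<mu>"] m abc by simp
  ultimately show "c * X - dilog_profile a X \<le> - \<mu> * \<bar>X\<bar>"
    by (cases "X \<ge> 0") (auto simp: algebra_simps)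
qed

lemma qdilog_nonzero: "qdilog b z \<noteq> 0" by (simp add: qdilog_def)

text \<open>With \<open>X = 2 pi b t\<close> and \<open>\<phi> = c X - D X\<close>, the modulus is \<open>e\<^bsup>N \<phi>\<^esup>\<close> up to a bounded factor. In
  \<open>N \<phi> = (N - 1) \<phi> + \<phi>\<close> the first part gives the exponential rate and the second one makes the factor
  integrable. Since \<open>1 / sqrt \<hbar> = (1 + b\<^sup>2) / b\<close>, the tangent is taken for slightly larger angles \<open>B\<close>, \<open>C\<close> and
  a slightly smaller \<open>A\<close>.\<close>

lemma tetrahedron_factor_bound:
  fixes A B C b t \<mu> :: real
  assumes b: "0 < b" "b\<^sup>2 \<le> 1/8" and ABC: "0 < A" "0 < B" "0 < C" "A + B + C = pi"
    and m: "0 < \<mu>" "\<mu> < B" "\<mu> < C"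
  defines "a \<equiv> pi - (1 + b\<^sup>2) * (pi - A)" and "N \<equiv> 1 / (2 * pi * b\<^sup>2)"
  assumes a0: "0 < a"
  shows "cmod (exp (of_real (1 / sqrt (hbar b) * C * t))
      / qdilog b (of_real t - \<i> / of_real (2 * pi * sqrt (hbar b)) * of_real (pi - A)))
    \<le> exp (30 / a - (N - 1) * ideal_volume a ((1 + b\<^sup>2) * B) ((1 + b\<^sup>2) * C) - 2 * pi * b * \<mu> * \<bar>t\<bar>)"
proof -
  define X where "X = 2 * pi * b * t"
  define B' where "B' = (1 + b\<^sup>2) * B"
  define C' where "C' = (1 + b\<^sup>2) * C"
  let ?z = "of_real t - \<i> / of_real (2 * pi * sqrt (hbar b)) * of_real (pi - A)"
  have g1: "1 \<le> 1 + b\<^sup>2" by simp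
  have le: "B \<le> B'" "C \<le> C'" unfolding B'_def C'_def using mult_right_mono[OF g1, of B] mult_right_mono[OF g1, of C] ABC by simp_all
  have a': "a < pi"
  proof -
    have "0 < (1 + b\<^sup>2) * (pi - A)" using ABC by (intro mult_pos_pos add_pos_nonneg) auto
    then show ?thesis by (simp add: a_def)
  qed
  have abc: "0 < a" "0 < B'" "0 < C'" "a + B' + C' = pi"
  proof -
    have e: "pi - A = B + C" using ABC by simp
    show "a + B' + C' = pi" unfolding a_def B'_def C'_def e by (simp add: algebra_simps)
  qed (use a0 le ABC in auto)
  have h: "1 / sqrt (hbar b) = (1 + b\<^sup>2) / b" using sqrt_hbar[OF b(1)] by simp
  have z: "of_real (2 * pi * b) * ?z = Complex X (a - pi)"
  proof (rule complex_eqI)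
    show "Im (of_real (2 * pi * b) * ?z) = Im (Complex X (a - pi))"
      using b h by (simp add: a_def sqrt_hbar Im_divide power2_eq_square)
  qed (simp add: X_def Re_divide)
  have N: "1 \<le> N"
  proof -
    have "2 * pi * b\<^sup>2 \<le> 2 * 4 * (1/8)" using b pi_less_4 by (intro mult_mono) auto
    then show ?thesis using b by (simp add: N_def)
  qed
  define \<phi> where "\<phi> = C' * X - dilog_profile a X"
  have \<phi>1: "\<phi> \<le> - ideal_volume a B' C'" and \<phi>2: "\<phi> \<le> - \<mu> * \<bar>X\<bar>"
    using profile_exponent_bounds[OF abc] m le unfolding \<phi>_def by auto
  have "N * \<phi> = (N - 1) * \<phi> + \<phi>" by (simp add: algebra_simps)
  also have "\<dots> \<le> (N - 1) * (- ideal_volume a B' C') + (- \<mu> * \<bar>X\<bar>)"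
    using N \<phi>1 \<phi>2 by (intro add_mono mult_left_mono) auto
  finally have N\<phi>: "N * \<phi> \<le> - ((N - 1) * ideal_volume a B' C') - 2 * pi * b * \<mu> * \<bar>t\<bar>"
    using b by (simp add: X_def abs_mult mult_ac)
  have "cmod (exp (of_real (1 / sqrt (hbar b) * C * t)) / qdilog b ?z)
    = exp (1 / sqrt (hbar b) * C * t) / cmod (qdilog b ?z)"
    by (simp add: norm_divide)
  also have "\<dots> \<le> exp (1 / sqrt (hbar b) * C * t) / exp (dilog_profile a X / (2 * pi * b\<^sup>2) - 30 / a)"
    using qdilog_lower_bound[OF b a0 a' z] qdilog_nonzero by (intro divide_left_mono mult_pos_pos) auto
  also have "\<dots> = exp (1 / sqrt (hbar b) * C * t - (dilog_profile a X / (2 * pi * b\<^sup>2) - 30 / a))"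
    by (simp only: exp_diff)
  also have "1 / sqrt (hbar b) * C * t - (dilog_profile a X / (2 * pi * b\<^sup>2) - 30 / a) = 30 / a + N * \<phi>"
    unfolding h using b by (simp add: \<phi>_def N_def X_def C'_def power2_eq_square field_simps)
  also have "exp (30 / a + N * \<phi>) \<le> exp (30 / a - (N - 1) * ideal_volume a B' C' - 2 * pi * b * \<mu> * \<bar>t\<bar>)"
    using N\<phi> by simp
  finally show ?thesis unfolding B'_def C'_def .
qed

text \<open>Logarithm of the bound for the factor of a tetrahedron with angles \<open>p, q, r\<close>, apart from the decay in \<open>t\<close>.
  Times \<open>2 pi b\<^sup>2\<close>, it tends to minus the volume as \<open>b\<close> tends to 0.\<close>

definition tetrahedron_rate :: "real \<Rightarrow> real \<Rightarrow> real \<Rightarrow> real \<Rightarrow> real" where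
  "tetrahedron_rate b p q r = 30 / (pi - (1 + b\<^sup>2) * (pi - p))
     - (1 / (2 * pi * b\<^sup>2) - 1) * ideal_volume (pi - (1 + b\<^sup>2) * (pi - p)) ((1 + b\<^sup>2) * q) ((1 + b\<^sup>2) * r)"

text \<open>A negative tetrahedron contributes \<open>qdilog b (- z)\<close> as a factor rather than a divisor; complex conjugation
  inverts the modulus and reduces this to the positive case at \<open>- t\<close>.\<close>

lemma signed_tetrahedron_factor_bound:
  fixes A B C b t \<mu> :: real and e :: int
  assumes b: "0 < b" "b\<^sup>2 \<le> 1/8" and ABC: "0 < A" "0 < B" "0 < C" "A + B + C = pi"
    and m: "0 < \<mu>" "\<mu> < B" "\<mu> < C" and e: "e \<in> {1, -1}"
  defines "a \<equiv> pi - (1 + b\<^sup>2) * (pi - A)"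
  assumes a0: "0 < a"
  shows "cmod (exp (of_real (1 / sqrt (hbar b) * C * of_int e * t))
      / qdilog b (of_int e * (of_real t - \<i> / of_real (2 * pi * sqrt (hbar b)) * of_real (pi - A))) powi e)
    \<le> exp (tetrahedron_rate b A B C - 2 * pi * b * \<mu> * \<bar>t\<bar>)"
proof (cases "e = 1")
  case True
  then show ?thesis
    using tetrahedron_factor_bound[OF b ABC m, of t] a0 unfolding a_def tetrahedron_rate_def by simp
next
  case False
  then have e: "e = -1" using e by simp
  let ?w = "\<i> / of_real (2 * pi * sqrt (hbar b)) * of_real (pi - A)"
  let ?z = "of_real (- t) - ?w"
  have h: "1 / sqrt (hbar b) = (1 + b\<^sup>2) / b" using sqrt_hbar[OF b(1)] by simp
  have c: "- (of_real t - ?w) = cnj ?z" by simp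
  have b1: "b \<le> 1" using power2_le_imp_le[of b 1] b by simp
  have "Im ?z = - ((pi - A) * (1 + b\<^sup>2) / (2 * pi * b))"
    using b by (simp add: sqrt_hbar[OF b(1)] Im_divide power2_eq_square) (simp add: field_simps)
  then have "2 * pi * b * Im ?z = a - pi" using b by (simp add: a_def)
  moreover have "a < pi"
  proof -
    have "0 < (1 + b\<^sup>2) * (pi - A)" using ABC by (intro mult_pos_pos add_pos_nonneg) auto
    then show ?thesis by (simp add: a_def)
  qed
  ultimately have z: "\<bar>2 * pi * b * Im ?z\<bar> < pi" using a0 by simp
  have "cmod (exp (of_real (1 / sqrt (hbar b) * C * of_int e * t))
      / qdilog b (of_int e * (of_real t - ?w)) powi e)
    = cmod (exp (of_real (1 / sqrt (hbar b) * C * - t))) * cmod (qdilog b (- (of_real t - ?w)))"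
  proof -
    have 1: "of_int e * (of_real t - ?w) = - (of_real t - ?w)" by (simp add: e)
    have 2: "1 / sqrt (hbar b) * C * of_int e * t = 1 / sqrt (hbar b) * C * - t" by (simp add: e)
    have 3: "q powi e = inverse q" for q :: complex by (simp add: e power_int_minus)
    show ?thesis unfolding 1 2 3 norm_divide norm_inverse by (simp only: divide_inverse inverse_inverse_eq)
  qed
  also have "\<dots> = cmod (exp (of_real (1 / sqrt (hbar b) * C * - t)) / qdilog b ?z)"
    unfolding c cmod_qdilog_cnj[OF b(1) b1 z] by (simp only: divide_inverse norm_mult norm_inverse)
  also have "\<dots> \<le> exp (tetrahedron_rate b A B C - 2 * pi * b * \<mu> * \<bar>- t\<bar>)"
    using tetrahedron_factor_bound[OF b ABC m, of "- t"] a0 unfolding a_def tetrahedron_rate_def by blast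
  finally show ?thesis by simp
qed

section \<open>The FAMED condition and the Neumann-Zagier equations\<close>

lemma curve_sum_linear:
  fixes h :: "'k \<Rightarrow> 'a::comm_ring_1"
  assumes "finite K"
  shows "curve_sum \<epsilon> \<sigma> (\<lambda>T i j. \<Sum>k\<in>K. h k * w k T i j) = (\<Sum>k\<in>K. h k * curve_sum \<epsilon> \<sigma> (w k))"
proof (induction \<sigma>)
  case Nil
  then show ?case by (simp add: curve_sum_def)
next
  case (Cons s \<sigma>)
  obtain T v p q where s: "s = (T, v, p, q)" by (metis prod_cases4)
  have c: "curve_sum \<epsilon> (s # \<sigma>) u = of_int (\<epsilon> T * perm_sign [v, 6 - (v + p + q), p, q]) * u T v (6 - (v + p + q)) + curve_sum \<epsilon> \<sigma> u"
    for u :: "_ \<Rightarrow> nat \<Rightarrow> nat \<Rightarrow> 'a"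
    by (simp add: curve_sum_def s Let_def)
  have "d * (\<Sum>k\<in>K. h k * g k) = (\<Sum>k\<in>K. h k * (d * g k))" for d g
    by (simp add: sum_distrib_left mult.left_commute)
  then show ?case unfolding c Cons by (simp only: distrib_left sum.distrib)
qed

lemma NZ_row_linear:
  fixes h :: "'k \<Rightarrow> 'a::comm_ring_1"
  assumes "finite K"
  shows "NZ_row \<epsilon> e r0 l r (\<lambda>T i j. \<Sum>k\<in>K. h k * w k T i j) = (\<Sum>k\<in>K. h k * NZ_row \<epsilon> e r0 l r (w k))"
proof (cases "r = r0")
  case True
  then show ?thesis using curve_sum_linear[OF assms] by (simp add: NZ_row_def)
next
  case False
  have "(\<Sum>q\<in>e r. \<Sum>k\<in>K. h k * (case q of (T, i, j) \<Rightarrow> w k T i j))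
     = (\<Sum>k\<in>K. \<Sum>q\<in>e r. h k * (case q of (T, i, j) \<Rightarrow> w k T i j))"
    by (rule sum.swap)
  then show ?thesis using False
    by (simp add: NZ_row_def edge_sum_def sum_distrib_left case_prod_beta)
qed

lemma NZ_row_add:
  "NZ_row \<epsilon> e r0 l r (\<lambda>T i j. u T i j + w T i j) = NZ_row \<epsilon> e r0 l r u + NZ_row \<epsilon> e r0 l r (w :: _ \<Rightarrow> _ \<Rightarrow> _ \<Rightarrow> 'a::comm_ring_1)"
proof -
  have *: "(\<Sum>k\<in>(UNIV::bool set). 1 * (if k then u else w) T i j) = u T i j + w T i j" for T i j
    by (simp add: UNIV_bool add.commute)
  have "NZ_row \<epsilon> e r0 l r (\<lambda>T i j. \<Sum>k\<in>(UNIV::bool set). 1 * (if k then u else w) T i j)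
    = (\<Sum>k\<in>(UNIV::bool set). 1 * NZ_row \<epsilon> e r0 l r (if k then u else w))"
    by (rule NZ_row_linear) simp
  then show ?thesis unfolding * by (simp add: UNIV_bool add.commute)
qed

lemma NZ_row_place:
  fixes u u1 u2 :: "'a::comm_ring_1^'n::finite"
  shows "NZ_row \<epsilon> e r0 l r (place \<epsilon> u u1 u2)
    = (NZ_G \<epsilon> e r0 l *v u + NZ_G1 \<epsilon> e r0 l *v u1 + NZ_G2 \<epsilon> e r0 l *v u2) $ r"
proof -
  have ax: "(\<Sum>k\<in>UNIV. v $ k * axis k 1 $ T) = v $ T" for v :: "'a^'n" and T
    by (simp add: axis_def if_distrib[of "\<lambda>x. _ * x"] cong: if_cong)
  have p: "place \<epsilon> u u1 u2 = (\<lambda>T i j. ((\<Sum>k\<in>UNIV. u $ k * place \<epsilon> (axis k 1) 0 0 T i j)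
      + (\<Sum>k\<in>UNIV. u1 $ k * place \<epsilon> 0 (axis k 1) 0 T i j))
      + (\<Sum>k\<in>UNIV. u2 $ k * place \<epsilon> 0 0 (axis k 1) T i j))"
    by (intro ext) (auto simp: place_def ax)
  show ?thesis
    unfolding p NZ_row_add NZ_row_linear[OF finite]
    by (simp add: matrix_vector_mult_def NZ_G_def NZ_G1_def NZ_G2_def mult.commute)
qed

text \<open>The edges that carry \<open>z'\<close> have angle \<open>c\<close> in a positive tetrahedron and \<open>b\<close> in a negative one.\<close>

lemma dihedral_eq_place:
  assumes "i \<le> 3" "j \<le> 3" "i \<noteq> j"
  shows "dihedral (a, b, c) T i j
    = place \<epsilon> a (\<chi> k. if \<epsilon> k = 1 then c $ k else b $ k) (\<chi> k. if \<epsilon> k = 1 then b $ k else c $ k) T i j"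
proof -
  have "i = 0 \<or> i = 1 \<or> i = 2 \<or> i = 3" "j = 0 \<or> j = 1 \<or> j = 2 \<or> j = 3" using assms by auto
  then show ?thesis using assms(3)
    by (cases "\<epsilon> T = 1"; elim disjE; simp add: dihedral_def place_def doubleton_eq_iff)
qed

lemma edge_sum_dihedral:
  assumes E: "E \<in> edges x"
  shows "edge_sum E (dihedral (a, b, c))
    = edge_sum E (place \<epsilon> a (\<chi> k. if \<epsilon> k = 1 then c $ k else b $ k) (\<chi> k. if \<epsilon> k = 1 then b $ k else c $ k))"
  unfolding edge_sum_def
proof (rule sum.cong[OF refl])
  fix q assume "q \<in> E"
  then have "q \<in> tet_edges" using E by (auto simp: edges_def)
  then obtain T i j where q: "q = (T, i, j)" "i < j" "j \<le> 3" by (auto simp: tet_edges_def)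
  then show "(case q of (T, i, j) \<Rightarrow> dihedral (a, b, c) T i j) = (case q of (T, i, j) \<Rightarrow>
      place \<epsilon> a (\<chi> k. if \<epsilon> k = 1 then c $ k else b $ k) (\<chi> k. if \<epsilon> k = 1 then b $ k else c $ k) T i j)"
    using dihedral_eq_place[of i j a b c T \<epsilon>] by simp
qed

lemma fourth_vertex:
  fixes v p q :: nat
  assumes "v \<le> 3" "p \<le> 3" "q \<le> 3" "v \<noteq> p" "v \<noteq> q" "p \<noteq> q"
  shows "v \<noteq> 6 - (v + p + q) \<and> 6 - (v + p + q) \<le> 3"
proof -
  have "v = 0 \<or> v = 1 \<or> v = 2 \<or> v = 3" "p = 0 \<or> p = 1 \<or> p = 2 \<or> p = 3" "q = 0 \<or> q = 1 \<or> q = 2 \<or> q = 3"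
    using assms(1-3) by auto
  then show ?thesis using assms(4-6) by (elim disjE; simp)
qed

lemma curve_sum_dihedral:
  assumes l: "normal_closed_curve x l"
  shows "curve_sum \<epsilon> l (dihedral (a, b, c))
    = curve_sum \<epsilon> l (place \<epsilon> a (\<chi> k. if \<epsilon> k = 1 then c $ k else b $ k) (\<chi> k. if \<epsilon> k = 1 then b $ k else c $ k))"
  unfolding curve_sum_def
proof (rule arg_cong[where f = sum_list], rule map_cong[OF refl])
  fix s assume "s \<in> set l"
  obtain T v p q where s: "s = (T, v, p, q)" by (metis prod_cases4)
  have "case (T, v, p, q) of (T, v, a, b) \<Rightarrow> v \<le> 3 \<and> a \<le> 3 \<and> b \<le> 3 \<and> distinct [v, a, b]"
    using l \<open>s \<in> set l\<close> unfolding normal_closed_curve_def s by blast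
  then have vpq: "v \<le> 3" "p \<le> 3" "q \<le> 3" "v \<noteq> p" "v \<noteq> q" "p \<noteq> q" by auto
  have "v \<noteq> 6 - (v + p + q)" "6 - (v + p + q) \<le> 3" using fourth_vertex[OF vpq] by auto
  then have "dihedral (a, b, c) T v (6 - (v + p + q))
    = place \<epsilon> a (\<chi> k. if \<epsilon> k = 1 then c $ k else b $ k) (\<chi> k. if \<epsilon> k = 1 then b $ k else c $ k) T v (6 - (v + p + q))"
    using vpq by (intro dihedral_eq_place) auto
  then show "(case s of (T, v, p, q) \<Rightarrow> let d = 6 - (v + p + q) in of_int (\<epsilon> T * perm_sign [v, d, p, q]) * dihedral (a, b, c) T v d)
    = (case s of (T, v, p, q) \<Rightarrow> let d = 6 - (v + p + q) in of_int (\<epsilon> T * perm_sign [v, d, p, q])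
       * place \<epsilon> a (\<chi> k. if \<epsilon> k = 1 then c $ k else b $ k) (\<chi> k. if \<epsilon> k = 1 then b $ k else c $ k) T v d)"
    by (simp add: s Let_def)
qed

text \<open>The two angle structures have the same sums around edges and along \<open>l\<close>; eliminating the angles at \<open>z'\<close>,
  which are determined by the sum \<open>pi\<close>, leaves the matrices \<open>A\<close> and \<open>B\<close>.\<close>

lemma NZ_equation_difference:
  fixes a b c a' b' c' :: "real^'n::finite"
  assumes al: "(a, b, c) \<in> angle_structures x" "(a', b', c') \<in> angle_structures x"
    and e: "e ` (- {r0}) \<subseteq> edges x" and l: "normal_closed_curve x l" and eps: "\<And>T. \<epsilon> T \<in> {1, -1}"
    and H: "HR \<epsilon> l (a', b', c') = HR \<epsilon> l (a, b, c)"
  defines "d \<equiv> a' - a" and "d2 \<equiv> (\<chi> k. if \<epsilon> k = 1 then b' $ k - b $ k else c' $ k - c $ k)"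
  shows "NZ_A \<epsilon> e r0 l *v d + NZ_B \<epsilon> e r0 l *v d2 = 0"
proof -
  let ?u1 = "\<lambda>b c. \<chi> k. if \<epsilon> k = 1 then c $ k else (b :: real^'n) $ k"
  let ?u2 = "\<lambda>b c. \<chi> k. if \<epsilon> k = 1 then b $ k else (c :: real^'n) $ k"
  let ?G = "NZ_G \<epsilon> e r0 l :: real^'n^'n" and ?G1 = "NZ_G1 \<epsilon> e r0 l :: real^'n^'n" and ?G2 = "NZ_G2 \<epsilon> e r0 l :: real^'n^'n"
  have row: "NZ_row \<epsilon> e r0 l r (place \<epsilon> a' (?u1 b' c') (?u2 b' c')) = NZ_row \<epsilon> e r0 l r (place \<epsilon> a (?u1 b c) (?u2 b c))" for r
  proof (cases "r = r0")
    case True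
    then show ?thesis using H unfolding HR_def curve_sum_dihedral[OF l] by (simp add: NZ_row_def)
  next
    case False
    then have E: "e r \<in> edges x" using e by auto
    have "edge_sum (e r) (dihedral (a', b', c')) = edge_sum (e r) (dihedral (a, b, c))"
      using al E by (simp add: angle_structures_def)
    then show ?thesis using False unfolding edge_sum_dihedral[OF E, where \<epsilon> = \<epsilon>] by (simp add: NZ_row_def)
  qed
  then have eq: "?G *v a' + ?G1 *v ?u1 b' c' + ?G2 *v ?u2 b' c' = ?G *v a + ?G1 *v ?u1 b c + ?G2 *v ?u2 b c"
    unfolding NZ_row_place by (simp add: vec_eq_iff)
  have u2: "?u2 b' c' = ?u2 b c + d2" by (simp add: vec_eq_iff d2_def)
  have u1: "?u1 b' c' = ?u1 b c - d - d2"
  proof -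
    have s: "a $ k + b $ k + c $ k = pi" "a' $ k + b' $ k + c' $ k = pi" for k
      using al by (auto simp: angle_structures_def)
    have "c' $ k = c $ k - (a' $ k - a $ k) - (b' $ k - b $ k)" "b' $ k = b $ k - (a' $ k - a $ k) - (c' $ k - c $ k)" for k
      using s[of k] by auto
    then show ?thesis by (simp add: vec_eq_iff d2_def d_def)
  qed
  have a': "a' = a + d" by (simp add: d_def)
  have neg: "?G1 *v (- w) = - (?G1 *v w)" for w by (simp add: vec_eq_iff matrix_vector_mult_def sum_negf)
  have "?G *v d + ?G1 *v (- d - d2) + ?G2 *v d2 = 0"
    using eq unfolding u1 u2 a' by (simp add: neg algebra_simps)
  then show ?thesis
    unfolding NZ_A_def NZ_B_def
    by (simp add: neg matrix_vector_mult_diff_rdistrib matrix_vector_mult_diff_distrib algebra_simps)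
qed

lemma matrix_inv_left:
  assumes "invertible A" shows "matrix_inv A ** A = mat 1"
proof -
  have "\<exists>A'. A ** A' = mat 1 \<and> A' ** A = mat 1" using assms by (simp add: invertible_def)
  from someI_ex[OF this] show ?thesis by (simp add: matrix_inv_def)
qed

text \<open>The previous lemma gives \<open>B\<^sup>-\<^sup>1 A\<close> on the difference of the angles \<open>a\<close> as minus the difference of the angles
  at \<open>z''\<close>. The diagonal term \<open>(\<epsilon> + 1) / 2\<close> of the FAMED condition turns the latter into the angles \<open>c\<close>,
  whichever of \<open>b\<close> and \<open>c\<close> is at \<open>z''\<close>.\<close>

lemma kinetic_angle_difference:
  fixes a b c a' b' c' :: "real^'n::finite"
  assumes al: "(a, b, c) \<in> angle_structures x" "(a', b', c') \<in> angle_structures x"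
    and e: "e ` (- {r0}) \<subseteq> edges x" and l: "normal_closed_curve x l" and eps: "\<And>T. \<epsilon> T \<in> {1, -1}"
    and H: "HR \<epsilon> l (a', b', c') = HR \<epsilon> l (a, b, c)" and F: "FAMED x \<epsilon> e r0 l"
  shows "(kinetic x \<epsilon> *v (a' - a)) $ k = of_int (\<epsilon> k) * (c' $ k - c $ k)"
proof -
  define d where "d = a' - a"
  define d2 where "d2 = (\<chi> k. if \<epsilon> k = 1 then b' $ k - b $ k else c' $ k - c $ k)"
  let ?A = "NZ_A \<epsilon> e r0 l :: real^'n^'n" and ?B = "NZ_B \<epsilon> e r0 l :: real^'n^'n"
  have eq: "?A *v d = - (?B *v d2)"
    using NZ_equation_difference[OF al e l eps H] unfolding d_def d2_def by (simp add: add_eq_0_iff2)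
  have "invertible ?B" using F by (simp add: FAMED_def invertible_det_nz)
  then have inv: "matrix_inv ?B ** ?B = mat 1" by (rule matrix_inv_left)
  have "(matrix_inv ?B ** ?A) *v d = matrix_inv ?B *v (?A *v d)" by (simp add: matrix_vector_mul_assoc)
  also have "\<dots> = - ((matrix_inv ?B ** ?B) *v d2)"
    unfolding eq by (simp add: matrix_vector_mul_assoc[symmetric] vec.neg)
  finally have "(matrix_inv ?B ** ?A) *v d = - d2" unfolding inv by simp
  moreover have "matrix_inv ?B ** ?A = kinetic x \<epsilon> + (1/2) *\<^sub>R (sign_matrix \<epsilon> + mat 1)"
    using F by (simp add: FAMED_def)
  ultimately have "kinetic x \<epsilon> *v d + ((1/2) *\<^sub>R (sign_matrix \<epsilon> + mat 1)) *v d = - d2"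
    by (simp add: matrix_vector_mult_add_rdistrib)
  from arg_cong[OF this, of "\<lambda>v. v $ k"]
  have "(kinetic x \<epsilon> *v d) $ k + (((1/2) *\<^sub>R (sign_matrix \<epsilon> + mat 1)) *v d) $ k = - d2 $ k"
    unfolding vector_add_component vector_uminus_component .
  moreover have "(((1/2) *\<^sub>R (sign_matrix \<epsilon> + mat 1)) *v d) $ k = (of_int (\<epsilon> k) + 1) / 2 * d $ k"
  proof -
    have "(((1/2) *\<^sub>R (sign_matrix \<epsilon> + mat 1)) *v d) $ k
      = (\<Sum>j\<in>UNIV. (if j = k then (of_int (\<epsilon> k) + 1) / 2 * d $ k else 0))"
      unfolding matrix_vector_mult_def vec_lambda_beta
      by (rule sum.cong[OF refl]) (auto simp: sign_matrix_def mat_def)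
    then show ?thesis by simp
  qed
  moreover have "a $ k + b $ k + c $ k = pi" "a' $ k + b' $ k + c' $ k = pi"
    using al by (auto simp: angle_structures_def)
  ultimately show ?thesis
    using eps[of k] unfolding d_def d2_def by (auto simp: algebra_simps)
qed

section \<open>Shifting the contour between angle structures\<close>

lemma prod_Basis_cart:
  fixes f :: "real \<Rightarrow> 'a::comm_monoid_mult" and t :: "real^'n::finite"
  shows "(\<Prod>i\<in>Basis. f (t \<bullet> i)) = (\<Prod>k\<in>UNIV. f (t $ k))"
proof -
  have B: "(Basis :: (real^'n) set) = range (\<lambda>k. axis k 1)" by (auto simp: Basis_vec_def)
  have inj: "inj (\<lambda>k. axis k 1 :: real^'n)" by (auto simp: inj_def axis_eq_axis)
  show ?thesis unfolding B prod.reindex[OF inj] by (simp add: inner_axis)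
qed

lemma integral_exp_neg_sum_abs:
  fixes m :: real assumes m: "0 < m"
  shows "integrable lborel (\<lambda>t::real^'n::finite. exp (- m * (\<Sum>k\<in>UNIV. \<bar>t $ k\<bar>)))"
    and "(\<integral>t. exp (- m * (\<Sum>k\<in>UNIV. \<bar>t $ k\<bar>)) \<partial>(lborel :: (real^'n) measure)) = (2 / m) ^ CARD('n)"
proof -
  have e: "exp (- m * (\<Sum>k\<in>UNIV. \<bar>t $ k\<bar>)) = (\<Prod>i\<in>Basis. exp (- m * \<bar>t \<bullet> i\<bar>))" for t :: "real^'n"
    unfolding prod_Basis_cart[of "\<lambda>x. exp (- m * \<bar>x\<bar>)"] by (simp add: sum_distrib_left exp_sum)
  have "(\<integral>\<^sup>+t. ennreal (exp (- m * (\<Sum>k\<in>UNIV. \<bar>t $ k\<bar>))) \<partial>(lborel :: (real^'n) measure))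
     = (\<integral>\<^sup>+t. (\<Prod>i\<in>Basis. ennreal (exp (- m * \<bar>t \<bullet> i\<bar>))) \<partial>(lborel :: (real^'n) measure))"
    unfolding e by (simp add: prod_ennreal)
  also have "\<dots> = (\<Prod>i\<in>(Basis :: (real^'n) set). \<integral>\<^sup>+x. ennreal (exp (- m * \<bar>x\<bar>)) \<partial>lborel)"
    by (rule nn_integral_lborel_prod) auto
  also have "(\<integral>\<^sup>+x. ennreal (exp (- m * \<bar>x\<bar>)) \<partial>lborel) = ennreal (2 / m)"
    using nn_integral_eq_integral[OF integral_exp_neg_abs(1)[OF m]] integral_exp_neg_abs(2)[OF m] by simp
  also have "(\<Prod>i\<in>(Basis :: (real^'n) set). ennreal (2 / m)) = ennreal ((2 / m) ^ CARD('n))"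
    using m by (simp add: ennreal_power)
  finally have N: "(\<integral>\<^sup>+t. ennreal (exp (- m * (\<Sum>k\<in>UNIV. \<bar>t $ k\<bar>))) \<partial>(lborel :: (real^'n) measure)) = ennreal ((2 / m) ^ CARD('n))" .
  have meas: "(\<lambda>t::real^'n. exp (- m * (\<Sum>k\<in>UNIV. \<bar>t $ k\<bar>))) \<in> borel_measurable borel"
    by (intro borel_measurable_continuous_onI continuous_intros)
  show "integrable lborel (\<lambda>t::real^'n. exp (- m * (\<Sum>k\<in>UNIV. \<bar>t $ k\<bar>)))"
    by (rule integrableI_nonneg) (use meas N in auto)
  show "(\<integral>t. exp (- m * (\<Sum>k\<in>UNIV. \<bar>t $ k\<bar>)) \<partial>(lborel :: (real^'n) measure)) = (2 / m) ^ CARD('n)"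
    using N m meas by (subst integral_eq_nn_integral) auto
qed

text \<open>The integrand of the partition function without the constant factor \<open>1 / |det A|\<close>.\<close>

definition state_integrand ::
  "(nat \<Rightarrow> 'n::finite \<Rightarrow> 'n + 'n) \<Rightarrow> ('n \<Rightarrow> int) \<Rightarrow> real \<Rightarrow> real^'n \<Rightarrow> real^'n \<Rightarrow> real^'n \<Rightarrow> complex" where
  "state_integrand x \<epsilon> b a c t =
     exp (2 * \<i> * of_real pi * of_real (t \<bullet> ((- (1/2) *\<^sub>R kinetic x \<epsilon>) *v t))) *
     (\<Prod>k\<in>UNIV. exp (of_real (1 / sqrt (hbar b) * c $ k * of_int (\<epsilon> k) * t $ k)) /
        qdilog b (of_int (\<epsilon> k) * (of_real (t $ k) - \<i> / of_real (2 * pi * sqrt (hbar b)) * of_real (pi - a $ k))) powi \<epsilon> k)"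

lemma cmod_partition_function:
  "cmod (partition_function x \<epsilon> b (a, \<beta>, c)) = cmod (\<integral>t. state_integrand x \<epsilon> b a c t \<partial>lborel) / \<bar>det (calA x)\<bar>"
proof -
  have "partition_function x \<epsilon> b (a, \<beta>, c) = (\<integral>t. state_integrand x \<epsilon> b a c t / of_real \<bar>det (calA x)\<bar> \<partial>lborel)"
    by (simp add: partition_function_def state_integrand_def Let_def)
  then show ?thesis by (simp add: norm_divide)
qed

text \<open>The same integrand as a holomorphic function of \<open>u\<close> in a tube around a real subspace; the angles enter
  only through \<open>\<kappa>\<close>.\<close>

definition tube_integrand ::
  "real^'n::finite^'n \<Rightarrow> ('n \<Rightarrow> int) \<Rightarrow> real \<Rightarrow> ('n \<Rightarrow> real) \<Rightarrow> ('n \<Rightarrow> complex) \<Rightarrow> complex" where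
  "tube_integrand Q \<epsilon> b \<kappa> u =
     exp (2 * \<i> * of_real pi * (\<Sum>j\<in>UNIV. \<Sum>k\<in>UNIV. of_real (Q $ j $ k) * (u j * u k)) + (\<Sum>k\<in>UNIV. of_real (\<kappa> k) * u k)) *
     (\<Prod>k\<in>UNIV. 1 / qdilog b (of_int (\<epsilon> k) * u k) powi \<epsilon> k)"

lemma quadratic_form_shift:
  fixes u :: "'n::finite \<Rightarrow> complex" and Q :: "real^'n^'n" and y :: "'n \<Rightarrow> real"
  assumes sym: "\<And>j k. Q $ j $ k = Q $ k $ j"
  shows "(\<Sum>j\<in>UNIV. \<Sum>k\<in>UNIV. of_real (Q $ j $ k) * ((u j + \<i> * of_real (y j)) * (u k + \<i> * of_real (y k))))
    = (\<Sum>j\<in>UNIV. \<Sum>k\<in>UNIV. of_real (Q $ j $ k) * (u j * u k))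
      + 2 * \<i> * (\<Sum>k\<in>UNIV. of_real (\<Sum>j\<in>UNIV. Q $ k $ j * y j) * u k)
      - of_real (\<Sum>j\<in>UNIV. \<Sum>k\<in>UNIV. Q $ j $ k * (y j * y k))"
proof -
  let ?S = "\<Sum>j\<in>UNIV. \<Sum>k\<in>UNIV. of_real (Q $ j $ k) * (of_real (y j) * u k)"
  have eq: "of_real (Q $ j $ k) * ((u j + \<i> * of_real (y j)) * (u k + \<i> * of_real (y k)))
    = of_real (Q $ j $ k) * (u j * u k) + \<i> * (of_real (Q $ j $ k) * (of_real (y j) * u k))
     + \<i> * (of_real (Q $ k $ j) * (of_real (y k) * u j)) - of_real (Q $ j $ k) * of_real (y j * y k)" for j k
    using sym[of j k] by (simp add: algebra_simps)
  have swap: "(\<Sum>j\<in>UNIV. \<Sum>k\<in>UNIV. of_real (Q $ k $ j) * (of_real (y k) * u j)) = ?S"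
    by (rule sum.swap)
  have S: "?S = (\<Sum>k\<in>UNIV. of_real (\<Sum>j\<in>UNIV. Q $ k $ j * y j) * u k)"
  proof -
    have "?S = (\<Sum>k\<in>UNIV. \<Sum>j\<in>UNIV. of_real (Q $ j $ k) * (of_real (y j) * u k))" by (rule sum.swap)
    also have "\<dots> = (\<Sum>k\<in>UNIV. of_real (\<Sum>j\<in>UNIV. Q $ k $ j * y j) * u k)"
      by (rule sum.cong[OF refl]) (simp add: sum_distrib_right sym mult.assoc)
    finally show ?thesis .
  qed
  show ?thesis
    unfolding eq sum_subtractf sum.distrib sum_distrib_left[symmetric] swap S
    by (simp add: algebra_simps)
qed

text \<open>Completing the substitution \<open>t = u + i y\<close> in the exponent: the cross terms of the quadratic form join the
  linear part, and the constants are purely imaginary.\<close>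

lemma state_integrand_eq_tube_integrand:
  fixes a c :: "real^'n::finite"
  assumes h: "h = sqrt (hbar b)" "h > 0"
    and y: "\<And>k. y k = (pi - a $ k) / (2 * pi * h)"
    and Q: "Q = - (1/2) *\<^sub>R kinetic x \<epsilon>"
    and lam: "\<And>k. \<kappa> k = - 4 * pi * (\<Sum>j\<in>UNIV. Q $ k $ j * y j) + 1 / h * c $ k * of_int (\<epsilon> k)"
  shows "\<exists>\<omega>::real. \<forall>t. state_integrand x \<epsilon> b a c t = cis \<omega> * tube_integrand Q \<epsilon> b \<kappa> (\<lambda>k. of_real (t $ k) - \<i> * of_real (y k))"
proof (intro exI allI)
  let ?\<omega> = "- 2 * pi * (\<Sum>j\<in>UNIV. \<Sum>k\<in>UNIV. Q $ j $ k * (y j * y k)) + (\<Sum>k\<in>UNIV. 1 / h * c $ k * of_int (\<epsilon> k) * y k)"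
  fix t :: "real^'n"
  define u where "u = (\<lambda>k. complex_of_real (t $ k) - \<i> * of_real (y k))"
  have tu: "complex_of_real (t $ k) = u k + \<i> * of_real (y k)" for k by (simp add: u_def)
  have symQ: "Q $ j $ k = Q $ k $ j" for j k
    unfolding Q kinetic_def Let_def by (simp add: transpose_def add.commute)
  have arg: "\<i> / of_real (2 * pi * sqrt (hbar b)) * of_real (pi - a $ k) = \<i> * of_real (y k)" for k
    unfolding y h(1)[symmetric] by simp
  have "complex_of_real (t \<bullet> (Q *v t)) = (\<Sum>j\<in>UNIV. \<Sum>k\<in>UNIV. of_real (Q $ j $ k) * (of_real (t $ j) * of_real (t $ k)))"
    by (simp add: inner_vec_def matrix_vector_mult_def sum_distrib_left mult_ac)
  also have "\<dots> = (\<Sum>j\<in>UNIV. \<Sum>k\<in>UNIV. of_real (Q $ j $ k) * (u j * u k))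
      + 2 * \<i> * (\<Sum>k\<in>UNIV. of_real (\<Sum>j\<in>UNIV. Q $ k $ j * y j) * u k)
      - of_real (\<Sum>j\<in>UNIV. \<Sum>k\<in>UNIV. Q $ j $ k * (y j * y k))"
    unfolding tu by (rule quadratic_form_shift[OF symQ])
  finally have quad: "complex_of_real (t \<bullet> (Q *v t)) = \<dots>" .
  have lin: "(\<Sum>k\<in>UNIV. complex_of_real (1 / sqrt (hbar b) * c $ k * of_int (\<epsilon> k) * t $ k))
    = (\<Sum>k\<in>UNIV. of_real (1 / h * c $ k * of_int (\<epsilon> k)) * u k) + \<i> * of_real (\<Sum>k\<in>UNIV. 1 / h * c $ k * of_int (\<epsilon> k) * y k)"
  proof -
    have "complex_of_real (r * t $ k) = of_real r * u k + \<i> * of_real (r * y k)" for r k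
      by (simp add: u_def algebra_simps)
    then show ?thesis unfolding h(1)[symmetric] of_real_sum sum_distrib_left sum.distrib[symmetric] by (simp only:)
  qed
  have lamsum: "(\<Sum>k\<in>UNIV. of_real (\<kappa> k) * u k)
    = - 4 * of_real pi * (\<Sum>k\<in>UNIV. of_real (\<Sum>j\<in>UNIV. Q $ k $ j * y j) * u k) + (\<Sum>k\<in>UNIV. of_real (1 / h * c $ k * of_int (\<epsilon> k)) * u k)"
  proof -
    have t: "complex_of_real (- 4 * pi * r) * w = - 4 * of_real pi * (of_real r * w)" for r w by simp
    show ?thesis unfolding lam of_real_add distrib_right sum.distrib t sum_distrib_left[symmetric] ..
  qed
  have ex: "2 * \<i> * of_real pi * of_real (t \<bullet> (Q *v t)) + (\<Sum>k\<in>UNIV. complex_of_real (1 / sqrt (hbar b) * c $ k * of_int (\<epsilon> k) * t $ k))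
    = \<i> * of_real ?\<omega> + (2 * \<i> * of_real pi * (\<Sum>j\<in>UNIV. \<Sum>k\<in>UNIV. of_real (Q $ j $ k) * (u j * u k)) + (\<Sum>k\<in>UNIV. of_real (\<kappa> k) * u k))"
  proof -
    have "2 * \<i> * of_real pi * (P + 2 * \<i> * S - of_real W) + (L + \<i> * of_real Y)
      = \<i> * of_real (- 2 * pi * W + Y) + (2 * \<i> * of_real pi * P + (- 4 * of_real pi * S + L))"
      for P S L :: complex and W Y :: real by (simp add: algebra_simps)
    then show ?thesis unfolding quad lin lamsum .
  qed
  have "state_integrand x \<epsilon> b a c t
    = exp (2 * \<i> * of_real pi * of_real (t \<bullet> (Q *v t)) + (\<Sum>k\<in>UNIV. complex_of_real (1 / sqrt (hbar b) * c $ k * of_int (\<epsilon> k) * t $ k)))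
     * (\<Prod>k\<in>UNIV. 1 / qdilog b (of_int (\<epsilon> k) * u k) powi \<epsilon> k)"
    unfolding state_integrand_def Q[symmetric] arg u_def[symmetric, THEN fun_cong, simplified] 
    by (simp add: u_def exp_add exp_sum prod_dividef)
  also have "\<dots> = cis ?\<omega> * tube_integrand Q \<epsilon> b \<kappa> u"
    unfolding ex exp_add tube_integrand_def cis_conv_exp by (simp add: mult.assoc exp_add)
  finally show "state_integrand x \<epsilon> b a c t = cis ?\<omega> * tube_integrand Q \<epsilon> b \<kappa> (\<lambda>k. of_real (t $ k) - \<i> * of_real (y k))"
    unfolding u_def .
qed

lemma holomorphic_on_signed_qdilog:
  assumes b: "0 < b" "b \<le> 1" and e: "e \<in> {1, -1 :: int}"
  shows "(\<lambda>z. 1 / qdilog b (of_int e * z) powi e) holomorphic_on {z. \<bar>2 * pi * b * Im z\<bar> < pi}"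
proof (cases "e = 1")
  case True
  then show ?thesis using holomorphic_on_divide[OF holomorphic_on_const holomorphic_on_qdilog[OF b] qdilog_nonzero, of 1]
    by simp
next
  case False
  then have e: "e = -1" using e by simp
  have "(qdilog b \<circ> uminus) holomorphic_on {z. \<bar>2 * pi * b * Im z\<bar> < pi}"
    by (rule holomorphic_on_compose_gen[OF _ holomorphic_on_qdilog[OF b]]) (auto intro!: holomorphic_intros)
  then show ?thesis by (simp add: e comp_def power_int_minus divide_inverse)
qed

lemma holomorphic_on_tube_integrand:
  assumes b: "0 < b" "b \<le> 1" and e: "\<And>k. \<epsilon> k \<in> {1, -1}"
    and u: "\<And>k. (\<lambda>z. u z k) holomorphic_on S" "\<And>z k. z \<in> S \<Longrightarrow> \<bar>2 * pi * b * Im (u z k)\<bar> < pi"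
  shows "(\<lambda>z. tube_integrand Q \<epsilon> b \<kappa> (u z)) holomorphic_on S"
proof -
  have "((\<lambda>z. 1 / qdilog b (of_int (\<epsilon> k) * z) powi \<epsilon> k) \<circ> (\<lambda>z. u z k)) holomorphic_on S" for k
    by (rule holomorphic_on_compose_gen[OF u(1) holomorphic_on_signed_qdilog[OF b e]]) (use u(2) in auto)
  then have f: "(\<lambda>z. 1 / qdilog b (of_int (\<epsilon> k) * u z k) powi \<epsilon> k) holomorphic_on S" for k
    by (simp add: comp_def)
  show ?thesis unfolding tube_integrand_def
  proof (rule holomorphic_on_mult)
    show "(\<lambda>z. \<Prod>k\<in>UNIV. 1 / qdilog b (of_int (\<epsilon> k) * u z k) powi \<epsilon> k) holomorphic_on S"
      by (intro holomorphic_on_prod f)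
  qed (intro holomorphic_intros u)
qed

lemma continuous_on_tube_integrand:
  assumes b: "0 < b" "b \<le> 1" and e: "\<And>k. \<epsilon> k \<in> {1, -1}"
    and u: "\<And>k. continuous_on S (\<lambda>z. u z k)" "\<And>z k. z \<in> S \<Longrightarrow> \<bar>2 * pi * b * Im (u z k)\<bar> < pi"
  shows "continuous_on S (\<lambda>z. tube_integrand Q \<epsilon> b \<kappa> (u z))"
proof -
  have f: "continuous_on S (\<lambda>z. 1 / qdilog b (of_int (\<epsilon> k) * u z k) powi \<epsilon> k)" for k
    by (rule continuous_on_compose2[OF holomorphic_on_imp_continuous_on[OF holomorphic_on_signed_qdilog[OF b e]] u(1)])
      (use u(2) in auto)
  show ?thesis unfolding tube_integrand_def
  proof (rule continuous_on_mult)
    show "continuous_on S (\<lambda>z. \<Prod>k\<in>UNIV. 1 / qdilog b (of_int (\<epsilon> k) * u z k) powi \<epsilon> k)"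
      by (intro continuous_on_prod f)
  qed (intro continuous_intros u)
qed

lemma cmod_state_integrand_le:
  fixes a \<beta> c :: "real^'n::finite"
  assumes b: "0 < b" "b\<^sup>2 \<le> 1/8" and e: "\<And>k. \<epsilon> k \<in> {1, -1}"
    and pos: "\<And>k. 0 < a $ k" "\<And>k. \<delta> \<le> \<beta> $ k" "\<And>k. \<delta> \<le> c $ k" "\<And>k. a $ k + \<beta> $ k + c $ k = pi"
    and d: "0 < \<delta>" and a0: "\<And>k. 0 < pi - (1 + b\<^sup>2) * (pi - a $ k)"
  shows "cmod (state_integrand x \<epsilon> b a c t)
    \<le> exp (\<Sum>k\<in>UNIV. tetrahedron_rate b (a $ k) (\<beta> $ k) (c $ k))
      * exp (- (pi * b * \<delta>) * (\<Sum>k\<in>UNIV. \<bar>t $ k\<bar>))"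
proof -
  let ?K = "\<lambda>k. tetrahedron_rate b (a $ k) (\<beta> $ k) (c $ k)"
  have f: "cmod (exp (of_real (1 / sqrt (hbar b) * c $ k * of_int (\<epsilon> k) * t $ k)) /
        qdilog b (of_int (\<epsilon> k) * (of_real (t $ k) - \<i> / of_real (2 * pi * sqrt (hbar b)) * of_real (pi - a $ k))) powi \<epsilon> k)
      \<le> exp (?K k - 2 * pi * b * (\<delta>/2) * \<bar>t $ k\<bar>)" for k
  proof (rule signed_tetrahedron_factor_bound[OF b _ _ _ _ _ _ _ e a0])
    show "0 < a $ k" "a $ k + \<beta> $ k + c $ k = pi" using pos by auto
    show "0 < \<beta> $ k" "0 < c $ k" "\<delta> / 2 < \<beta> $ k" "\<delta> / 2 < c $ k" "0 < \<delta> / 2"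
      using pos(2)[of k] pos(3)[of k] d by auto
  qed
  have "cmod (exp (2 * \<i> * of_real pi * of_real (t \<bullet> ((- (1/2) *\<^sub>R kinetic x \<epsilon>) *v t)))) = 1"
    by (simp add: norm_exp_eq_Re)
  then have "cmod (state_integrand x \<epsilon> b a c t)
    = (\<Prod>k\<in>UNIV. cmod (exp (of_real (1 / sqrt (hbar b) * c $ k * of_int (\<epsilon> k) * t $ k)) /
        qdilog b (of_int (\<epsilon> k) * (of_real (t $ k) - \<i> / of_real (2 * pi * sqrt (hbar b)) * of_real (pi - a $ k))) powi \<epsilon> k))"
    unfolding state_integrand_def norm_mult prod_norm[symmetric] by simp
  also have "\<dots> \<le> (\<Prod>k\<in>UNIV. exp (?K k - 2 * pi * b * (\<delta>/2) * \<bar>t $ k\<bar>))"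
    by (intro prod_mono conjI norm_ge_zero f)
  also have "\<dots> = exp (\<Sum>k\<in>UNIV. ?K k - 2 * pi * b * (\<delta>/2) * \<bar>t $ k\<bar>)" by (simp add: exp_sum)
  also have "(\<Sum>k\<in>UNIV. ?K k - 2 * pi * b * (\<delta>/2) * \<bar>t $ k\<bar>) = (\<Sum>k\<in>UNIV. ?K k) + (- (pi * b * \<delta>) * (\<Sum>k\<in>UNIV. \<bar>t $ k\<bar>))"
    unfolding sum_subtractf by (simp add: sum_distrib_left sum_negf[symmetric] mult.assoc)
  finally show ?thesis by (simp only: exp_add)
qed

text \<open>The segment between two angle structures may be prolonged a little at both ends, so that the contours
  to be compared lie inside an open family.\<close>

lemma affine_angle_bound:
  fixes p p' s \<delta> :: real
  assumes p: "2 * \<delta> \<le> p" "p \<le> pi" "2 * \<delta> \<le> p'" "p' \<le> pi" and d: "0 < \<delta>"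
    and s: "- (\<delta> / pi) < s" "s < 1 + \<delta> / pi"
  shows "\<delta> \<le> p + s * (p' - p)"
proof -
  have pp: "\<bar>p' - p\<bar> \<le> pi" using p d by linarith
  have small: "- \<delta> \<le> r * (p' - p)" if "\<bar>r\<bar> \<le> \<delta> / pi" for r
  proof -
    have "\<bar>r * (p' - p)\<bar> \<le> \<delta> / pi * pi" unfolding abs_mult using that pp d by (intro mult_mono) auto
    then show ?thesis by simp
  qed
  consider "s < 0" | "0 \<le> s" "s \<le> 1" | "1 < s" by linarith
  then show ?thesis
  proof cases
    case 1
    then show ?thesis using small[of s] s p by simp
  next
    case 2
    have "(1 - s) * (2 * \<delta>) + s * (2 * \<delta>) \<le> (1 - s) * p + s * p'"
      using 2 p by (intro add_mono mult_left_mono) auto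
    then show ?thesis using d by (simp add: algebra_simps)
  next
    case 3
    have "p + s * (p' - p) = p' + (s - 1) * (p' - p)" by (simp add: algebra_simps)
    then show ?thesis using small[of "s - 1"] s p 3 by simp
  qed
qed

text \<open>All angle structures on the segment have the same \<open>\<kappa>\<close>, so they give one holomorphic function on parallel
  contours. Moving along the segment is a shift of the parameter \<open>z\<close> in the imaginary direction \<open>s\<close>, and a
  shift in the real direction translates \<open>t\<close> by a multiple of \<open>dv\<close>.\<close>

lemma cmod_integral_state_integrand_eq:
  fixes a \<beta> c a' \<beta>' c' :: "real^'n::finite"
  assumes b: "0 < b" "b\<^sup>2 \<le> 1/8" and e: "\<And>k. \<epsilon> k \<in> {1, -1}" and d: "0 < \<delta>"
    and ge: "\<And>k. 2 * \<delta> \<le> a $ k" "\<And>k. 2 * \<delta> \<le> \<beta> $ k" "\<And>k. 2 * \<delta> \<le> c $ k"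
      "\<And>k. 2 * \<delta> \<le> a' $ k" "\<And>k. 2 * \<delta> \<le> \<beta>' $ k" "\<And>k. 2 * \<delta> \<le> c' $ k"
    and sums: "\<And>k. a $ k + \<beta> $ k + c $ k = pi" "\<And>k. a' $ k + \<beta>' $ k + c' $ k = pi"
    and b\<delta>: "(1 + b\<^sup>2) * (pi - \<delta>) < pi"
    and K: "\<And>k. (kinetic x \<epsilon> *v (a' - a)) $ k = of_int (\<epsilon> k) * (c' $ k - c $ k)"
  shows "cmod (\<integral>t. state_integrand x \<epsilon> b a c t \<partial>lborel) = cmod (\<integral>t. state_integrand x \<epsilon> b a' c' t \<partial>lborel)"
proof -
  define h where "h = sqrt (hbar b)"
  have hb: "h = b / (1 + b\<^sup>2)" unfolding h_def by (rule sqrt_hbar[OF b(1)])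
  have g0: "0 < 1 + b\<^sup>2" by (simp add: add_pos_nonneg)
  have h0: "h > 0" unfolding hb using b g0 by simp
  have b1: "b \<le> 1" using power2_le_imp_le[of b 1] b by simp
  \<comment> \<open>How far the segment of angle structures is prolonged beyond its ends.\<close>
  define \<eta> where "\<eta> = \<delta> / pi"
  have eta: "0 < \<eta>" using d by (simp add: \<eta>_def)
  define A where "A s = a + s *\<^sub>R (a' - a)" for s
  define B where "B s = \<beta> + s *\<^sub>R (\<beta>' - \<beta>)" for s
  define C where "C s = c + s *\<^sub>R (c' - c)" for s
  define y where "y s k = (pi - A s $ k) / (2 * pi * h)" for s k
  define D where "D k = (a' $ k - a $ k) / (2 * pi * h)" for k
  define Q where "Q = - (1/2) *\<^sub>R kinetic x \<epsilon>"
  define \<kappa> where "\<kappa> k = - 4 * pi * (\<Sum>j\<in>UNIV. Q $ k $ j * y 0 j) + 1 / h * c $ k * of_int (\<epsilon> k)" for k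
  have y_lin: "y s k = y 0 k - s * D k" for s k
    by (simp add: y_def D_def A_def diff_divide_distrib algebra_simps add_divide_distrib)
  \<comment> \<open>Along the segment the change of \<open>Q y\<close> compensates that of \<open>c\<close>, by the hypothesis on \<open>kinetic\<close>.\<close>
  have lam: "\<kappa> k = - 4 * pi * (\<Sum>j\<in>UNIV. Q $ k $ j * y s j) + 1 / h * C s $ k * of_int (\<epsilon> k)" for s k
  proof -
    have "(\<Sum>j\<in>UNIV. Q $ k $ j * D j) = (\<Sum>j\<in>UNIV. kinetic x \<epsilon> $ k $ j * (a' $ j - a $ j)) * (- 1 / (4 * pi * h))"
      unfolding sum_distrib_right using h0 by (intro sum.cong refl) (simp add: Q_def D_def field_simps)
    also have "(\<Sum>j\<in>UNIV. kinetic x \<epsilon> $ k $ j * (a' $ j - a $ j)) = of_int (\<epsilon> k) * (c' $ k - c $ k)"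
      using K[of k] by (simp add: matrix_vector_mult_def)
    finally have QD: "(\<Sum>j\<in>UNIV. Q $ k $ j * D j) = of_int (\<epsilon> k) * (c' $ k - c $ k) * (- 1 / (4 * pi * h))" .
    have "(\<Sum>j\<in>UNIV. Q $ k $ j * y s j) = (\<Sum>j\<in>UNIV. Q $ k $ j * y 0 j) - s * (\<Sum>j\<in>UNIV. Q $ k $ j * D j)"
      unfolding y_lin[of s] by (simp add: right_diff_distrib sum_subtractf sum_distrib_left mult.left_commute)
    then show ?thesis unfolding \<kappa>_def QD using h0 by (simp add: C_def field_simps)
  qed
  have angle: "\<delta> \<le> A s $ k" "\<delta> \<le> B s $ k" "\<delta> \<le> C s $ k" "A s $ k + B s $ k + C s $ k = pi"
    if s: "- \<eta> < s" "s < 1 + \<eta>" for s k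
  proof -
    have le: "a $ k \<le> pi" "\<beta> $ k \<le> pi" "c $ k \<le> pi" "a' $ k \<le> pi" "\<beta>' $ k \<le> pi" "c' $ k \<le> pi"
      using ge[of k] sums[of k] d by linarith+
    show "\<delta> \<le> A s $ k" "\<delta> \<le> B s $ k" "\<delta> \<le> C s $ k"
      unfolding A_def B_def C_def vector_add_component vector_scaleR_component vector_minus_component real_scaleR_def
      using s[unfolded \<eta>_def] le ge[of k] d by - (intro affine_angle_bound; assumption)+
    have "A s $ k + B s $ k + C s $ k
      = (a $ k + \<beta> $ k + c $ k) + s * ((a' $ k + \<beta>' $ k + c' $ k) - (a $ k + \<beta> $ k + c $ k))"
      by (simp add: A_def B_def C_def algebra_simps)
    then show "A s $ k + B s $ k + C s $ k = pi" unfolding sums by simp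
  qed
  have strip: "0 < 2 * pi * b * y s k" "2 * pi * b * y s k < pi" "pi - (1 + b\<^sup>2) * (pi - \<delta>) \<le> pi - (1 + b\<^sup>2) * (pi - A s $ k)"
    if s: "- \<eta> < s" "s < 1 + \<eta>" for s k
  proof -
    have eq: "2 * pi * b * y s k = (1 + b\<^sup>2) * (pi - A s $ k)"
      unfolding y_def hb using b g0 by (simp add: field_simps)
    have "(1 + b\<^sup>2) * (pi - A s $ k) \<le> (1 + b\<^sup>2) * (pi - \<delta>)"
      using angle(1)[OF s, of k] g0 by (intro mult_left_mono) auto
    then show "2 * pi * b * y s k < pi" "pi - (1 + b\<^sup>2) * (pi - \<delta>) \<le> pi - (1 + b\<^sup>2) * (pi - A s $ k)"
      using b\<delta> eq by auto
    have "0 < pi - A s $ k" using angle[OF s, of k] d by linarith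
    then show "0 < 2 * pi * b * y s k" unfolding eq using g0 by simp
  qed
  define F where "F t z = tube_integrand Q \<epsilon> b \<kappa> (\<lambda>k. of_real (t $ k) - \<i> * of_real (y 0 k) + z * of_real (D k))" for t :: "real^'n" and z
  define dv where "dv = (\<chi> k. D k)"
  let ?R = "{z. \<bar>Re z\<bar> < 1 \<and> - \<eta> < Im z \<and> Im z < 1 + \<eta>}"
  have arg: "of_real (t $ k) - \<i> * of_real (y 0 k) + z * of_real (D k)
    = of_real ((Re z *\<^sub>R dv + t) $ k) - \<i> * of_real (y (Im z) k)" for t z k
    unfolding y_lin[of "Im z"] by (simp add: complex_eq_iff dv_def)
  have tube: "\<exists>\<omega>::real. \<forall>t. state_integrand x \<epsilon> b (A s) (C s) t
      = cis \<omega> * tube_integrand Q \<epsilon> b \<kappa> (\<lambda>k. of_real (t $ k) - \<i> * of_real (y s k))" for s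
    by (rule state_integrand_eq_tube_integrand[OF h_def h0 _ Q_def lam[of _ s]]) (simp add: y_def)
  have cmodF: "cmod (F t z) = cmod (state_integrand x \<epsilon> b (A (Im z)) (C (Im z)) (Re z *\<^sub>R dv + t))" for t z
  proof -
    obtain \<omega> where "\<forall>t. state_integrand x \<epsilon> b (A (Im z)) (C (Im z)) t
      = cis \<omega> * tube_integrand Q \<epsilon> b \<kappa> (\<lambda>k. of_real (t $ k) - \<i> * of_real (y (Im z) k))"
      using tube by blast
    then show ?thesis unfolding F_def arg by (simp add: norm_mult)
  qed
  have inner: "\<bar>2 * pi * b * Im (of_real (t $ k) - \<i> * of_real (y 0 k) + z * of_real (D k))\<bar> < pi"
    if "z \<in> ?R" for t :: "real^'n" and k z
    unfolding arg using strip[of "Im z" k] that by auto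
  define a0 where "a0 = pi - (1 + b\<^sup>2) * (pi - \<delta>)"
  have a0: "0 < a0" using b\<delta> by (simp add: a0_def)
  define m where "m = pi * b * \<delta>"
  have m: "0 < m" using b d by (simp add: m_def)
  define G where "G = exp (\<Sum>k\<in>(UNIV::'n set). 30 / a0) * exp (m * (\<Sum>k\<in>UNIV. \<bar>D k\<bar>))"
  have N: "1 \<le> 1 / (2 * pi * b\<^sup>2)"
  proof -
    have "2 * pi * b\<^sup>2 \<le> 2 * 4 * (1/8)" using b pi_less_4 by (intro mult_mono) auto
    then show ?thesis using b by simp
  qed
  have "(\<integral>t. F t (Complex 0 0) \<partial>lborel) = (\<integral>t. F t (Complex 0 1) \<partial>lborel)"
  proof (rule integral_shift_imaginary[where ?s0.0 = "-\<eta>" and ?s1.0 = "1 + \<eta>" and d = dv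
        and g = "\<lambda>t. G * exp (- m * (\<Sum>k\<in>UNIV. \<bar>t $ k\<bar>))"])
    show "F t holomorphic_on ?R" for t
      unfolding F_def
      by (rule holomorphic_on_tube_integrand[OF b(1) b1 e _ inner]) (auto intro!: holomorphic_intros)
    show "F t (z + of_real \<sigma>) = F (\<sigma> *\<^sub>R dv + t) z" for t z \<sigma>
      unfolding F_def by (rule arg_cong[where f = "tube_integrand Q \<epsilon> b \<kappa>"], rule ext)
        (simp add: dv_def algebra_simps)
    show "(\<lambda>t. F t z) \<in> borel_measurable borel" if "z \<in> ?R" for z
      unfolding F_def
      by (intro borel_measurable_continuous_onI continuous_on_tube_integrand[OF b(1) b1 e _ inner[OF that]] continuous_intros)
    show "cmod (F t z) \<le> G * exp (- m * (\<Sum>k\<in>UNIV. \<bar>t $ k\<bar>))" if z: "z \<in> ?R" for t z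
    proof -
      let ?s = "Im z" and ?t = "Re z *\<^sub>R dv + t"
      have s: "- \<eta> < ?s" "?s < 1 + \<eta>" using z by auto
      let ?a = "\<lambda>k. pi - (1 + b\<^sup>2) * (pi - A ?s $ k)"
      have pa: "0 < ?a k" "a0 \<le> ?a k" for k using strip(3)[OF s, of k] a0 by (auto simp: a0_def)
      have "cmod (F t z) \<le> exp (\<Sum>k\<in>UNIV. tetrahedron_rate b (A ?s $ k) (B ?s $ k) (C ?s $ k))
        * exp (- (pi * b * \<delta>) * (\<Sum>k\<in>UNIV. \<bar>?t $ k\<bar>))"
        unfolding cmodF
        by (rule cmod_state_integrand_le[OF b e _ angle(2)[OF s] angle(3)[OF s] angle(4)[OF s] d pa(1)])
          (use angle(1)[OF s] d in \<open>auto intro: less_le_trans\<close>)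
      also have "\<dots> \<le> exp (\<Sum>k\<in>(UNIV::'n set). 30 / a0) * exp (m * (\<Sum>k\<in>UNIV. \<bar>D k\<bar>) + - m * (\<Sum>k\<in>UNIV. \<bar>t $ k\<bar>))"
      proof (intro mult_mono)
        have "tetrahedron_rate b (A ?s $ k) (B ?s $ k) (C ?s $ k) \<le> 30 / a0" for k
        proof -
          have "0 \<le> ideal_volume (?a k) ((1 + b\<^sup>2) * B ?s $ k) ((1 + b\<^sup>2) * C ?s $ k)"
          proof (rule ideal_volume_nonneg[OF pa(1)])
            show "0 < (1 + b\<^sup>2) * B ?s $ k" "0 < (1 + b\<^sup>2) * C ?s $ k"
              using angle(2,3)[OF s, of k] d g0 by (auto intro!: mult_pos_pos)
            have "pi - A ?s $ k = B ?s $ k + C ?s $ k" using angle(4)[OF s, of k] by linarith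
            then show "?a k + (1 + b\<^sup>2) * B ?s $ k + (1 + b\<^sup>2) * C ?s $ k = pi" by (simp add: distrib_left)
          qed
          then have "0 \<le> (1 / (2 * pi * b\<^sup>2) - 1) * ideal_volume (?a k) ((1 + b\<^sup>2) * B ?s $ k) ((1 + b\<^sup>2) * C ?s $ k)"
            using N by (intro mult_nonneg_nonneg) auto
          moreover have "30 / ?a k \<le> 30 / a0" using pa a0 by (intro divide_left_mono mult_pos_pos) auto
          ultimately show ?thesis unfolding tetrahedron_rate_def by linarith
        qed
        then show "exp (\<Sum>k\<in>UNIV. tetrahedron_rate b (A ?s $ k) (B ?s $ k) (C ?s $ k))
          \<le> exp (\<Sum>k\<in>(UNIV::'n set). 30 / a0)"
          by (subst exp_le_cancel_iff) (rule sum_mono)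
        have "\<bar>t $ k\<bar> - \<bar>D k\<bar> \<le> \<bar>?t $ k\<bar>" for k
        proof -
          have "\<bar>Re z * D k\<bar> \<le> 1 * \<bar>D k\<bar>" unfolding abs_mult using z by (intro mult_right_mono) auto
          then show ?thesis by (simp add: dv_def)
        qed
        then have "(\<Sum>k\<in>UNIV. \<bar>t $ k\<bar> - \<bar>D k\<bar>) \<le> (\<Sum>k\<in>UNIV. \<bar>?t $ k\<bar>)" by (rule sum_mono)
        then have "m * ((\<Sum>k\<in>UNIV. \<bar>t $ k\<bar>) - (\<Sum>k\<in>UNIV. \<bar>D k\<bar>)) \<le> m * (\<Sum>k\<in>UNIV. \<bar>?t $ k\<bar>)"
          using m by (intro mult_left_mono) (auto simp: sum_subtractf)
        then show "exp (- (pi * b * \<delta>) * (\<Sum>k\<in>UNIV. \<bar>?t $ k\<bar>))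
          \<le> exp (m * (\<Sum>k\<in>UNIV. \<bar>D k\<bar>) + - m * (\<Sum>k\<in>UNIV. \<bar>t $ k\<bar>))"
          unfolding m_def[symmetric] by (subst exp_le_cancel_iff) (simp add: right_diff_distrib)
      qed auto
      also have "\<dots> = G * exp (- m * (\<Sum>k\<in>UNIV. \<bar>t $ k\<bar>))"
        unfolding G_def exp_add by (simp only: mult.assoc)
      finally show ?thesis .
    qed
    show "integrable lborel (\<lambda>t::real^'n. G * exp (- m * (\<Sum>k\<in>UNIV. \<bar>t $ k\<bar>)))"
      by (intro integrable_mult_right integral_exp_neg_sum_abs(1) m)
  qed (use eta in auto)
  moreover have "cmod (\<integral>t. F t (Complex 0 s) \<partial>lborel) = cmod (\<integral>t. state_integrand x \<epsilon> b (A s) (C s) t \<partial>lborel)" for s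
  proof -
    obtain \<omega> where w: "\<forall>t. state_integrand x \<epsilon> b (A s) (C s) t
      = cis \<omega> * tube_integrand Q \<epsilon> b \<kappa> (\<lambda>k. of_real (t $ k) - \<i> * of_real (y s k))"
      using tube by blast
    have "F t (Complex 0 s) = tube_integrand Q \<epsilon> b \<kappa> (\<lambda>k. of_real (t $ k) - \<i> * of_real (y s k))" for t
      unfolding F_def arg by simp
    then have "state_integrand x \<epsilon> b (A s) (C s) t = cis \<omega> * F t (Complex 0 s)" for t using w by simp
    then have "(\<integral>t. state_integrand x \<epsilon> b (A s) (C s) t \<partial>lborel) = cis \<omega> * (\<integral>t. F t (Complex 0 s) \<partial>lborel)"
      by (simp only: integral_mult_right_zero)
    then show ?thesis by (simp add: norm_mult)
  qed
  ultimately have "cmod (\<integral>t. state_integrand x \<epsilon> b (A 0) (C 0) t \<partial>lborel) = cmod (\<integral>t. state_integrand x \<epsilon> b (A 1) (C 1) t \<partial>lborel)"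
    by metis
  then show ?thesis by (simp add: A_def C_def)
qed

lemma cmod_integral_le:
  fixes f :: "'a \<Rightarrow> complex"
  assumes g: "integrable M g" and le: "\<And>x. cmod (f x) \<le> g x"
  shows "cmod (\<integral>x. f x \<partial>M) \<le> (\<integral>x. g x \<partial>M)"
proof (cases "integrable M f")
  case True
  have "cmod (\<integral>x. f x \<partial>M) \<le> (\<integral>x. cmod (f x) \<partial>M)" by (rule integral_norm_bound)
  also have "\<dots> \<le> (\<integral>x. g x \<partial>M)" using True g le by (intro integral_mono) auto
  finally show ?thesis .
next
  case False
  have "0 \<le> g x" for x using le[of x] norm_ge_zero order_trans by blast
  then show ?thesis using False by (simp add: not_integrable_integral_eq Bochner_Integration.integral_nonneg)
qed

lemma cmod_integral_state_integrand_le: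
  fixes a \<beta> c :: "real^'n::finite"
  assumes b: "0 < b" "b\<^sup>2 \<le> 1/8" and e: "\<And>k. \<epsilon> k \<in> {1, -1}"
    and pos: "\<And>k. 0 < a $ k" "\<And>k. \<delta> \<le> \<beta> $ k" "\<And>k. \<delta> \<le> c $ k" "\<And>k. a $ k + \<beta> $ k + c $ k = pi"
    and d: "0 < \<delta>" and a0: "\<And>k. 0 < pi - (1 + b\<^sup>2) * (pi - a $ k)"
  shows "cmod (\<integral>t. state_integrand x \<epsilon> b a c t \<partial>lborel)
    \<le> exp (\<Sum>k\<in>UNIV. tetrahedron_rate b (a $ k) (\<beta> $ k) (c $ k))
      * (2 / (pi * b * \<delta>)) ^ CARD('n)" (is "_ \<le> exp ?S * _")
proof -
  have m: "0 < pi * b * \<delta>" using b d by simp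
  have int: "integrable lborel (\<lambda>t::real^'n. exp ?S * exp (- (pi * b * \<delta>) * (\<Sum>k\<in>UNIV. \<bar>t $ k\<bar>)))"
    by (intro integrable_mult_right integral_exp_neg_sum_abs(1) m)
  have "cmod (\<integral>t. state_integrand x \<epsilon> b a c t \<partial>lborel)
    \<le> (\<integral>t. exp ?S * exp (- (pi * b * \<delta>) * (\<Sum>k\<in>UNIV. \<bar>t $ k\<bar>)) \<partial>(lborel :: (real^'n) measure))"
  proof (rule cmod_integral_le)
    show "integrable lborel (\<lambda>t::real^'n. exp ?S * exp (- (pi * b * \<delta>) * (\<Sum>k\<in>UNIV. \<bar>t $ k\<bar>)))" by (rule int)
  qed (rule cmod_state_integrand_le[OF b e pos d a0])
  also have "\<dots> = exp ?S * (2 / (pi * b * \<delta>)) ^ CARD('n)"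
    unfolding integral_mult_right_zero integral_exp_neg_sum_abs(2)[OF m] ..
  finally show ?thesis .
qed

section \<open>Comparison of exponential rates\<close>

lemma filterlim_hbar: "filterlim hbar (at_right 0) (at_right 0)"
proof -
  have ev: "\<forall>\<^sub>F b in at_right 0. (0::real) < b" by (simp add: eventually_at_right_less)
  have "((\<lambda>b::real. (b / (1 + b\<^sup>2))\<^sup>2) \<longlongrightarrow> (0 / (1 + 0\<^sup>2))\<^sup>2) (at_right 0)"
    by (intro tendsto_intros) auto
  then have "((\<lambda>b::real. (b / (1 + b\<^sup>2))\<^sup>2) \<longlongrightarrow> 0) (at_right 0)" by simp
  then have "(hbar \<longlongrightarrow> 0) (at_right 0)"
    by (rule Lim_transform_eventually) (use ev in \<open>auto elim!: eventually_mono simp: hbar_eq\<close>)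
  moreover have "\<forall>\<^sub>F b in at_right 0. hbar b \<in> {0<..} \<and> hbar b \<noteq> 0"
    using ev
  proof (rule eventually_mono)
    fix b :: real assume b: "0 < b"
    have "0 < b / (1 + b\<^sup>2)" using b by (intro divide_pos_pos add_pos_nonneg) auto
    then have "0 < hbar b" unfolding hbar_eq[OF b] by (rule zero_less_power)
    then show "hbar b \<in> {0<..} \<and> hbar b \<noteq> 0" by simp
  qed
  ultimately show ?thesis by (simp add: filterlim_at)
qed

text \<open>The prefactor does not vanish, and the correction \<open>1 + O(\<hbar>)\<close> has modulus at least one half when \<open>\<hbar>\<close> is small.\<close>

lemma asymptotic_expansion_lower_bound:
  assumes ae: "asymptotic_expansion x \<epsilon> e r0 l \<alpha> f f2 z \<delta> V"
    and nz: "det (calA x) \<noteq> 0" "det (NZ_B \<epsilon> e r0 l :: real^'n::finite^'n) \<noteq> 0"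
      "one_loop \<epsilon> e r0 l f f2 z \<noteq> 0" "\<delta> \<noteq> 0"
  obtains C where "0 < C"
    "\<forall>\<^sub>F b in at_right 0. C * exp (- 1 / (2 * pi * hbar b) * V) \<le> cmod (partition_function x \<epsilon> b \<alpha>)"
proof -
  let ?B = "NZ_B \<epsilon> e r0 l :: real^'n^'n"
  define X where "X = exp (\<i> / of_real pi * potential f f2 z) /
                   (of_real (det (calA x)) * csqrt (2 * of_real (det (matrix_inv ?B))))"
  define Y where "Y = csqrt (\<delta> * one_loop \<epsilon> e r0 l f f2 z)"
  obtain g :: "real \<Rightarrow> complex" where g: "g \<in> O[at_right 0](\<lambda>h. of_real h)"
    and ev: "\<forall>\<^sub>F h in at_right 0. \<forall>b>0. h = hbar b \<longrightarrow> cmod (partition_function x \<epsilon> b \<alpha>) =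
           cmod (X * (of_real (exp (- 1 / (2 * pi * h) * V)) / Y) * (1 + g h))"
    using ae unfolding asymptotic_expansion_def X_def Y_def by blast
  have "invertible ?B" using nz by (simp add: invertible_det_nz)
  then have "det (matrix_inv ?B) * det ?B = 1" using matrix_inv_left[of ?B] by (metis det_I det_mul)
  then have "det (matrix_inv ?B) \<noteq> 0" by auto
  then have X: "X \<noteq> 0" using nz by (simp add: X_def)
  have Y: "Y \<noteq> 0" using nz by (simp add: Y_def)
  have small: "\<forall>\<^sub>F h in at_right 0. cmod (g h) \<le> 1/2"
  proof -
    obtain c where c: "\<forall>\<^sub>F h in at_right 0. cmod (g h) \<le> c * cmod (of_real h :: complex)"
      using g unfolding bigo_def by auto
    have "((\<lambda>h::real. c * \<bar>h\<bar>) \<longlongrightarrow> c * \<bar>0\<bar>) (at_right 0)" by (intro tendsto_intros)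
    then have "((\<lambda>h::real. c * \<bar>h\<bar>) \<longlongrightarrow> 0) (at_right 0)" by simp
    then have "\<forall>\<^sub>F h::real in at_right 0. c * \<bar>h\<bar> < 1/2" by (rule order_tendstoD) simp
    with c show ?thesis by eventually_elim auto
  qed
  define C where "C = cmod X / cmod Y * (1/2)"
  have "0 < C" using X Y by (simp add: C_def)
  moreover have "\<forall>\<^sub>F b in at_right 0. C * exp (- 1 / (2 * pi * hbar b) * V) \<le> cmod (partition_function x \<epsilon> b \<alpha>)"
  proof -
    have "\<forall>\<^sub>F h in at_right 0. (\<forall>b>0. h = hbar b \<longrightarrow> C * exp (- 1 / (2 * pi * h) * V) \<le> cmod (partition_function x \<epsilon> b \<alpha>))"
      using ev small
    proof eventually_elim
      case (elim h)
      have "1/2 \<le> cmod (1 + g h)" using elim(2) norm_triangle_ineq2[of 1 "- g h"] by simp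
      then have "C * exp (- 1 / (2 * pi * h) * V) \<le> cmod X / cmod Y * cmod (1 + g h) * exp (- 1 / (2 * pi * h) * V)"
        unfolding C_def by (intro mult_right_mono mult_left_mono) auto
      also have "\<dots> = cmod (X * (of_real (exp (- 1 / (2 * pi * h) * V)) / Y) * (1 + g h))"
        by (simp add: norm_mult norm_divide)
      finally show ?case using elim(1) by auto
    qed
    then have "\<forall>\<^sub>F b in at_right 0. \<forall>b'>0. hbar b = hbar b' \<longrightarrow> C * exp (- 1 / (2 * pi * hbar b) * V) \<le> cmod (partition_function x \<epsilon> b' \<alpha>)"
      by (rule eventually_compose_filterlim[OF _ filterlim_hbar])
    moreover have "\<forall>\<^sub>F b in at_right 0. (0::real) < b" by (simp add: eventually_at_right_less)
    ultimately show ?thesis by eventually_elim auto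
  qed
  ultimately show ?thesis by (rule that)
qed

lemma lobachevsky_isCont: "0 < t \<Longrightarrow> t < pi \<Longrightarrow> isCont lobachevsky t"
  using lobachevsky_has_derivative DERIV_isCont by blast

lemma ideal_volume_scaled_tendsto:
  fixes p q r :: real
  assumes "0 < p" "0 < q" "0 < r" "p + q + r = pi"
  shows "((\<lambda>b. ideal_volume (pi - (1 + b\<^sup>2) * (pi - p)) ((1 + b\<^sup>2) * q) ((1 + b\<^sup>2) * r)) \<longlongrightarrow> ideal_volume p q r) (at_right 0)"
proof -
  have "((\<lambda>b::real. pi - (1 + b\<^sup>2) * (pi - p)) \<longlongrightarrow> pi - (1 + 0\<^sup>2) * (pi - p)) (at_right 0)"
    "((\<lambda>b::real. (1 + b\<^sup>2) * q) \<longlongrightarrow> (1 + 0\<^sup>2) * q) (at_right 0)"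
    "((\<lambda>b::real. (1 + b\<^sup>2) * r) \<longlongrightarrow> (1 + 0\<^sup>2) * r) (at_right 0)"
    by (intro tendsto_intros)+
  then have l: "((\<lambda>b::real. pi - (1 + b\<^sup>2) * (pi - p)) \<longlongrightarrow> p) (at_right 0)"
    "((\<lambda>b::real. (1 + b\<^sup>2) * q) \<longlongrightarrow> q) (at_right 0)" "((\<lambda>b::real. (1 + b\<^sup>2) * r) \<longlongrightarrow> r) (at_right 0)"
    by simp_all
  show ?thesis
    unfolding ideal_volume_def using assms l
    by (intro tendsto_intros isCont_tendsto_compose[OF lobachevsky_isCont]) auto
qed

text \<open>Take logarithms, multiply by \<open>2 pi b\<^sup>2\<close>, and let \<open>b\<close> tend to 0. The prefactor, polynomial in \<open>1 / b\<close>, disappears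
  because \<open>b\<^sup>2 ln b\<close> tends to 0, and the scaled angles tend to the given ones.\<close>

lemma volume_le_of_exponential_bounds:
  fixes p q r :: "real^'n::finite" and C C' V m :: real
  assumes pos: "\<And>k. 0 < p $ k" "\<And>k. 0 < q $ k" "\<And>k. 0 < r $ k" "\<And>k. p $ k + q $ k + r $ k = pi"
    and C: "0 < C" "0 < C'" "0 < m"
    and ev: "\<forall>\<^sub>F b in at_right 0. C * exp (- 1 / (2 * pi * hbar b) * V)
      \<le> C' * (exp (\<Sum>k\<in>UNIV. tetrahedron_rate b (p $ k) (q $ k) (r $ k))
      * (2 / (pi * b * m)) ^ CARD('n))"
  shows "(\<Sum>k\<in>UNIV. ideal_volume (p $ k) (q $ k) (r $ k)) \<le> V"
proof -
  define L where "L b k = ideal_volume (pi - (1 + b\<^sup>2) * (pi - p $ k)) ((1 + b\<^sup>2) * q $ k) ((1 + b\<^sup>2) * r $ k)" for b k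
  define W where "W b = (\<Sum>k\<in>(UNIV::'n set). 30 / (pi - (1 + b\<^sup>2) * (pi - p $ k)))" for b
  have L: "((\<lambda>b. \<Sum>k\<in>UNIV. L b k) \<longlongrightarrow> (\<Sum>k\<in>UNIV. ideal_volume (p $ k) (q $ k) (r $ k))) (at_right 0)"
    unfolding L_def using pos by (intro tendsto_sum ideal_volume_scaled_tendsto) auto
  have W: "(W \<longlongrightarrow> (\<Sum>k\<in>UNIV. 30 / (pi - (1 + 0\<^sup>2) * (pi - p $ k)))) (at_right 0)"
    unfolding W_def[abs_def] using pos(1) less_imp_neq by (intro tendsto_intros) (auto simp: less_le)
  define lo where "lo b = 2 * pi * b\<^sup>2 * ln C - (1 + b\<^sup>2)\<^sup>2 * V" for b
  define up where "up b = 2 * pi * b\<^sup>2 * (ln C' + CARD('n) * ln (2 / (pi * m)) + W b)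
      - 2 * pi * CARD('n) * (b * (b * ln b)) - (1 - 2 * pi * b\<^sup>2) * (\<Sum>k\<in>UNIV. L b k)" for b
  have lo: "(lo \<longlongrightarrow> 2 * pi * 0\<^sup>2 * ln C - (1 + 0\<^sup>2)\<^sup>2 * V) (at_right 0)"
    unfolding lo_def[abs_def] by (intro tendsto_intros)
  have up: "(up \<longlongrightarrow> 2 * pi * 0\<^sup>2 * (ln C' + CARD('n) * ln (2 / (pi * m)) + (\<Sum>k\<in>UNIV. 30 / (pi - (1 + 0\<^sup>2) * (pi - p $ k))))
     - 2 * pi * CARD('n) * (0 * 0) - (1 - 2 * pi * 0\<^sup>2) * (\<Sum>k\<in>UNIV. ideal_volume (p $ k) (q $ k) (r $ k))) (at_right 0)"
    unfolding up_def[abs_def] by (intro tendsto_intros L W x_ln_x_tendsto_0)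
  have "\<forall>\<^sub>F b in at_right 0. (0::real) < b" by (simp add: eventually_at_right_less)
  with ev have "\<forall>\<^sub>F b in at_right 0. lo b \<le> up b"
  proof eventually_elim
    case (elim b)
    note b = elim(2)
    let ?n = "1 / (2 * pi * b\<^sup>2)"
    have h: "- 1 / (2 * pi * hbar b) * V = - ?n * ((1 + b\<^sup>2)\<^sup>2 * V)"
      unfolding hbar_eq[OF b] by (simp add: power_divide)
    have S: "(\<Sum>k\<in>UNIV. 30 / (pi - (1 + b\<^sup>2) * (pi - p $ k)) - (?n - 1) * L b k) = W b - (?n - 1) * (\<Sum>k\<in>UNIV. L b k)"
      by (simp add: W_def sum_subtractf sum_distrib_left)
    have c: "0 < 2 / (pi * b * m)" using b C by simp
    have "ln (C * exp (- ?n * ((1 + b\<^sup>2)\<^sup>2 * V))) \<le> ln (C' * (exp (W b - (?n - 1) * (\<Sum>k\<in>UNIV. L b k)) * (2 / (pi * b * m)) ^ CARD('n)))"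
      using elim(1) C c unfolding h tetrahedron_rate_def L_def[symmetric] S by (subst ln_le_cancel_iff) auto
    moreover have "ln (C * exp (- ?n * ((1 + b\<^sup>2)\<^sup>2 * V))) = ln C - ?n * ((1 + b\<^sup>2)\<^sup>2 * V)"
      using C by (simp add: ln_mult)
    moreover have "ln (C' * (exp (W b - (?n - 1) * (\<Sum>k\<in>UNIV. L b k)) * (2 / (pi * b * m)) ^ CARD('n)))
      = ln C' + (W b - (?n - 1) * (\<Sum>k\<in>UNIV. L b k)) + CARD('n) * (ln (2 / (pi * m)) - ln b)"
    proof -
      have "2 / (pi * b * m) = 2 / (pi * m) / b" by simp
      then have "ln (2 / (pi * b * m)) = ln (2 / (pi * m)) - ln b" using b C by (simp only: ln_div) simp
      then show ?thesis using C c b by (simp add: ln_mult ln_realpow)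
    qed
    ultimately have "ln C - ?n * ((1 + b\<^sup>2)\<^sup>2 * V)
      \<le> ln C' + (W b - (?n - 1) * (\<Sum>k\<in>UNIV. L b k)) + CARD('n) * (ln (2 / (pi * m)) - ln b)" by simp
    then have "2 * pi * b\<^sup>2 * (ln C - ?n * ((1 + b\<^sup>2)\<^sup>2 * V))
      \<le> 2 * pi * b\<^sup>2 * (ln C' + (W b - (?n - 1) * (\<Sum>k\<in>UNIV. L b k)) + CARD('n) * (ln (2 / (pi * m)) - ln b))"
      using b by (intro mult_left_mono) auto
    moreover have n: "2 * pi * b\<^sup>2 * ?n = 1" using b by simp
    have "2 * pi * b\<^sup>2 * (ln C - ?n * ((1 + b\<^sup>2)\<^sup>2 * V)) = lo b"
      unfolding lo_def right_diff_distrib mult.assoc[symmetric] n by simp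
    moreover have "2 * pi * b\<^sup>2 * (ln C' + (W b - (?n - 1) * (\<Sum>k\<in>UNIV. L b k)) + CARD('n) * (ln (2 / (pi * m)) - ln b)) = up b"
    proof -
      have gen: "Z * (c' + (w - (N - 1) * s) + d * (u - v)) = Z * (c' + d * u + w) - d * (Z * v) - (Z * N - Z) * s"
        for Z c' w N s d u v :: real by (simp add: algebra_simps)
      have e: "d * (2 * pi * b\<^sup>2 * v) = 2 * pi * d * (b * (b * v))" for d v :: real
        by (simp add: power2_eq_square)
      show ?thesis unfolding up_def gen n e ..
    qed
    ultimately show ?case by simp
  qed
  from tendsto_le[OF _ up lo this] show ?thesis by simp
qed

lemma Vol_le_ideal_volume_sum:
  assumes "(a, \<beta>, c) \<in> angle_structures x"
  shows "Vol (a, \<beta>, c) \<le> (\<Sum>k\<in>UNIV. ideal_volume (a $ k) (\<beta> $ k) (c $ k))"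
  unfolding Vol_def case_prod_conv using assms
  by (intro sum_mono tet_volume_le_ideal_volume) (auto simp: angle_structures_def)

lemma Vol_le_of_asymptotic_expansion:
  fixes x :: "nat \<Rightarrow> 'n::finite \<Rightarrow> 'n + 'n"
  assumes eps: "\<And>T. \<epsilon> T \<in> {1, -1}"
    and al: "\<alpha> \<in> angle_structures x" "\<alpha>' \<in> angle_structures x" and H: "HR \<epsilon> l \<alpha>' = HR \<epsilon> l \<alpha>"
    and l: "normal_closed_curve x l" and e: "e ` (- {r0}) \<subseteq> edges x" and F: "FAMED x \<epsilon> e r0 l"
    and tau: "one_loop \<epsilon> e r0 l f f2 z \<noteq> 0" and \<delta>: "\<delta> \<noteq> 0"
    and ae: "asymptotic_expansion x \<epsilon> e r0 l \<alpha> f f2 z \<delta> V"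
  shows "Vol \<alpha>' \<le> V"
proof -
  obtain a \<beta> c where \<alpha>: "\<alpha> = (a, \<beta>, c)" by (metis prod_cases3)
  obtain a' \<beta>' c' where \<alpha>': "\<alpha>' = (a', \<beta>', c')" by (metis prod_cases3)
  have pos: "0 < a $ k" "0 < \<beta> $ k" "0 < c $ k" "a $ k + \<beta> $ k + c $ k = pi"
    "0 < a' $ k" "0 < \<beta>' $ k" "0 < c' $ k" "a' $ k + \<beta>' $ k + c' $ k = pi" for k
    using al unfolding \<alpha> \<alpha>' by (auto simp: angle_structures_def)
  \<comment> \<open>All angles of both structures; half of the smallest one serves as a uniform margin.\<close>
  define S where "S = (\<Union>k. {a $ k, \<beta> $ k, c $ k, a' $ k, \<beta>' $ k, c' $ k})"
  have S: "finite S" "S \<noteq> {}" "\<And>s. s \<in> S \<Longrightarrow> 0 < s" unfolding S_def using pos by auto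
  define d where "d = Min S / 2"
  have d: "0 < d" unfolding d_def using S by simp
  have ge: "2 * d \<le> a $ k" "2 * d \<le> \<beta> $ k" "2 * d \<le> c $ k" "2 * d \<le> a' $ k" "2 * d \<le> \<beta>' $ k" "2 * d \<le> c' $ k" for k
  proof -
    have "2 * d \<le> s" if "s \<in> S" for s using Min_le[OF S(1) that] by (simp add: d_def)
    moreover have "{a $ k, \<beta> $ k, c $ k, a' $ k, \<beta>' $ k, c' $ k} \<subseteq> S" unfolding S_def by blast
    ultimately show "2 * d \<le> a $ k" "2 * d \<le> \<beta> $ k" "2 * d \<le> c $ k" "2 * d \<le> a' $ k" "2 * d \<le> \<beta>' $ k" "2 * d \<le> c' $ k"
      by auto
  qed
  have det: "det (calA x) \<noteq> 0" "det (NZ_B \<epsilon> e r0 l :: real^'n^'n) \<noteq> 0" using F by (auto simp: FAMED_def)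
  note K = kinetic_angle_difference[OF al[unfolded \<alpha> \<alpha>'] e l eps H[unfolded \<alpha> \<alpha>'] F]
  obtain C where C: "0 < C"
    and lower: "\<forall>\<^sub>F b in at_right 0. C * exp (- 1 / (2 * pi * hbar b) * V) \<le> cmod (partition_function x \<epsilon> b \<alpha>)"
    using asymptotic_expansion_lower_bound[OF ae det tau \<delta>] by blast
  have "((\<lambda>b::real. (1 + b\<^sup>2) * (pi - d)) \<longlongrightarrow> (1 + 0\<^sup>2) * (pi - d)) (at_right 0)"
    by (intro tendsto_intros)
  then have ev1: "\<forall>\<^sub>F b::real in at_right 0. (1 + b\<^sup>2) * (pi - d) < pi"
    by (rule order_tendstoD) (use d in simp)
  have "((\<lambda>b::real. b\<^sup>2) \<longlongrightarrow> 0\<^sup>2) (at_right 0)" by (intro tendsto_intros)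
  then have ev2: "\<forall>\<^sub>F b::real in at_right 0. b\<^sup>2 < 1/8" by (rule order_tendstoD) simp
  have ev3: "\<forall>\<^sub>F b in at_right 0. (0::real) < b" by (simp add: eventually_at_right_less)
  have "(\<Sum>k\<in>UNIV. ideal_volume (a' $ k) (\<beta>' $ k) (c' $ k)) \<le> V"
  proof (rule volume_le_of_exponential_bounds[OF pos(5-8) C _ d])
    show "0 < 1 / \<bar>det (calA x)\<bar>" using det by simp
    show "\<forall>\<^sub>F b in at_right 0. C * exp (- 1 / (2 * pi * hbar b) * V)
      \<le> 1 / \<bar>det (calA x)\<bar> * (exp (\<Sum>k\<in>UNIV. tetrahedron_rate b (a' $ k) (\<beta>' $ k) (c' $ k))
      * (2 / (pi * b * d)) ^ CARD('n))" (is "\<forall>\<^sub>F b in at_right 0. ?lo b \<le> ?D * ?up b")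
      using lower ev1 ev2 ev3
    proof eventually_elim
      case (elim b)
      then have b: "0 < b" "b\<^sup>2 \<le> 1/8" by auto
      have a0: "0 < pi - (1 + b\<^sup>2) * (pi - a' $ k)" for k
      proof -
        have "(1 + b\<^sup>2) * (pi - a' $ k) \<le> (1 + b\<^sup>2) * (pi - d)"
          using ge(4)[of k] d by (intro mult_left_mono) auto
        then show ?thesis using elim(2) by linarith
      qed
      have le: "d \<le> \<beta>' $ k" "d \<le> c' $ k" for k using ge(5,6)[of k] d by auto
      have "cmod (partition_function x \<epsilon> b \<alpha>) = cmod (\<integral>t. state_integrand x \<epsilon> b a' c' t \<partial>lborel) / \<bar>det (calA x)\<bar>"
        unfolding \<alpha> cmod_partition_function
          cmod_integral_state_integrand_eq[OF b eps d ge pos(4,8) elim(2) K] ..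
      also have "\<dots> \<le> ?up b / \<bar>det (calA x)\<bar>"
        using cmod_integral_state_integrand_le[OF b eps pos(5) le pos(8) d a0]
        by (intro divide_right_mono) auto
      finally show ?case using elim(1) by simp
    qed
  qed
  then show ?thesis using Vol_le_ideal_volume_sum[OF al(2)[unfolded \<alpha>']] unfolding \<alpha>' by linarith
qed

theorem corollary1p20:
  fixes M :: "'m topology"
    and \<Gamma> :: "(complex^2^2) set"
    and \<pi> :: "complex \<times> real \<Rightarrow> 'm"
    and x :: "nat \<Rightarrow> 'n::finite \<Rightarrow> 'n + 'n"
    and q :: "'n \<times> (nat \<Rightarrow> real) \<Rightarrow> 'm"
    and s :: "'n \<Rightarrow> (nat \<Rightarrow> real) \<Rightarrow> complex \<times> real"
    and \<epsilon> :: "'n \<Rightarrow> int"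
    and \<alpha> :: "'n angles"
    and l :: "'n normal_curve"
    and e :: "'n \<Rightarrow> ('n \<times> nat \<times> nat) set"
    and r0 :: "'n"
    and f f1 f2 :: "int^'n"
    and dev :: "complex \<times> real \<Rightarrow> complex \<times> real"
    and v :: "complex option \<Rightarrow> complex option"
    and z :: "complex^'n"
    and V :: real
    and \<delta> :: complex
  assumes "hyperbolic_manifold \<Gamma> M \<pi>"
    and "one_torus_cusp M"
    and "trivial_group (homology_group 2 M)"
    and "ordered_ideal_triangulation M x q"
    and "tet_lifts \<pi> q s"
    and "\<epsilon> = tet_sign s"
    and "\<alpha> \<in> angle_structures x"
    and "peripheral_scc M x q l"
    and "independent_edges x \<epsilon> e r0"
    and "FAMED x \<epsilon> e r0 l"
    and "strong_flattening M x q \<epsilon> e r0 f f1 f2"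
    and "cone_structure \<Gamma> dev v"
    and "V \<ge> 0" and "structure_volume \<Gamma> dev (ennreal V)"
    and "shape_parameters \<epsilon> s v z"
    and "gluing_equations \<epsilon> e r0 l z (HR \<epsilon> l \<alpha>)"
    and "HC \<epsilon> l z = \<i> * of_real (HR \<epsilon> l \<alpha>)"
    and "one_loop \<epsilon> e r0 l f f2 z \<noteq> 0"
    and "\<delta> \<in> {1, -1}"
    and "asymptotic_expansion x \<epsilon> e r0 l \<alpha> f f2 z \<delta> V"
  shows "(SUP \<alpha>' \<in> {\<alpha>' \<in> angle_structures x. HR \<epsilon> l \<alpha>' = HR \<epsilon> l \<alpha>}. ereal (Vol \<alpha>')) \<le> ereal V"
proof (rule SUP_least)
  fix \<alpha>' assume "\<alpha>' \<in> {\<alpha>' \<in> angle_structures x. HR \<epsilon> l \<alpha>' = HR \<epsilon> l \<alpha>}"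
  then have \<alpha>': "\<alpha>' \<in> angle_structures x" "HR \<epsilon> l \<alpha>' = HR \<epsilon> l \<alpha>" by auto
  have "Vol \<alpha>' \<le> V"
  proof (rule Vol_le_of_asymptotic_expansion[OF _ assms(7) \<alpha>' _ _ assms(10) assms(18) _ assms(20)])
    show "\<epsilon> T \<in> {1, -1}" for T using assms(6) by (simp add: tet_sign_def)
    show "normal_closed_curve x l" using assms(8) by (simp add: peripheral_scc_def)
    show "e ` (- {r0}) \<subseteq> edges x" using assms(9) by (simp add: independent_edges_def)
    show "\<delta> \<noteq> 0" using assms(19) by auto
  qed
  then show "ereal (Vol \<alpha>') \<le> ereal V" by simp
qed

end
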